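(* Let $F$ be a function on $(0,\infty)$ and let $A=A(x,y)$, $y\ge x\ge 0$, be related to $F$ by the Marchenko equation $$A(x,y)+\int_x^\infty A(x,t)F(t+y)\,dt=-F(x+y),\qquad y\ge x\ge 0 .$$ Let $x_0\ge 0$ be such that $\int_{2x_0}^\infty\sigma_F(y)\,dy<1$, where $\sigma_F(x)=\sup_{y\ge x}|F(y)|$. (i) Assume $\sigma_F\in L^1(0,\infty)$ and $\int_0^\infty x|F'(x)|\,dx<\infty$, and put $\sigma_{1F}(x)=\int_x^\infty\sigma_F(y)\,dy$. Then there is a constant $c>0$, which may depend on $x_0$ but does not depend on $x$, such that for all $x\ge x_0$ $$\sigma_A(x)\le c\,\sigma_F(2x),\qquad \sigma_{1A}(x)\le c\,\sigma_{1F}(2x),$$ $$\|A_y\|_1\le \sigma_{2F}(2x)\bigl(1+c\,\sigma_{1F}(2x)\bigr),\qquad \|A_x\|_1\le c\bigl[\sigma_{2F}(2x)+\sigma_{1F}(2x)\sigma_F(2x)\bigr].$$ (ii) Conversely, if for $x\ge x_0$ $$\sigma_A(x)+\sigma_{1A}(x)+\|A_x\|_1+\|A_y\|_1<\infty ,$$ then, with a constant $c>0$ which may depend on $x_0$ but does not depend on $x$, for $x\ge x_0$ $$\sigma_F(2x)\le c\,\sigma_A(x),\qquad \int_{2x}^\infty|F(v)|\,dv\le c\,\sigma_{1A}(x),\qquad \sigma_{2F}(2x)\le c\bigl[\sigma_A(x)\sigma_{1A}(x)+\|A_x\|_1(1+\sigma_{1A}(x))\bigr].$$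
   Context: Notation: $\sigma_{2F}(x)=\int_x^\infty|F'(y)|\,dy$; $\sigma_A(x)=\sup_{y\ge x}|A(x,y)|$; $\sigma_{1A}(x)=\int_x^\infty|A(x,s)|\,ds$; $A_x=\partial A/\partial x$, $A_y=\partial A/\partial y$, and $\|A_x\|_1=\int_x^\infty|A_x(x,y)|\,dy$, $\|A_y\|_1=\int_x^\infty|A_y(x,y)|\,dy$ (these norms are functions of $x$). $F'$, $A_x$, $A_y$ are understood as (almost everywhere / weak) derivatives, with $F$ locally absolutely continuous where $F'$ is used. For $x\ge x_0$ the Marchenko equation is considered for $A(x,\cdot)\in L^1(x,\infty)$; the condition on $x_0$ makes it uniquely solvable there. The letter $c$ may denote different constants in different inequalities. *)

theory Defs
  imports "HOL-Analysis.Analysis"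
begin

text \<open>
  Functions are complex-valued, which covers the real case. All suprema and all integrals of
  moduli are taken in \<^typ>\<open>ennreal\<close>, so \<open>\<sigma>(x) < \<infinity>\<close> has its usual meaning and no
  quantity collapses to a default value when it is infinite.

  \<open>F\<close> is a function on \<open>(0,\<infinity>)\<close>. The Marchenko equation at the corner \<open>x = y = 0\<close> refers to
  the number \<open>F 0\<close>, so an arbitrary value \<open>F 0\<close> is allowed; it enters nothing else but
  \<open>\<sigma>\<^sub>F(0)\<close>, and no continuity of \<open>F\<close> at \<open>0\<close> is assumed.
\<close>

definition absolutely_continuous_on :: "real set \<Rightarrow> (real \<Rightarrow> complex) \<Rightarrow> bool" where
  "absolutely_continuous_on S f \<longleftrightarrow>
     (\<forall>\<epsilon>>0. \<exists>\<delta>>0. \<forall>D :: (real \<times> real) set.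
        finite D \<longrightarrow> (\<forall>(u, v)\<in>D. u \<le> v \<and> {u..v} \<subseteq> S) \<longrightarrow>
        pairwise (\<lambda>(u, v) (u', v'). {u<..<v} \<inter> {u'<..<v'} = {}) D \<longrightarrow>
        (\<Sum>(u, v)\<in>D. v - u) < \<delta> \<longrightarrow> (\<Sum>(u, v)\<in>D. norm (f v - f u)) < \<epsilon>)"

text \<open>
  Local absolute continuity on an open interval. The almost everywhere differentiability is a
  consequence of the first conjunct (Lebesgue); it is recorded because the weak derivative is
  then the pointwise one, \<open>vector_derivative f (at t)\<close>.
\<close>

definition loc_abs_cont_on :: "real set \<Rightarrow> (real \<Rightarrow> complex) \<Rightarrow> bool" where
  "loc_abs_cont_on S f \<longleftrightarrow>
     (\<forall>a b. {a..b} \<subseteq> S \<longrightarrow> absolutely_continuous_on {a..b} f) \<and>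
     (AE t in lebesgue. t \<in> S \<longrightarrow> f differentiable (at t))"

definition sigma_F :: "(real \<Rightarrow> complex) \<Rightarrow> real \<Rightarrow> ennreal" where
  "sigma_F F x = (SUP y\<in>{x..}. ennreal (norm (F y)))"

definition sigma_1F :: "(real \<Rightarrow> complex) \<Rightarrow> real \<Rightarrow> ennreal" where
  "sigma_1F F x = (\<integral>\<^sup>+ y \<in> {x..}. sigma_F F y \<partial>lebesgue)"

definition sigma_2F :: "(real \<Rightarrow> complex) \<Rightarrow> real \<Rightarrow> ennreal" where
  "sigma_2F F x = (\<integral>\<^sup>+ y \<in> {x..}. ennreal (norm (vector_derivative F (at y))) \<partial>lebesgue)"

definition sigma_A :: "(real \<Rightarrow> real \<Rightarrow> complex) \<Rightarrow> real \<Rightarrow> ennreal" where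
  "sigma_A A x = (SUP y\<in>{x..}. ennreal (norm (A x y)))"

definition sigma_1A :: "(real \<Rightarrow> real \<Rightarrow> complex) \<Rightarrow> real \<Rightarrow> ennreal" where
  "sigma_1A A x = (\<integral>\<^sup>+ s \<in> {x..}. ennreal (norm (A x s)) \<partial>lebesgue)"

text \<open>
  The norms \<open>\<parallel>A\<^sub>y\<parallel>\<^sub>1\<close> and \<open>\<parallel>A\<^sub>x\<parallel>\<^sub>1\<close> as functions of \<open>x\<close>, with the value \<open>\<infinity>\<close> if the derivative
  does not exist. Thus a finite upper bound includes the existence of the derivative.
\<close>

definition norm_Ay :: "(real \<Rightarrow> real \<Rightarrow> complex) \<Rightarrow> real \<Rightarrow> ennreal" where
  "norm_Ay A x =
     (if loc_abs_cont_on {x<..} (A x)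
      then \<integral>\<^sup>+ y \<in> {x<..}. ennreal (norm (vector_derivative (A x) (at y))) \<partial>lebesgue
      else \<infinity>)"

text \<open>
  \<open>A\<close> is considered on \<open>y \<ge> x \<ge> x\<^sub>0\<close>, so \<open>A\<^sub>x(x,y)\<close> is the derivative of \<open>s \<mapsto> A(s,y)\<close> within
  \<open>[x\<^sub>0,y]\<close>: the two-sided one for \<open>x\<^sub>0 < x < y\<close> and the right-hand one for \<open>x = x\<^sub>0\<close>. It is
  required at the given \<open>x\<close> for almost every \<open>y\<close>, since the norm is a function of every \<open>x\<close>,
  and not only of almost every \<open>x\<close>.
\<close>

definition norm_Ax :: "real \<Rightarrow> (real \<Rightarrow> real \<Rightarrow> complex) \<Rightarrow> real \<Rightarrow> ennreal" where
  "norm_Ax x0 A x =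
     (if (AE y in lebesgue. x < y \<longrightarrow>
            loc_abs_cont_on {x<..<y} (\<lambda>s. A s y) \<and>
            (\<lambda>s. A s y) differentiable (at x within {x0..y}))
      then \<integral>\<^sup>+ y \<in> {x<..}.
             ennreal (norm (vector_derivative (\<lambda>s. A s y) (at x within {x0..y}))) \<partial>lebesgue
      else \<infinity>)"

definition marchenko :: "(real \<Rightarrow> complex) \<Rightarrow> (real \<Rightarrow> real \<Rightarrow> complex) \<Rightarrow> real \<Rightarrow> bool" where
  "marchenko F A x0 \<longleftrightarrow>
     (\<forall>x\<ge>x0. \<forall>y\<ge>x.
        A x y + (LINT t:{x..}|lebesgue. A x t * F (t + y)) = - F (x + y))"

end

theory Submission
  imports Defs
begin

text \<open>
  Put \<open>b\<^sub>x(t) = A(x, x + t)\<close> for \<open>t > 0\<close>. In these coordinates the Marchenko equation lives on a half-line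
  that does not depend on \<open>x\<close>: it reads \<open>(1 + K\<^sub>x) b\<^sub>x = - F(2x + \<cdot>)\<close> with
  \<open>(K\<^sub>x g)(s) = \<integral>\<^sub>0\<^sup>\<infinity> g(t) F(2x + s + t) dt\<close>. By Tonelli, \<open>K\<^sub>x\<close> has norm at most
  \<open>\<integral>\<^bsub>2x\<^esub>\<^sup>\<infinity> |F| \<le> q = \<integral>\<^bsub>2x\<^sub>0\<^esub>\<^sup>\<infinity> \<sigma>\<^sub>F < 1\<close> on \<open>L\<^sup>1(0,\<infinity>)\<close> (\<open>tail_corr_le\<close>), so
  \<open>\<parallel>g\<parallel> \<le> (1 - q)\<^sup>-\<^sup>1 \<parallel>(1 + K\<^sub>x) g\<parallel>\<close> for every integrable \<open>g\<close> (\<open>tail_le_absorb\<close>). This inequality is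
  behind all estimates. Applied to \<open>b\<^sub>x\<close> it gives the bounds of \<open>\<sigma>\<^sub>1\<^sub>A\<close> and \<open>\<sigma>\<^sub>A\<close>; the equation itself,
  solved for \<open>F\<close>, gives the first two bounds of the converse.

  The derivatives are reached through difference quotients, because \<open>A\<^sub>x(x, y)\<close> has to exist at every
  \<open>x\<close>, for almost every \<open>y\<close>, and not only almost everywhere in both variables. If \<open>F' \<in> L\<^sup>1\<close>, the
  difference quotients of \<open>F\<close> converge to \<open>F'\<close> in \<open>L\<^sup>1\<close>: they converge almost everywhere and their norms
  do not exceed that of \<open>F'\<close> in the limit, so that Scheffe's lemma applies (\<open>tail_quot_diff_tendsto\<close>).
  In \<open>A(x, y) = - F(x + y) - \<integral>\<^sub>0\<^sup>\<infinity> b\<^sub>x(t) F(x + y + t) dt\<close> the \<open>y\<close>-derivative falls on \<open>F\<close> only, and the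
  bound of \<open>\<parallel>A\<^sub>y\<parallel>\<^sub>1\<close> follows. For the \<open>x\<close>-derivative let \<open>D\<^sub>h = (b\<^bsub>x+h\<^esub> - b\<^sub>x) / h\<close>. It solves
  \<open>(1 + K\<^bsub>x+h\<^esub>) D\<^sub>h = R\<^sub>h\<close>, where \<open>R\<^sub>h\<close> is made of difference quotients of \<open>F\<close> and converges in \<open>L\<^sup>1\<close>. Hence
  \<open>D\<^sub>h\<close> is bounded by a multiple of \<open>\<integral>\<^bsub>2x\<^esub>\<^sup>\<infinity> |F'|\<close> and is Cauchy in \<open>L\<^sup>1\<close> as \<open>h \<rightarrow> 0\<close>
  (\<open>tail_b_quot_le\<close>, \<open>tail_b_quot_Cauchy\<close>). The difference quotient of \<open>s \<mapsto> A(s, y)\<close> at \<open>x\<close> is minus that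
  of \<open>F\<close> at \<open>x + y\<close> minus \<open>\<integral> D\<^sub>h(t) F(x + h + y + t) dt\<close> minus an integral of \<open>b\<^sub>x\<close> against difference quotients
  of \<open>F\<close>. The last two terms are Cauchy uniformly in \<open>y\<close> and also in \<open>L\<^sup>1(dy)\<close>. So \<open>A\<^sub>x(x, y)\<close> exists
  wherever \<open>F'(x + y)\<close> does, the difference quotients converge to it in \<open>L\<^sup>1\<close>
  (\<open>tail_quot_a_ax_tendsto\<close>), and \<open>\<parallel>A\<^sub>x\<parallel>\<^sub>1 \<le> c \<sigma>\<^sub>2\<^sub>F(2x)\<close>.

  For the converse \<open>F' \<in> L\<^sup>1(2x\<^sub>0, \<infinity>)\<close> has to be proved first (\<open>sigma_2F_finite\<close>). The equation
  \<open>F'(x + y) = - A\<^sub>y(x, y) - \<integral>\<^sub>0\<^sup>\<infinity> b\<^sub>x(t) F'(x + y + t) dt\<close>, read for difference quotients, is of Volterra type.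
  Since \<open>b\<^sub>x\<close> is bounded uniformly in \<open>x \<ge> x\<^sub>0\<close>, the part \<open>t \<le> d\<close> of the integral can be absorbed for a small
  fixed \<open>d\<close>; the part \<open>t > d\<close> involves only \<open>F'\<close> beyond \<open>2x + d\<close>. Finitely many steps of length \<open>d/2\<close> lead
  from large \<open>x\<close>, where \<open>\<parallel>b\<^sub>x\<parallel> \<le> 1/2\<close>, down to \<open>x\<^sub>0\<close>. After that, the difference of the equations at \<open>x + h\<close>
  and \<open>x\<close> bounds the difference quotient of \<open>F\<close> by that of \<open>A\<close>, by its integral against \<open>F\<close>, and by the
  mean of \<open>A(x, t) F(t + y)\<close> over \<open>x \<le> t \<le> x + h\<close>; the \<open>L\<^sup>1\<close> convergence above allows \<open>h \<rightarrow> 0\<close>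
  (\<open>tail_k_le_tail_ax\<close>).
\<close>

section \<open>Absolutely continuous functions\<close>

text \<open>
  The fundamental theorem of calculus with an exceptional null set \<open>N\<close>. Outside \<open>N\<close> the gauge is the
  one of the classical proof. At the points of \<open>N\<close> it forces the intervals into an open set \<open>U\<close> of
  measure less than \<open>\<delta>\<close>, and the increments of \<open>g\<close> over these intervals are small by absolute
  continuity.
\<close>

lemma has_integral_derivative_absolutely_continuous:
  fixes g g' :: "real \<Rightarrow> complex"
  assumes "a \<le> b"
    and ac: "absolutely_continuous_on {a..b} g"
    and N: "negligible N"
    and vecd: "\<And>x. x \<in> {a..b} - N \<Longrightarrow> (g has_vector_derivative g' x) (at x within {a..b})"
  shows "(g' has_integral g b - g a) {a..b}"
proof -
  define f' where "f' = (\<lambda>x. if x \<in> N then 0 else g' x)"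
  have "(f' has_integral g b - g a) {a..b}"
    unfolding has_integral_real
  proof (intro allI impI)
    fix e :: real assume e: "e > 0"
    define e1 where "e1 = e / (2 * (b - a + 1))"
    have e1: "e1 > 0" "e1 * (b - a) < e / 2" using e \<open>a \<le> b\<close> by (auto simp: e1_def field_simps)
    obtain \<delta> where "\<delta> > 0" and \<delta>: "\<And>D. finite D \<Longrightarrow> (\<forall>(u, v)\<in>D. u \<le> v \<and> {u..v} \<subseteq> {a..b}) \<Longrightarrow>
        pairwise (\<lambda>(u, v) (u', v'). {u<..<v} \<inter> {u'<..<v'} = {}) D \<Longrightarrow>
        (\<Sum>(u, v)\<in>D. v - u) < \<delta> \<Longrightarrow> (\<Sum>(u, v)\<in>D. norm (g v - g u)) < e / 2"
      using ac[unfolded absolutely_continuous_on_def, rule_format, of "e / 2"] e by auto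
    have "N \<in> sets lebesgue" "emeasure lebesgue N = 0"
      using N negligible_iff_null_sets by (auto simp: null_sets_def)
    then obtain U where U: "open U" "N \<subseteq> U" "emeasure lebesgue (U - N) < ennreal \<delta>"
      using sets_lebesgue_outer_open[of N \<delta>] \<open>\<delta> > 0\<close> by metis
    have U': "U \<in> lmeasurable" "measure lebesgue U < \<delta>"
    proof -
      have "emeasure lebesgue U = emeasure lebesgue (U - N) + emeasure lebesgue N"
        using U \<open>N \<in> sets lebesgue\<close> Un_absorb2[OF U(2)]
        by (subst plus_emeasure) (auto simp del: Un_Diff_cancel2 simp: Un_commute)
      then have "emeasure lebesgue U < ennreal \<delta>" using U(3) \<open>emeasure lebesgue N = 0\<close> by simp
      then show m: "U \<in> lmeasurable"
        using U(1) by (auto simp: fmeasurable_def intro: order.strict_trans)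
      then show "measure lebesgue U < \<delta>"
        using \<open>emeasure lebesgue U < ennreal \<delta>\<close> \<open>\<delta> > 0\<close>
        by (simp only: emeasure_eq_measure2 ennreal_less_iff measure_nonneg)
    qed
    have "\<exists>d>0. (x \<in> {a..b} - N \<longrightarrow>
         (\<forall>y\<in>{a..b}. norm (y-x) < d \<longrightarrow> norm (g y - g x - (y-x) *\<^sub>R g' x) \<le> e1 * norm (y-x)))
         \<and> (x \<in> N \<longrightarrow> ball x d \<subseteq> U)" for x
    proof (cases "x \<in> N")
      case True
      then show ?thesis using U by (meson DiffE openE subsetD)
    next
      case False
      then show ?thesis
        using vecd[unfolded has_vector_derivative_def has_derivative_within_alt] \<open>e1 > 0\<close>
        by (cases "x \<in> {a..b}") (auto intro: exI[of _ 1])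
    qed
    then obtain d where d: "\<And>x. 0 < d x"
       "\<And>x y. \<lbrakk>x \<in> {a..b} - N; y \<in> {a..b}; norm (y-x) < d x\<rbrakk>
                        \<Longrightarrow> norm (g y - g x - (y-x) *\<^sub>R g' x) \<le> e1 * norm (y-x)"
       "\<And>x. x \<in> N \<Longrightarrow> ball x (d x) \<subseteq> U"
      by metis
    show "\<exists>\<gamma>. gauge \<gamma> \<and> (\<forall>p. p tagged_division_of {a..b} \<and> \<gamma> fine p \<longrightarrow>
            norm ((\<Sum>(x, k)\<in>p. measure lborel k *\<^sub>R f' x) - (g b - g a)) < e)"
    proof (intro exI conjI allI impI; (elim conjE)?)
      show "gauge (\<lambda>x. ball x (d x))" using d(1) gauge_ball_dependent by blast
    next
      fix p
      assume ptag: "p tagged_division_of {a..b}" and finep: "(\<lambda>x. ball x (d x)) fine p"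
      have fin: "finite p" using ptag by blast
      have ba: "b - a = (\<Sum>(x,K)\<in>p. Sup K - Inf K)" "g b - g a = (\<Sum>(x,K)\<in>p. g(Sup K) - g(Inf K))"
        using additive_tagged_division_1[where f= "\<lambda>x. x"] additive_tagged_division_1[where f= g]
              \<open>a \<le> b\<close> ptag by auto
      have pK: "\<exists>u v. K = {u..v} \<and> u \<le> v \<and> x \<in> {u..v} \<and> {u..v} \<subseteq> {a..b}" if "(x, K) \<in> p" for x K
        using tagged_division_ofD(2,3,4)[OF ptag that] by (auto simp: box_real)
      \<comment> \<open>The degenerate intervals are left out because several tags may share one of them.\<close>
      define p1 where "p1 = {(x,K) \<in> p. x \<in> N \<and> Inf K < Sup K}"
      have p1: "p1 \<subseteq> p" "finite p1" using fin by (auto simp: p1_def intro: rev_finite_subset)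
      define w where "w = (\<lambda>(x,K). measure lborel K *\<^sub>R f' x - (g(Sup K) - g(Inf K)))"
      have "norm (sum w (p - p1)) \<le> (\<Sum>n\<in>p-p1. e1 * (case n of (x, k) \<Rightarrow> Sup k - Inf k))"
      proof (rule sum_norm_le)
        fix n assume n: "n \<in> p - p1"
        obtain x K where [simp]: "n = (x, K)" by fastforce
        have xK: "(x, K) \<in> p" "(x, K) \<notin> p1" using n by auto
        obtain u v where k: "K = {u..v}" "u \<le> v" "x \<in> {u..v}" "{u..v} \<subseteq> {a..b}" using pK[OF xK(1)] by auto
        have "norm (w (x,K)) \<le> e1 * (Sup K - Inf K)"
        proof (cases "x \<in> N")
          case True
          then have "u = v" using xK k by (auto simp: p1_def)
          then show ?thesis using k by (simp add: w_def)
        next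
          case False
          have ball: "\<forall>y\<in>K. y \<in> ball x (d x)" using finep xK(1) by blast
          have "norm ((v - u) *\<^sub>R g' x - (g v - g u)) = norm (g u - g x - (u - x) *\<^sub>R g' x - (g v - g x - (v - x) *\<^sub>R g' x))"
            by (auto simp: algebra_simps)
          also have "\<dots> \<le> norm (g u - g x - (u - x) *\<^sub>R g' x) + norm (g v - g x - (v - x) *\<^sub>R g' x)"
            by (rule norm_triangle_ineq4)
          also have "\<dots> \<le> e1 * norm (u - x) + e1 * norm (v - x)"
            using k ball[rule_format, of u] ball[rule_format, of v] False by (intro add_mono d(2)) (auto simp: dist_real_def)
          also have "\<dots> \<le> e1 * (v - u)" using k by (auto simp: algebra_simps)
          finally show ?thesis using k False by (simp add: w_def f'_def)
        qed
        then show "norm (w n) \<le> e1 * (case n of (x, k) \<Rightarrow> Sup k - Inf k)" by simp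
      qed
      also have "\<dots> \<le> (\<Sum>n\<in>p. e1 * (case n of (x, k) \<Rightarrow> Sup k - Inf k))"
      proof (rule sum_mono2)
        fix n assume n: "n \<in> p - (p - p1)"
        obtain x K where [simp]: "n = (x, K)" by fastforce
        have "Inf K \<le> Sup K" using pK[of x K] n by auto
        then show "0 \<le> e1 * (case n of (x, k) \<Rightarrow> Sup k - Inf k)" using e1 by simp
      qed (use fin in auto)
      also have "\<dots> = e1 * (b - a)"
        by (simp add: ba(1) sum_distrib_left split_def)
      finally have 1: "norm (sum w (p - p1)) < e / 2" using e1 by linarith
      define r where "r = (\<lambda>(x::real, K::real set). (Inf K, Sup K))"
      have disj: "{Inf K<..<Sup K} \<inter> {Inf K'<..<Sup K'} = {}" if kk: "(x,K) \<in> p" "(x',K') \<in> p" "(x,K) \<noteq> (x',K')" for x x' K K'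
      proof -
        obtain u v u' v' where "K = {u..v}" "u \<le> v" "K' = {u'..v'}" "u' \<le> v'"
          using pK[OF kk(1)] pK[OF kk(2)] by blast
        then show ?thesis using tagged_division_ofD(5)[OF ptag kk] by (simp add: interior_atLeastAtMost_real)
      qed
      have inj: "inj_on r p1"
      proof (rule inj_onI, rule ccontr)
        fix s t assume st: "s \<in> p1" "t \<in> p1" "r s = r t" "s \<noteq> t"
        obtain x K x' K' where [simp]: "s = (x,K)" "t = (x',K')" by fastforce
        have "{Inf K<..<Sup K} \<inter> {Inf K'<..<Sup K'} = {}"
          using disj[of x K x' K'] st by (auto simp: p1_def)
        then show False using st dense[of "Inf K" "Sup K"] by (auto simp: p1_def r_def)
      qed
      have "(\<Sum>(u, v)\<in>r ` p1. norm (g v - g u)) < e / 2"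
      proof (rule \<delta>)
        show "finite (r ` p1)" using p1 by simp
        show "\<forall>(u, v)\<in>r ` p1. u \<le> v \<and> {u..v} \<subseteq> {a..b}"
        proof (rule ballI)
          fix n assume "n \<in> r ` p1"
          then obtain x K where xK: "(x, K) \<in> p" "n = (Inf K, Sup K)" using p1(1) by (auto simp: r_def)
          then show "case n of (u, v) \<Rightarrow> u \<le> v \<and> {u..v} \<subseteq> {a..b}" using pK[OF xK(1)] by auto
        qed
        show "pairwise (\<lambda>(u, v) (u', v'). {u<..<v} \<inter> {u'<..<v'} = {}) (r ` p1)"
        proof (rule pairwise_imageI)
          fix s t assume st: "s \<in> p1" "t \<in> p1" "s \<noteq> t" "r s \<noteq> r t"
          obtain x K x' K' where [simp]: "s = (x,K)" "t = (x',K')" by fastforce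
          have "{Inf K<..<Sup K} \<inter> {Inf K'<..<Sup K'} = {}"
            using disj[of x K x' K'] st by (auto simp: p1_def)
          then show "(case r s of (u, v) \<Rightarrow> \<lambda>(u', v'). {u<..<v} \<inter> {u'<..<v'} = {}) (r t)" by (simp add: r_def)
        qed
        have "(\<Sum>(u, v)\<in>r ` p1. v - u) = (\<Sum>(x,K)\<in>p1. Sup K - Inf K)"
          by (subst sum.reindex[OF inj]) (auto simp: r_def intro!: sum.cong)
        also have "\<dots> = (\<Sum>z\<in>p1. measure lebesgue {Inf (snd z)<..<Sup (snd z)})"
          by (intro sum.cong) (auto simp: p1_def)
        also have "\<dots> = measure lebesgue (\<Union>z\<in>p1. {Inf (snd z)<..<Sup (snd z)})"
        proof (rule measure_UNION'[symmetric])
          show "pairwise (\<lambda>s t. disjnt {Inf (snd s)<..<Sup (snd s)} {Inf (snd t)<..<Sup (snd t)}) p1"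
          proof (rule pairwiseI)
            fix s t assume st: "s \<in> p1" "t \<in> p1" "s \<noteq> t"
            then have "(fst s, snd s) \<in> p" "(fst t, snd t) \<in> p" "(fst s, snd s) \<noteq> (fst t, snd t)"
              using p1(1) by auto
            from disj[OF this] show "disjnt {Inf (snd s)<..<Sup (snd s)} {Inf (snd t)<..<Sup (snd t)}"
              unfolding disjnt_def .
          qed
        qed (use p1 in auto)
        also have "\<dots> \<le> measure lebesgue U"
        proof (rule measure_mono_fmeasurable)
          show "(\<Union>z\<in>p1. {Inf (snd z)<..<Sup (snd z)}) \<subseteq> U"
          proof safe
            fix z x K assume z: "(x, K) \<in> p1" "z \<in> {Inf (snd (x, K))<..<Sup (snd (x, K))}"
            then have xK: "(x, K) \<in> p" "x \<in> N" by (auto simp: p1_def)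
            have "z \<in> K" using pK[OF xK(1)] z by auto
            moreover have "K \<subseteq> ball x (d x)" using finep xK(1) by blast
            ultimately show "z \<in> U" using d(3)[OF xK(2)] by blast
          qed
          show "(\<Union>z\<in>p1. {Inf (snd z)<..<Sup (snd z)}) \<in> sets lebesgue"
            by (intro sets_completionI_sets) (auto intro!: borel_open)
        qed (rule U')
        finally show "(\<Sum>(u, v)\<in>r ` p1. v - u) < \<delta>" using U' by simp
      qed
      moreover have "norm (sum w p1) \<le> (\<Sum>(u, v)\<in>r ` p1. norm (g v - g u))"
        unfolding sum.reindex[OF inj]
        by (rule sum_norm_le) (auto simp: w_def r_def p1_def f'_def norm_minus_commute)
      ultimately have 2: "norm (sum w p1) < e / 2" by simp
      have "(\<Sum>(x, k)\<in>p. measure lborel k *\<^sub>R f' x) - (g b - g a) = sum w p"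
        unfolding ba by (simp add: w_def split_def sum_subtractf)
      also have "\<dots> = sum w (p - p1) + sum w p1"
        by (rule sum.subset_diff[OF p1(1) fin])
      finally have 3: "(\<Sum>(x, k)\<in>p. measure lborel k *\<^sub>R f' x) - (g b - g a) = sum w (p - p1) + sum w p1" .
      show "norm ((\<Sum>(x, k)\<in>p. measure lborel k *\<^sub>R f' x) - (g b - g a)) < e"
        unfolding 3 by (rule norm_triangle_lt) (use 1 2 in linarith)
    qed
  qed
  then show ?thesis
    by (rule has_integral_spike[OF N, rotated]) (auto simp: f'_def)
qed

text \<open>
  This covers the sum of a translate of \<open>f\<close> and a Lipschitz function, the form in which \<open>A\<close> depends on
  each of its variables.
\<close>

lemma absolutely_continuous_on_dominated:
  assumes ac: "absolutely_continuous_on {c + a..c + b} f"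
    and L: "0 \<le> L"
    and le: "\<And>u v. a \<le> u \<Longrightarrow> u \<le> v \<Longrightarrow> v \<le> b \<Longrightarrow> norm (g v - g u) \<le> norm (f (c + v) - f (c + u)) + L * (v - u)"
  shows "absolutely_continuous_on {a..b} g"
  unfolding absolutely_continuous_on_def
proof (intro allI impI)
  fix e :: real assume e: "0 < e"
  obtain d where "d > 0" and d: "\<And>D. finite D \<Longrightarrow> (\<forall>(u, v)\<in>D. u \<le> v \<and> {u..v} \<subseteq> {c + a..c + b}) \<Longrightarrow>
        pairwise (\<lambda>(u, v) (u', v'). {u<..<v} \<inter> {u'<..<v'} = {}) D \<Longrightarrow>
        (\<Sum>(u, v)\<in>D. v - u) < d \<Longrightarrow> (\<Sum>(u, v)\<in>D. norm (f v - f u)) < e / 2"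
    using ac[unfolded absolutely_continuous_on_def, rule_format, of "e / 2"] e by auto
  define d' where "d' = min d (e / (2 * (L + 1)))"
  have "0 < d'" using \<open>d > 0\<close> e L by (simp add: d'_def)
  moreover have "(\<Sum>(u, v)\<in>D. norm (g v - g u)) < e"
    if D: "finite D" "\<forall>(u, v)\<in>D. u \<le> v \<and> {u..v} \<subseteq> {a..b}"
      "pairwise (\<lambda>(u, v) (u', v'). {u<..<v} \<inter> {u'<..<v'} = {}) D" "(\<Sum>(u, v)\<in>D. v - u) < d'" for D
  proof -
    define s where "s = (\<lambda>(u::real, v::real). (c + u, c + v))"
    have inj: "inj_on s D" by (auto simp: inj_on_def s_def)
    have uv: "u \<le> v" "a \<le> u" "v \<le> b" if "(u, v) \<in> D" for u v using D(2) that by auto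
    have 1: "(\<Sum>(u, v)\<in>s ` D. norm (f v - f u)) < e / 2"
    proof (rule d)
      show "\<forall>(u, v)\<in>s ` D. u \<le> v \<and> {u..v} \<subseteq> {c + a..c + b}" using uv by (fastforce simp: s_def)
      show "pairwise (\<lambda>(u, v) (u', v'). {u<..<v} \<inter> {u'<..<v'} = {}) (s ` D)"
      proof (rule pairwise_imageI)
        fix p p' assume p: "p \<in> D" "p' \<in> D" "p \<noteq> p'"
        obtain u v u' v' where [simp]: "p = (u, v)" "p' = (u', v')" by fastforce
        have "{u<..<v} \<inter> {u'<..<v'} = {}" using pairwiseD[OF D(3) p] by simp
        moreover have "{c + u<..<c + v} \<inter> {c + u'<..<c + v'} = (\<lambda>t. c + t) ` ({u<..<v} \<inter> {u'<..<v'})"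
          by (auto simp: image_iff intro!: bexI[of _ "_ - c"])
        ultimately show "(case s p of (u, v) \<Rightarrow> \<lambda>(u', v'). {u<..<v} \<inter> {u'<..<v'} = {}) (s p')"
          by (simp add: s_def)
      qed
      show "(\<Sum>(u, v)\<in>s ` D. v - u) < d"
        using D(4) by (subst sum.reindex[OF inj]) (simp add: s_def split_def d'_def)
    qed (use D in auto)
    have "(\<Sum>(u, v)\<in>D. norm (g v - g u)) \<le> (\<Sum>(u, v)\<in>D. norm (f (c + v) - f (c + u)) + L * (v - u))"
      using uv le by (intro sum_mono) (auto split: prod.splits)
    also have "\<dots> = (\<Sum>(u, v)\<in>s ` D. norm (f v - f u)) + L * (\<Sum>(u, v)\<in>D. v - u)"
      by (subst sum.reindex[OF inj]) (simp add: s_def split_def sum.distrib sum_distrib_left)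
    also have "L * (\<Sum>(u, v)\<in>D. v - u) \<le> L * (e / (2 * (L + 1)))"
      using D(4) L by (intro mult_left_mono) (auto simp: d'_def)
    also have "\<dots> \<le> e / 2" using L e by (simp add: field_simps)
    finally show ?thesis using 1 by linarith
  qed
  ultimately show "\<exists>\<delta>>0. \<forall>D :: (real \<times> real) set.
        finite D \<longrightarrow> (\<forall>(u, v)\<in>D. u \<le> v \<and> {u..v} \<subseteq> {a..b}) \<longrightarrow>
        pairwise (\<lambda>(u, v) (u', v'). {u<..<v} \<inter> {u'<..<v'} = {}) D \<longrightarrow>
        (\<Sum>(u, v)\<in>D. v - u) < \<delta> \<longrightarrow> (\<Sum>(u, v)\<in>D. norm (g v - g u)) < e"
    by blast
qed

lemma loc_abs_cont_on_cong:
  assumes S: "open S" and eq: "\<And>t. t \<in> S \<Longrightarrow> f t = g t" and f: "loc_abs_cont_on S f"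
  shows "loc_abs_cont_on S g"
  unfolding loc_abs_cont_on_def
proof (intro conjI allI impI)
  fix u v assume uv: "{u..v} \<subseteq> S"
  have ac: "absolutely_continuous_on {u..v} f" using f uv by (simp add: loc_abs_cont_on_def)
  show "absolutely_continuous_on {u..v} g"
  proof (rule absolutely_continuous_on_dominated[where c=0 and L=0 and f=f])
    fix s t assume "u \<le> s" "s \<le> t" "t \<le> v"
    then have "s \<in> S" "t \<in> S" using uv by auto
    then show "norm (g t - g s) \<le> norm (f (0 + t) - f (0 + s)) + 0 * (t - s)" by (simp add: eq)
  qed (use ac in auto)
next
  have "AE t in lebesgue. t \<in> S \<longrightarrow> f differentiable at t" using f by (simp add: loc_abs_cont_on_def)
  then show "AE t in lebesgue. t \<in> S \<longrightarrow> g differentiable at t"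
  proof eventually_elim
    case (elim t)
    show ?case
    proof
      assume t: "t \<in> S"
      then have "(f has_vector_derivative vector_derivative f (at t)) (at t)"
        using elim by (simp add: vector_derivative_works)
      then have "(g has_vector_derivative vector_derivative f (at t)) (at t)"
        by (rule has_vector_derivative_transform_within_open[OF _ S t]) (simp add: eq)
      then show "g differentiable at t" by (auto simp: has_vector_derivative_def differentiable_def)
    qed
  qed
qed

lemma loc_abs_cont_on_subset: "loc_abs_cont_on S g \<Longrightarrow> T \<subseteq> S \<Longrightarrow> loc_abs_cont_on T g"
  unfolding loc_abs_cont_on_def by (auto elim!: eventually_mono)

lemma absolutely_continuous_on_imp_continuous_on:
  assumes "absolutely_continuous_on {u..v} g"
  shows "continuous_on {u..v} g"
  unfolding continuous_on_iff
proof (intro ballI allI impI)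
  fix x e :: real assume x: "x \<in> {u..v}" and e: "0 < e"
  obtain d where "d > 0" and d: "\<And>D. finite D \<Longrightarrow> (\<forall>(s, t)\<in>D. s \<le> t \<and> {s..t} \<subseteq> {u..v}) \<Longrightarrow>
        pairwise (\<lambda>(s, t) (s', t'). {s<..<t} \<inter> {s'<..<t'} = {}) D \<Longrightarrow>
        (\<Sum>(s, t)\<in>D. t - s) < d \<Longrightarrow> (\<Sum>(s, t)\<in>D. norm (g t - g s)) < e"
    using assms[unfolded absolutely_continuous_on_def, rule_format, of e] e by auto
  have "dist (g y) (g x) < e" if "y \<in> {u..v}" "dist y x < d" for y
  proof (cases "x \<le> y")
    case True
    then show ?thesis using d[of "{(x, y)}"] that x by (simp add: dist_real_def dist_norm)
  next
    case False
    then show ?thesis using d[of "{(y, x)}"] that x by (simp add: dist_real_def dist_norm norm_minus_commute)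
  qed
  then show "\<exists>d>0. \<forall>y\<in>{u..v}. dist y x < d \<longrightarrow> dist (g y) (g x) < e" using \<open>d > 0\<close> by blast
qed

lemma loc_abs_cont_on_imp_continuous_on:
  assumes "loc_abs_cont_on {p<..} g"
  shows "continuous_on {p<..} g"
proof (rule continuous_at_imp_continuous_on, rule ballI)
  fix z assume z: "z \<in> {p<..}"
  let ?I = "{(p + z) / 2..z + 1}"
  have "?I \<subseteq> {p<..}" using z by auto
  then have "continuous_on ?I g"
    using assms by (intro absolutely_continuous_on_imp_continuous_on) (simp add: loc_abs_cont_on_def)
  then show "isCont g z" by (rule continuous_on_interior) (use z in auto)
qed

text \<open>
  Tonelli's theorem is used for \<open>lborel\<close>, since \<open>(t, y) \<mapsto> F(t + y)\<close> is measurable for the product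
  when \<open>F\<close> is a Borel function. The next lemmas replace Lebesgue measurable functions by Borel versions.
\<close>

lemma completion_ex_borel_measurable_complex:
  fixes g :: "'a \<Rightarrow> complex"
  assumes [measurable]: "g \<in> borel_measurable (completion M)"
  shows "\<exists>g'\<in>borel_measurable M. AE x in M. g x = g' x"
proof -
  obtain u v where [measurable]: "u \<in> borel_measurable M" "v \<in> borel_measurable M"
    and uv: "AE x in M. Re (g x) = u x" "AE x in M. Im (g x) = v x"
    using completion_ex_borel_measurable_real[of "\<lambda>x. Re (g x)" M]
      completion_ex_borel_measurable_real[of "\<lambda>x. Im (g x)" M] by auto
  have "(\<lambda>x. Complex (u x) (v x)) = (\<lambda>x. of_real (u x) + \<i> * of_real (v x))"
    by (auto simp: complex_eq_iff)
  then have 1: "(\<lambda>x. Complex (u x) (v x)) \<in> borel_measurable M" by simp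
  have 2: "AE x in M. g x = Complex (u x) (v x)" using uv by eventually_elim (simp add: complex_eq_iff)
  show ?thesis using 2 1 by (rule bexI)
qed

lemma AE_lborel_imp_negligible:
  fixes P :: "'a::euclidean_space \<Rightarrow> bool"
  assumes "AE z in lborel. P z"
  obtains N where "negligible N" "\<And>z. z \<notin> N \<Longrightarrow> P z"
proof -
  obtain N where "{z \<in> space lborel. \<not> P z} \<subseteq> N" "N \<in> null_sets lborel"
    using assms by (auto simp: eventually_ae_filter)
  then show ?thesis
    by (intro that[of N]) (auto simp: negligible_iff_null_sets intro: null_sets_completionI)
qed

lemma AE_lborel_shift:
  fixes c :: real
  assumes "AE z in lborel. P z"
  shows "AE y in lborel. P (c + y)"
proof -
  obtain N where N: "{z \<in> space lborel. \<not> P z} \<subseteq> N" "N \<in> null_sets lborel"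
    using assms by (auto simp: eventually_ae_filter)
  have "AE y in lborel. c + 1 * y \<notin> N"
    by (rule AE_borel_affine) (use N(2) AE_not_in[OF N(2)] in auto)
  then show ?thesis using N(1) by (auto elim!: eventually_mono)
qed

text \<open>
  The derivative is measurable because it has a gauge integral over every compact subinterval.
\<close>

lemma loc_abs_cont_borel_derivative:
  assumes ac: "loc_abs_cont_on {p<..} g"
  obtains k where "k \<in> borel_measurable borel" "\<And>z. z \<le> p \<Longrightarrow> k z = 0"
    "AE z in lborel. p < z \<longrightarrow> (g has_vector_derivative k z) (at z)"
    "\<And>a b. p < a \<Longrightarrow> a \<le> b \<Longrightarrow> (k has_integral g b - g a) {a..b}"
proof -
  define g' where "g' = (\<lambda>z. vector_derivative g (at z))"
  have "AE z in lborel. z \<in> {p<..} \<longrightarrow> g differentiable at z"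
    using ac by (simp add: loc_abs_cont_on_def AE_completion_iff)
  then have ae: "AE z in lborel. p < z \<longrightarrow> (g has_vector_derivative g' z) (at z)"
    by eventually_elim (simp add: g'_def vector_derivative_works)
  then obtain N where N: "negligible N" "\<And>z. z \<notin> N \<Longrightarrow> p < z \<longrightarrow> (g has_vector_derivative g' z) (at z)"
    by (rule AE_lborel_imp_negligible) blast
  have int: "(g' has_integral g b - g a) {a..b}" if "p < a" "a \<le> b" for a b
  proof (rule has_integral_derivative_absolutely_continuous[OF \<open>a \<le> b\<close> _ N(1)])
    have "{a..b} \<subseteq> {p<..}" using that by auto
    then show "absolutely_continuous_on {a..b} g" using ac by (simp add: loc_abs_cont_on_def)
    show "(g has_vector_derivative g' x) (at x within {a..b})" if "x \<in> {a..b} - N" for x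
      using N(2)[of x] that \<open>p < a\<close> by (auto intro: has_vector_derivative_at_within)
  qed
  have "(\<lambda>z. indicator {p + 1 / Suc n..p + 1 / Suc n + n} z *\<^sub>R g' z) \<in> borel_measurable lebesgue" for n
    by (rule has_integral_implies_lebesgue_measurable, rule int) auto
  then have "(\<lambda>z. indicator {p<..} z *\<^sub>R g' z) \<in> borel_measurable lebesgue"
  proof (rule borel_measurable_LIMSEQ_metric)
    fix z
    show "(\<lambda>n. indicator {p + 1 / Suc n..p + 1 / Suc n + n} z *\<^sub>R g' z) \<longlonglongrightarrow> indicator {p<..} z *\<^sub>R g' z"
    proof (cases "p < z")
      case True
      then obtain m where m: "1 / Suc m < z - p" using nat_approx_posE[of "z - p"] by auto
      have "\<forall>n\<ge>max m (nat \<lceil>z - p\<rceil>). indicator {p + 1 / Suc n..p + 1 / Suc n + n} z *\<^sub>R g' z = indicator {p<..} z *\<^sub>R g' z"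
      proof (intro allI impI)
        fix n assume n: "max m (nat \<lceil>z - p\<rceil>) \<le> n"
        have "1 / real (Suc n) \<le> 1 / real (Suc m)" using n by (intro divide_left_mono) auto
        moreover have "z - p \<le> real n" using n by linarith
        moreover have "0 < 1 / real (Suc n)" by simp
        ultimately have "z \<in> {p + 1 / Suc n..p + 1 / Suc n + n}" using m unfolding atLeastAtMost_iff by linarith
        then show "indicator {p + 1 / Suc n..p + 1 / Suc n + n} z *\<^sub>R g' z = indicator {p<..} z *\<^sub>R g' z"
          using True by simp
      qed
      then show ?thesis by (intro tendsto_eventually) (unfold eventually_sequentially, blast)
    next
      case False
      have "z \<notin> {p + 1 / Suc n..p + 1 / Suc n + n}" for n
      proof -
        have "0 < 1 / real (Suc n)" by simp
        then show ?thesis using False unfolding atLeastAtMost_iff by linarith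
      qed
      then show ?thesis using False by (simp del: atLeastAtMost_iff)
    qed
  qed
  from completion_ex_borel_measurable_complex[OF this]
  obtain k0 where [measurable]: "k0 \<in> borel_measurable borel"
    and k0: "AE z in lborel. indicator {p<..} z *\<^sub>R g' z = k0 z" by auto
  define k where "k = (\<lambda>z. if p < z then k0 z else 0)"
  have kg: "AE z in lborel. p < z \<longrightarrow> k z = g' z"
    using k0 by eventually_elim (auto simp: k_def)
  then obtain M where M: "negligible M" "\<And>z. z \<notin> M \<Longrightarrow> p < z \<longrightarrow> k z = g' z"
    by (rule AE_lborel_imp_negligible) blast
  show ?thesis
  proof
    show "k \<in> borel_measurable borel" unfolding k_def by measurable
    show "AE z in lborel. p < z \<longrightarrow> (g has_vector_derivative k z) (at z)"
      using ae kg by eventually_elim simp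
    show "(k has_integral g b - g a) {a..b}" if "p < a" "a \<le> b" for a b
    proof (rule has_integral_spike[OF M(1) _ int[OF that]])
      fix z assume "z \<in> {a..b} - M"
      then show "k z = g' z" using M(2)[of z] that(1) by simp
    qed
  qed (simp add: k_def)
qed

section \<open>The norm of \<open>L\<^sup>1\<close> of a half-line\<close>

abbreviation enorm :: "'a::real_normed_vector \<Rightarrow> ennreal" where
  "enorm w \<equiv> ennreal (norm w)"

text \<open>
  The norm of \<open>L\<^sup>1(p, \<infinity>)\<close>. As an extended real it is available before integrability is known.
\<close>

definition tail :: "(real \<Rightarrow> complex) \<Rightarrow> real \<Rightarrow> ennreal" where
  "tail f p = (\<integral>\<^sup>+ z\<in>{p<..}. enorm (f z) \<partial>lborel)"

lemma tail_antimono: "p \<le> u \<Longrightarrow> tail f u \<le> tail f p"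
  unfolding tail_def by (intro nn_integral_mono) (auto simp: indicator_def)

lemma tail_mono_AE:
  assumes "AE z in lborel. p < z \<longrightarrow> norm (f z) \<le> norm (g z)"
  shows "tail f p \<le> tail g p"
proof -
  have "AE z in lborel. enorm (f z) * indicator {p<..} z \<le> enorm (g z) * indicator {p<..} z"
    using assms by eventually_elim (auto simp: indicator_def intro: ennreal_leI)
  then show ?thesis unfolding tail_def by (rule nn_integral_mono_AE)
qed

lemma tail_cong_AE:
  assumes "AE z in lborel. p < z \<longrightarrow> norm (f z) = norm (g z)"
  shows "tail f p = tail g p"
proof (rule antisym)
  show "tail f p \<le> tail g p" by (rule tail_mono_AE, rule eventually_mono[OF assms]) simp
  show "tail g p \<le> tail f p" by (rule tail_mono_AE, rule eventually_mono[OF assms]) simp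
qed

lemma tail_triangle:
  assumes [measurable]: "g \<in> borel_measurable borel" "h \<in> borel_measurable borel"
    and le: "\<And>z. p < z \<Longrightarrow> norm (f z) \<le> norm (g z) + norm (h z)"
  shows "tail f p \<le> tail g p + tail h p"
proof -
  have "tail f p \<le> (\<integral>\<^sup>+ z. enorm (g z) * indicator {p<..} z + enorm (h z) * indicator {p<..} z \<partial>lborel)"
    unfolding tail_def
  proof (rule nn_integral_mono)
    fix z
    have "enorm (f z) \<le> enorm (g z) + enorm (h z)" if "p < z"
      using ennreal_leI[OF le[OF that]] by simp
    then show "enorm (f z) * indicator {p<..} z
        \<le> enorm (g z) * indicator {p<..} z + enorm (h z) * indicator {p<..} z"
      by (cases "p < z") auto
  qed
  also have "\<dots> = tail g p + tail h p"
    unfolding tail_def by (intro nn_integral_add) auto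
  finally show ?thesis .
qed

lemma tail_triangle3:
  assumes [measurable]: "g1 \<in> borel_measurable borel" "g2 \<in> borel_measurable borel" "g3 \<in> borel_measurable borel"
    and le: "\<And>z. u < z \<Longrightarrow> norm (g z) \<le> norm (g1 z) + norm (g2 z) + norm (g3 z)"
  shows "tail g u \<le> tail g1 u + tail g2 u + tail g3 u"
proof -
  have "tail g u \<le> tail (\<lambda>z. of_real (norm (g1 z) + norm (g2 z))) u + tail g3 u"
    by (rule tail_triangle) (use le in \<open>auto simp del: of_real_add\<close>)
  also have "\<dots> \<le> tail g1 u + tail g2 u + tail g3 u"
    by (intro add_right_mono tail_triangle) (auto simp del: of_real_add)
  finally show ?thesis .
qed

lemma tail_cmult:
  assumes [measurable]: "f \<in> borel_measurable borel"
  shows "tail (\<lambda>z. c * f z) p = ennreal (norm c) * tail f p"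
proof -
  have "tail (\<lambda>z. c * f z) p = (\<integral>\<^sup>+ z. ennreal (norm c) * (enorm (f z) * indicator {p<..} z) \<partial>lborel)"
    unfolding tail_def by (intro nn_integral_cong) (simp add: norm_mult ennreal_mult mult.assoc)
  also have "\<dots> = ennreal (norm c) * tail f p"
    unfolding tail_def by (rule nn_integral_cmult) measurable
  finally show ?thesis .
qed

lemma nn_integral_lborel_shift:
  fixes f :: "real \<Rightarrow> ennreal"
  shows "f \<in> borel_measurable borel \<Longrightarrow> (\<integral>\<^sup>+ x. f (c + x) \<partial>lborel) = (\<integral>\<^sup>+ x. f x \<partial>lborel)"
  using nn_integral_real_affine[of f 1 c] by simp

lemma tail_shift:
  assumes [measurable]: "f \<in> borel_measurable borel"
  shows "tail (\<lambda>z. f (c + z)) p = tail f (c + p)"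
proof -
  have "tail f (c + p) = (\<integral>\<^sup>+ z. enorm (f (c + z)) * indicator {c + p<..} (c + z) \<partial>lborel)"
    unfolding tail_def by (rule nn_integral_lborel_shift[symmetric]) measurable
  also have "\<dots> = tail (\<lambda>z. f (c + z)) p"
    unfolding tail_def by (intro nn_integral_cong) (simp add: indicator_def)
  finally show ?thesis by simp
qed

lemma tail_finite:
  "integrable lborel f \<Longrightarrow> tail f p < \<infinity>"
proof -
  assume "integrable lborel f"
  then have "(\<integral>\<^sup>+ z. enorm (f z) \<partial>lborel) < \<infinity>" by (simp add: integrable_iff_bounded)
  moreover have "tail f p \<le> (\<integral>\<^sup>+ z. enorm (f z) \<partial>lborel)"
    unfolding tail_def by (intro nn_integral_mono) (auto simp: indicator_def)
  ultimately show ?thesis by (rule le_less_trans[rotated])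
qed

lemma tail_lebesgue:
  assumes "AE z in lborel. u < z \<longrightarrow> norm (k z) = norm (g z)"
  shows "(\<integral>\<^sup>+ z\<in>{u..}. enorm (g z) \<partial>lebesgue) = tail k u"
    and "(\<integral>\<^sup>+ z\<in>{u<..}. enorm (g z) \<partial>lebesgue) = tail k u"
proof -
  have "AE z in lborel. z \<noteq> u" by (rule AE_lborel_singleton)
  then have "AE z in lborel. enorm (g z) * indicator {u..} z = enorm (k z) * indicator {u<..} z"
    using assms by eventually_elim (auto simp: indicator_def)
  then show "(\<integral>\<^sup>+ z\<in>{u..}. enorm (g z) \<partial>lebesgue) = tail k u"
    unfolding tail_def nn_integral_completion by (rule nn_integral_cong_AE)
  have "AE z in lborel. enorm (g z) * indicator {u<..} z = enorm (k z) * indicator {u<..} z"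
    using assms by eventually_elim (auto simp: indicator_def)
  then show "(\<integral>\<^sup>+ z\<in>{u<..}. enorm (g z) \<partial>lebesgue) = tail k u"
    unfolding tail_def nn_integral_completion by (rule nn_integral_cong_AE)
qed

section \<open>Difference quotients of functions with integrable derivative\<close>

definition quot :: "(real \<Rightarrow> complex) \<Rightarrow> real \<Rightarrow> real \<Rightarrow> complex" where
  "quot f h z = (f (z + h) - f z) / of_real h"

lemma has_vector_derivative_iff_quot:
  "(f has_vector_derivative D) (at x within S) \<longleftrightarrow>
     ((\<lambda>h. quot f h x) \<longlongrightarrow> D) (at 0 within {h. x + h \<in> S})"
proof -
  have at: "at x within S = filtermap (\<lambda>h. x + h) (at 0 within {h. x + h \<in> S})"
  proof (rule filter_eqI)
    fix P
    have "(\<forall>y\<in>S. y \<noteq> x \<and> dist y x < d \<longrightarrow> P y) \<longleftrightarrow>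
        (\<forall>h\<in>{h. x + h \<in> S}. h \<noteq> 0 \<and> dist h 0 < d \<longrightarrow> P (x + h))" (is "?L \<longleftrightarrow> ?R") for d
    proof
      assume L: ?L
      show ?R using L by (auto simp: dist_real_def)
    next
      assume R: ?R
      show ?L
      proof safe
        fix y assume "y \<in> S" "y \<noteq> x" "dist y x < d"
        then show "P y" using R[rule_format, of "y - x"] by (simp add: dist_real_def)
      qed
    qed
    then show "eventually P (at x within S)
        \<longleftrightarrow> eventually P (filtermap (\<lambda>h. x + h) (at 0 within {h. x + h \<in> S}))"
      by (simp add: eventually_filtermap eventually_at)
  qed
  have "(f has_vector_derivative D) (at x within S) \<longleftrightarrow>
      ((\<lambda>y. norm (f y - f x - (y - x) *\<^sub>R D) / norm (y - x)) \<longlongrightarrow> 0) (at x within S)"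
    unfolding has_vector_derivative_def has_derivative_iff_norm by (simp add: bounded_linear_scaleR_left)
  also have "\<dots> \<longleftrightarrow> ((\<lambda>h. norm (f (x + h) - f x - h *\<^sub>R D) / norm h) \<longlongrightarrow> 0) (at 0 within {h. x + h \<in> S})"
    unfolding at filterlim_filtermap by simp
  also have "\<dots> \<longleftrightarrow> ((\<lambda>h. norm (quot f h x - D)) \<longlongrightarrow> 0) (at 0 within {h. x + h \<in> S})"
  proof (rule filterlim_cong[OF refl refl])
    have "\<forall>\<^sub>F h in at 0 within {h. x + h \<in> S}. h \<noteq> 0" by (simp add: eventually_at_filter)
    then show "\<forall>\<^sub>F h in at 0 within {h. x + h \<in> S}. norm (f (x + h) - f x - h *\<^sub>R D) / norm h = norm (quot f h x - D)"
    proof eventually_elim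
      case (elim h)
      then have "f (x + h) - f x - h *\<^sub>R D = of_real h * (quot f h x - D)"
        by (simp add: quot_def scaleR_conv_of_real field_simps)
      then show ?case using elim by (simp add: norm_mult)
    qed
  qed
  finally show ?thesis by (simp only: tendsto_norm_zero_iff LIM_zero_iff)
qed

lemma quot_measurable [measurable]:
  assumes [measurable]: "f \<in> borel_measurable borel"
  shows "quot f h \<in> borel_measurable borel"
  unfolding quot_def[abs_def] by measurable

lemma ennreal_norm_indicator:
  "enorm (indicator S z *\<^sub>R w) = enorm (w::complex) * indicator S z"
  by (simp add: indicator_def)

lemma ennreal_tendsto_0_I:
  fixes r :: "'a \<Rightarrow> ennreal"
  assumes "\<And>e. 0 < e \<Longrightarrow> \<forall>\<^sub>F x in Fl. r x \<le> ennreal e"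
  shows "(r \<longlongrightarrow> 0) Fl"
proof (rule order_tendstoI)
  fix a :: ennreal assume "0 < a"
  then obtain e where e: "0 < ennreal e" "ennreal e < a" 
    using dense[of 0 a] by (metis ennreal_cases less_top_ennreal top.not_eq_extremum ennreal_less_top order.strict_trans)
  then have "\<forall>\<^sub>F x in Fl. r x \<le> ennreal e" using assms by simp
  then show "\<forall>\<^sub>F x in Fl. r x < a" using e(2) by (auto elim!: eventually_mono)
qed simp

text \<open>
  What is used of a locally absolutely continuous function with integrable derivative: it has a Borel
  density \<open>k\<close>, is its indefinite integral, and has \<open>k\<close> as its pointwise derivative almost everywhere.
\<close>

locale primitive =
  fixes f k :: "real \<Rightarrow> complex" and p :: real
  assumes f_meas [measurable]: "f \<in> borel_measurable borel"
    and k_meas [measurable]: "k \<in> borel_measurable borel"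
    and k_int: "integrable lborel k"
    and ftc: "\<And>a b. p < a \<Longrightarrow> a \<le> b \<Longrightarrow> f b - f a = (LINT s:{a..b}|lborel. k s)"
    and deriv: "AE z in lborel. p < z \<longrightarrow> (f has_vector_derivative k z) (at z)"
begin

lemma norm_diff_le:
  assumes "p < a" "a \<le> b"
  shows "enorm (f b - f a) \<le> (\<integral>\<^sup>+ s\<in>{a..b}. enorm (k s) \<partial>lborel)"
proof -
  have "integrable lborel (\<lambda>s. indicator {a..b} s *\<^sub>R k s)"
    by (intro integrable_mult_indicator k_int) auto
  from integral_norm_bound_ennreal[OF this]
  show ?thesis
    unfolding ftc[OF assms] set_lebesgue_integral_def ennreal_norm_indicator .
qed

lemma norm_diff_le_shift:
  assumes "p < z" "0 \<le> h"
  shows "enorm (f (z + h) - f z) \<le> (\<integral>\<^sup>+ s\<in>{0..h}. enorm (k (z + s)) \<partial>lborel)"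
proof -
  have "(\<integral>\<^sup>+ s\<in>{z..z+h}. enorm (k s) \<partial>lborel)
      = (\<integral>\<^sup>+ s. enorm (k (z + s)) * indicator {z..z+h} (z + s) \<partial>lborel)"
    by (rule nn_integral_lborel_shift[symmetric]) measurable
  also have "\<dots> = (\<integral>\<^sup>+ s\<in>{0..h}. enorm (k (z + s)) \<partial>lborel)"
    by (intro nn_integral_cong) (simp add: indicator_def)
  finally show ?thesis using norm_diff_le[of z "z + h"] assms by simp
qed

abbreviation shift_err :: "real \<Rightarrow> real \<Rightarrow> ennreal" where
  "shift_err h \<equiv> tail (\<lambda>z. f (z + h) - f z)"

abbreviation quot_err :: "real \<Rightarrow> real \<Rightarrow> ennreal" where
  "quot_err h \<equiv> tail (\<lambda>z. quot f h z - k z)"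

text \<open>
  The increment over \<open>[z, z + h]\<close> is at most the integral of \<open>|k(z + s)|\<close> over \<open>0 \<le> s \<le> h\<close>; Tonelli moves
  the integration over \<open>z\<close> inside, where it gives at most \<open>tail k u\<close> for each \<open>s\<close>.
\<close>

lemma tail_diff_le_pos:
  assumes "p \<le> u" "0 \<le> h"
  shows "shift_err h u \<le> ennreal h * tail k u"
proof -
  have "shift_err h u
      \<le> (\<integral>\<^sup>+ z. (\<integral>\<^sup>+ s. enorm (k (z + s)) * indicator {0..h} s * indicator {u<..} z \<partial>lborel) \<partial>lborel)"
    unfolding tail_def
  proof (intro nn_integral_mono)
    fix z
    have "enorm (f (z + h) - f z) * indicator {u<..} z
        \<le> (\<integral>\<^sup>+ s\<in>{0..h}. enorm (k (z + s)) \<partial>lborel) * indicator {u<..} z"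
      using norm_diff_le_shift[of z h] assms by (cases "u < z") simp_all
    also have "\<dots> = (\<integral>\<^sup>+ s. enorm (k (z + s)) * indicator {0..h} s * indicator {u<..} z \<partial>lborel)"
      by (rule nn_integral_multc[symmetric]) measurable
    finally show "enorm (f (z + h) - f z) * indicator {u<..} z \<le> \<dots>" .
  qed
  also have "\<dots> = (\<integral>\<^sup>+ s. (\<integral>\<^sup>+ z. enorm (k (z + s)) * indicator {0..h} s * indicator {u<..} z \<partial>lborel) \<partial>lborel)"
    by (rule lborel_pair.Fubini') measurable
  also have "\<dots> \<le> (\<integral>\<^sup>+ s. tail k u * indicator {0..h} s \<partial>lborel)"
  proof (intro nn_integral_mono)
    fix s :: real
    have "(\<integral>\<^sup>+ z. enorm (k (z + s)) * indicator {0..h} s * indicator {u<..} z \<partial>lborel)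
      = (\<integral>\<^sup>+ z. enorm (k (z + s)) * indicator {u<..} z * indicator {0..h} s \<partial>lborel)"
      by (simp add: ac_simps)
    also have "\<dots> = tail (\<lambda>z. k (s + z)) u * indicator {0..h} s"
      unfolding tail_def by (subst nn_integral_multc) (auto simp: add.commute)
    also have "\<dots> \<le> tail k u * indicator {0..h} s"
      by (auto simp: tail_shift indicator_def intro: tail_antimono)
    finally show "(\<integral>\<^sup>+ z. enorm (k (z + s)) * indicator {0..h} s * indicator {u<..} z \<partial>lborel)
      \<le> tail k u * indicator {0..h} s" .
  qed
  also have "\<dots> = ennreal h * tail k u"
    using assms by (subst nn_integral_cmult) (auto simp: mult.commute)
  finally show ?thesis .
qed

lemma tail_diff_le:
  assumes "p \<le> u" "p \<le> u + h"
  shows "shift_err h u \<le> ennreal \<bar>h\<bar> * tail k (min u (u + h))"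
proof (cases "0 \<le> h")
  case True
  then show ?thesis using tail_diff_le_pos[of u h] assms by (simp add: min_def)
next
  case False
  have "shift_err h u = tail (\<lambda>z. (\<lambda>w. f (w + - h) - f w) (h + z)) u"
    by (simp add: norm_minus_commute tail_def add.commute)
  also have "\<dots> = tail (\<lambda>w. f (w + - h) - f w) (h + u)"
    by (rule tail_shift) measurable
  also have "\<dots> \<le> ennreal (- h) * tail k (h + u)"
    using False assms by (intro tail_diff_le_pos) (auto simp: add.commute)
  finally show ?thesis using False by (simp add: min_def add.commute)
qed

lemma tail_quot_le:
  assumes "p \<le> u" "p \<le> u + h" "h \<noteq> 0"
  shows "tail (quot f h) u \<le> tail k (min u (u + h))"
proof -
  have "tail (quot f h) u = tail (\<lambda>z. (1 / of_real h) * (f (z + h) - f z)) u"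
    by (simp add: quot_def[abs_def])
  also have "\<dots> = enorm (1 / of_real h :: complex) * shift_err h u"
    by (rule tail_cmult) measurable
  also have "\<dots> \<le> ennreal (1 / \<bar>h\<bar>) * (ennreal \<bar>h\<bar> * tail k (min u (u + h)))"
    by (intro mult_mono tail_diff_le assms) (auto simp: norm_divide)
  also have "\<dots> = tail k (min u (u + h))"
    using assms by (simp add: mult.assoc[symmetric] ennreal_mult[symmetric])
  finally show ?thesis .
qed

lemma tail_quot_diff_le:
  "tail (\<lambda>z. quot f h z - quot f j z) u \<le> quot_err h u + quot_err j u"
proof (rule tail_triangle)
  fix z
  show "norm (quot f h z - quot f j z) \<le> norm (quot f h z - k z) + norm (quot f j z - k z)"
    using norm_triangle_ineq4[of "quot f h z - k z" "quot f j z - k z"] by simp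
qed measurable

lemma tail_continuous:
  assumes "v \<longlonglongrightarrow> u"
  shows "(\<lambda>n. tail k (v n)) \<longlonglongrightarrow> tail k u"
  unfolding tail_def
proof (rule nn_integral_dominated_convergence[where w="\<lambda>z. enorm (k z)"])
  show "(\<integral>\<^sup>+ z. enorm (k z) \<partial>lborel) < \<infinity>"
    using k_int by (simp add: integrable_iff_bounded)
  show "AE z in lborel. (\<lambda>n. enorm (k z) * indicator {v n<..} z) \<longlonglongrightarrow> enorm (k z) * indicator {u<..} z"
    using AE_lborel_singleton[of u]
  proof eventually_elim
    case (elim z)
    have "\<forall>\<^sub>F n in sequentially. (v n < z) = (u < z)"
    proof (cases "u < z")
      case True
      then show ?thesis using order_tendstoD(2)[OF assms, of z] by simp
    next
      case False
      then show ?thesis using order_tendstoD(1)[OF assms, of z] elim by (auto elim: eventually_mono)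
    qed
    then show ?case by (intro tendsto_eventually) (erule eventually_mono, simp add: indicator_def)
  qed
qed (auto simp: indicator_def)

text \<open>
  The difference quotients converge almost everywhere, and their norms are at most
  \<open>tail k (min u (u + h))\<close>, which tends to \<open>tail k u\<close>. By Scheffe's lemma this suffices for convergence in
  norm.
\<close>

lemma tail_quot_diff_tendsto:
  assumes "p \<le> u"
  shows "((\<lambda>h. quot_err h u) \<longlongrightarrow> 0) (at 0 within {h. p \<le> u + h})"
  unfolding tendsto_at_iff_sequentially
proof (intro allI impI)
  fix h :: "nat \<Rightarrow> real"
  assume h: "\<forall>i. h i \<in> {h. p \<le> u + h} - {0}" and lim: "h \<longlonglongrightarrow> 0"
  let ?G = "\<lambda>n z. indicator {u<..} z *\<^sub>R quot f (h n) z" and ?g = "\<lambda>z. indicator {u<..} z *\<^sub>R k z"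
  have le: "tail (quot f (h n)) u \<le> tail k (min u (u + h n))" for n
    using h assms by (intro tail_quot_le) auto
  have "(\<lambda>n. \<integral>\<^sup>+ z. enorm (?G n z - ?g z) \<partial>lborel) \<longlonglongrightarrow> 0"
  proof (rule Scheffe_lemma1)
    show "integrable lborel ?g" by (intro integrable_mult_indicator k_int) auto
    show "integrable lborel (?G n)" for n
    proof (rule integrableI_bounded)
      have "(\<integral>\<^sup>+ z. enorm (?G n z) \<partial>lborel) = tail (quot f (h n)) u"
        by (simp only: ennreal_norm_indicator tail_def)
      also have "\<dots> < \<infinity>" using le[of n] tail_finite[OF k_int] by (rule le_less_trans)
      finally show "(\<integral>\<^sup>+ z. enorm (?G n z) \<partial>lborel) < \<infinity>" .
    qed measurable
    show "AE z in lborel. (\<lambda>n. ?G n z) \<longlonglongrightarrow> ?g z"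
      using deriv
    proof eventually_elim
      case (elim z)
      show ?case
      proof (cases "u < z")
        case True
        then have "(f has_vector_derivative k z) (at z)" using elim assms by auto
        then have "((\<lambda>h. quot f h z) \<longlongrightarrow> k z) (at 0)"
          by (simp add: has_vector_derivative_iff_quot)
        then have "(\<lambda>n. quot f (h n) z) \<longlonglongrightarrow> k z"
          using h lim by (auto simp: tendsto_at_iff_sequentially o_def)
        then show ?thesis using True by simp
      qed simp
    qed
    have "(\<lambda>n. tail k (min u (u + h n))) \<longlonglongrightarrow> tail k u"
      by (rule tail_continuous) (use tendsto_min[OF tendsto_const[of u] tendsto_add[OF tendsto_const[of u] lim]] in simp)
    then have "limsup (\<lambda>n. tail k (min u (u + h n))) = tail k u"
      by (intro lim_imp_Limsup) auto
    moreover have "limsup (\<lambda>n. tail (quot f (h n)) u) \<le> limsup (\<lambda>n. tail k (min u (u + h n)))"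
      using le by (intro Limsup_mono always_eventually) auto
    ultimately show "limsup (\<lambda>n. \<integral>\<^sup>+ z. enorm (?G n z) \<partial>lborel) \<le> (\<integral>\<^sup>+ z. enorm (?g z) \<partial>lborel)"
      by (simp only: ennreal_norm_indicator tail_def)
  qed
  moreover have "(\<integral>\<^sup>+ z. enorm (?G n z - ?g z) \<partial>lborel) = tail (\<lambda>z. quot f (h n) z - k z) u" for n
    unfolding tail_def by (intro nn_integral_cong) (simp add: indicator_def)
  ultimately show "((\<lambda>h. quot_err h u) \<circ> h) \<longlonglongrightarrow> 0"
    by (simp add: o_def)
qed

text \<open>
  Uniform continuity on the whole half-line. Split \<open>k\<close> at height \<open>n\<close>: the part of \<open>k\<close> above \<open>n\<close> has small
  integral over the line for large \<open>n\<close>, and the part below contributes at most \<open>n |h|\<close>.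
\<close>

lemma uniformly_small_diff:
  assumes "0 < e"
  shows "\<exists>d>0. \<forall>z h. p < z \<longrightarrow> p < z + h \<longrightarrow> \<bar>h\<bar> < d \<longrightarrow> norm (f (z + h) - f z) \<le> e"
proof -
  let ?w = "\<lambda>n z. enorm (k z) * indicator {z. real n < norm (k z)} z"
  have "(\<lambda>n. \<integral>\<^sup>+ z. ?w n z \<partial>lborel) \<longlonglongrightarrow> (\<integral>\<^sup>+ z. 0 \<partial>(lborel :: real measure))"
  proof (rule nn_integral_dominated_convergence[where w="\<lambda>z. enorm (k z)"])
    show "(\<integral>\<^sup>+ z. enorm (k z) \<partial>lborel) < \<infinity>"
      using k_int by (simp add: integrable_iff_bounded)
    show "AE z in lborel. (\<lambda>n. ?w n z) \<longlonglongrightarrow> 0"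
    proof (rule AE_I2, rule tendsto_eventually)
      fix z
      obtain m where "norm (k z) \<le> real m" using real_arch_simple by blast
      then have "\<forall>n\<ge>m. ?w n z = 0" by auto
      then show "\<forall>\<^sub>F n in sequentially. ?w n z = 0" unfolding eventually_sequentially by blast
    qed
  qed (auto simp: indicator_def)
  then have "\<forall>\<^sub>F n in sequentially. (\<integral>\<^sup>+ z. ?w n z \<partial>lborel) < ennreal (e / 2)"
    using assms by (intro order_tendstoD(2)) auto
  then have "\<exists>n. (\<integral>\<^sup>+ z. ?w n z \<partial>lborel) < ennreal (e / 2)"
    by (rule eventually_happens'[OF sequentially_bot])
  then obtain n where n: "(\<integral>\<^sup>+ z. ?w n z \<partial>lborel) < ennreal (e / 2)" ..
  \<comment> \<open>Then \<open>n * d \<le> e / 2\<close>, also for \<open>n = 0\<close>.\<close>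
  define d where "d = e / (2 * (real n + 1))"
  have "0 < d" using assms by (simp add: d_def)
  have main: "norm (f b - f a) \<le> e" if "p < a" "a \<le> b" "b - a < d" for a b
  proof -
    have "enorm (f b - f a) \<le> (\<integral>\<^sup>+ s\<in>{a..b}. enorm (k s) \<partial>lborel)"
      by (rule norm_diff_le) fact+
    also have "\<dots> \<le> (\<integral>\<^sup>+ s. ennreal n * indicator {a..b} s + ?w n s \<partial>lborel)"
    proof (intro nn_integral_mono)
      fix s
      show "enorm (k s) * indicator {a..b} s \<le> ennreal n * indicator {a..b} s + ?w n s"
        by (cases "real n < norm (k s)"; cases "s \<in> {a..b}") (auto intro: ennreal_leI)
    qed
    also have "\<dots> = ennreal n * ennreal (b - a) + (\<integral>\<^sup>+ s. ?w n s \<partial>lborel)"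
      using that by (subst nn_integral_add) (auto simp: nn_integral_cmult)
    also have "\<dots> \<le> ennreal (e / 2) + ennreal (e / 2)"
    proof (rule add_mono)
      have "real n * (b - a) \<le> real n * d" using that by (intro mult_left_mono) auto
      also have "\<dots> \<le> e / 2" using assms by (simp add: d_def field_simps)
      finally show "ennreal n * ennreal (b - a) \<le> ennreal (e / 2)"
        using that by (simp flip: ennreal_mult add: ennreal_leI)
    qed (use n in simp)
    also have "\<dots> = ennreal e" using assms by (simp flip: ennreal_plus)
    finally show ?thesis using assms by simp
  qed
  show ?thesis
  proof (intro exI conjI allI impI)
    fix z h assume h: "p < z" "p < z + h" "\<bar>h\<bar> < d"
    show "norm (f (z + h) - f z) \<le> e"
    proof (cases "0 \<le> h")
      case True
      then show ?thesis using main[of z "z + h"] h by simp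
    next
      case False
      then show ?thesis using main[of "z + h" z] h by (simp add: norm_minus_commute)
    qed
  qed (rule \<open>0 < d\<close>)
qed

definition modulus :: "real \<Rightarrow> ennreal" where
  "modulus h = (SUP z\<in>{z. p < z \<and> p < z + h}. enorm (f (z + h) - f z))"

lemma norm_diff_le_modulus: "p < z \<Longrightarrow> p < z + h \<Longrightarrow> enorm (f (z + h) - f z) \<le> modulus h"
  unfolding modulus_def by (rule SUP_upper) simp

lemma modulus_tendsto: "(modulus \<longlongrightarrow> 0) (at 0 within S)"
proof (rule ennreal_tendsto_0_I)
  fix e :: real assume "0 < e"
  then obtain d where d: "d > 0" "\<And>z h. p < z \<Longrightarrow> p < z + h \<Longrightarrow> \<bar>h\<bar> < d \<Longrightarrow> norm (f (z + h) - f z) \<le> e"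
    using uniformly_small_diff by meson
  have "modulus h \<le> ennreal e" if "\<bar>h\<bar> < d" for h
    unfolding modulus_def using d(2) that by (intro SUP_least ennreal_leI) auto
  then show "\<forall>\<^sub>F h in at 0 within S. modulus h \<le> ennreal e"
    using d(1) by (auto simp: eventually_at dist_real_def intro!: exI[of _ d])
qed

end

lemma loc_abs_cont_primitive:
  assumes ac: "loc_abs_cont_on {p<..} g" and g [measurable]: "g \<in> borel_measurable borel"
    and fin: "(\<integral>\<^sup>+ y\<in>{p<..}. enorm (vector_derivative g (at y)) \<partial>lebesgue) < \<infinity>"
  obtains k where "primitive g k p"
    "\<And>u. p \<le> u \<Longrightarrow> tail k u = (\<integral>\<^sup>+ y\<in>{u..}. enorm (vector_derivative g (at y)) \<partial>lebesgue)"
    "\<And>u. p \<le> u \<Longrightarrow> tail k u = (\<integral>\<^sup>+ y\<in>{u<..}. enorm (vector_derivative g (at y)) \<partial>lebesgue)"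
proof -
  obtain k where k_meas [measurable]: "k \<in> borel_measurable borel" and k0: "\<And>z. z \<le> p \<Longrightarrow> k z = 0"
    and k: "AE z in lborel. p < z \<longrightarrow> (g has_vector_derivative k z) (at z)"
    and int: "\<And>u v. p < u \<Longrightarrow> u \<le> v \<Longrightarrow> (k has_integral g v - g u) {u..v}"
    using loc_abs_cont_borel_derivative[OF ac] by metis
  have eq: "AE z in lborel. u < z \<longrightarrow> norm (k z) = norm (vector_derivative g (at z))" if "p \<le> u" for u
    using k by eventually_elim (use that in \<open>auto simp: vector_derivative_at\<close>)
  have "(\<integral>\<^sup>+ z. enorm (k z) \<partial>lborel) = tail k p"
    unfolding tail_def by (intro nn_integral_cong) (auto simp: indicator_def k0 not_less)
  also have "\<dots> < \<infinity>" using tail_lebesgue(2)[OF eq[of p]] fin by simp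
  finally have k_int: "integrable lborel k" by (intro integrableI_bounded) auto
  show ?thesis
  proof
    show "primitive g k p"
    proof
      fix u v assume uv: "p < u" "u \<le> v"
      have "set_integrable lborel {u..v} k"
        unfolding set_integrable_def by (intro integrable_mult_indicator k_int) auto
      then show "g v - g u = (LINT s:{u..v}|lborel. k s)"
        using int[OF uv] by (simp add: set_borel_integral_eq_integral(2) integral_unique)
    qed (fact g k_meas k_int k)+
    show "tail k u = (\<integral>\<^sup>+ y\<in>{u..}. enorm (vector_derivative g (at y)) \<partial>lebesgue)" if "p \<le> u" for u
      using tail_lebesgue(1)[OF eq[OF that]] by simp
    show "tail k u = (\<integral>\<^sup>+ y\<in>{u<..}. enorm (vector_derivative g (at y)) \<partial>lebesgue)" if "p \<le> u" for u
      using tail_lebesgue(2)[OF eq[OF that]] by simp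
  qed
qed

section \<open>Correlation integrals\<close>

text \<open>
  For \<open>g\<close> supported in \<open>[0, \<infinity>)\<close>, the function \<open>s \<mapsto> corr g F (2 * x + s)\<close> is \<open>K\<^sub>x g\<close>. Keeping \<open>x\<close> in the
  argument lets one function describe the operators for all \<open>x\<close>.
\<close>

definition corr :: "(real \<Rightarrow> complex) \<Rightarrow> (real \<Rightarrow> complex) \<Rightarrow> real \<Rightarrow> complex" where
  "corr g f u = (LINT t|lborel. g t * f (u + t))"

lemma corr_measurable [measurable]:
  assumes [measurable]: "g \<in> borel_measurable borel" "f \<in> borel_measurable borel"
  shows "corr g f \<in> borel_measurable borel"
  unfolding corr_def[abs_def] by measurable

lemma norm_corr_le:
  assumes [measurable]: "g \<in> borel_measurable borel" "f \<in> borel_measurable borel"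
  shows "enorm (corr g f u) \<le> (\<integral>\<^sup>+ t. enorm (g t) * enorm (f (u + t)) \<partial>lborel)"
proof (cases "integrable lborel (\<lambda>t. g t * f (u + t))")
  case True
  from integral_norm_bound_ennreal[OF this] show ?thesis
    by (simp add: corr_def norm_mult ennreal_mult)
qed (simp add: corr_def not_integrable_integral_eq)

text \<open>
  Young's inequality before the tails of \<open>f\<close> are bounded by a common value; this form is needed where the
  contributions of small and of large \<open>t\<close> are treated differently.
\<close>

lemma tail_corr_le_integral:
  assumes [measurable]: "g \<in> borel_measurable borel" "f \<in> borel_measurable borel"
  shows "tail (corr g f) u \<le> (\<integral>\<^sup>+ t. enorm (g t) * tail f (u + t) \<partial>lborel)"
proof -
  have "tail (corr g f) u \<le> (\<integral>\<^sup>+ z. (\<integral>\<^sup>+ t. enorm (g t) * enorm (f (z + t)) * indicator {u<..} z \<partial>lborel) \<partial>lborel)"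
    unfolding tail_def
  proof (intro nn_integral_mono)
    fix z
    have "enorm (corr g f z) * indicator {u<..} z
        \<le> (\<integral>\<^sup>+ t. enorm (g t) * enorm (f (z + t)) \<partial>lborel) * indicator {u<..} z"
      using norm_corr_le[of g f z] by (cases "u < z") simp_all
    also have "\<dots> = (\<integral>\<^sup>+ t. enorm (g t) * enorm (f (z + t)) * indicator {u<..} z \<partial>lborel)"
      by (rule nn_integral_multc[symmetric]) measurable
    finally show "enorm (corr g f z) * indicator {u<..} z \<le> \<dots>" .
  qed
  also have "\<dots> = (\<integral>\<^sup>+ t. (\<integral>\<^sup>+ z. enorm (g t) * enorm (f (z + t)) * indicator {u<..} z \<partial>lborel) \<partial>lborel)"
    by (rule lborel_pair.Fubini') measurable
  also have "\<dots> = (\<integral>\<^sup>+ t. enorm (g t) * tail f (u + t) \<partial>lborel)"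
  proof (intro nn_integral_cong)
    fix t :: real
    have "(\<integral>\<^sup>+ z. enorm (g t) * enorm (f (z + t)) * indicator {u<..} z \<partial>lborel)
       = (\<integral>\<^sup>+ z. enorm (g t) * (enorm (f (t + z)) * indicator {u<..} z) \<partial>lborel)"
      by (simp add: ac_simps)
    also have "\<dots> = enorm (g t) * tail (\<lambda>z. f (t + z)) u"
      unfolding tail_def by (rule nn_integral_cmult) measurable
    also have "\<dots> = enorm (g t) * tail f (u + t)"
      by (subst tail_shift) (auto simp: add.commute)
    finally show "(\<integral>\<^sup>+ z. enorm (g t) * enorm (f (z + t)) * indicator {u<..} z \<partial>lborel)
        = enorm (g t) * tail f (u + t)" .
  qed
  finally show ?thesis .
qed

lemma tail_zero_eq:
  assumes "\<And>t. t \<le> 0 \<Longrightarrow> g t = 0"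
  shows "tail g 0 = (\<integral>\<^sup>+ t. enorm (g t) \<partial>lborel)"
  unfolding tail_def using assms by (intro nn_integral_cong) (auto simp: indicator_def)

lemma tail_corr_le:
  assumes [measurable]: "g \<in> borel_measurable borel" "f \<in> borel_measurable borel"
    and g0: "\<And>t. t \<le> 0 \<Longrightarrow> g t = 0"
  shows "tail (corr g f) u \<le> tail g 0 * tail f u"
proof -
  have "tail (corr g f) u \<le> (\<integral>\<^sup>+ t. enorm (g t) * tail f (u + t) \<partial>lborel)"
    by (rule tail_corr_le_integral) measurable
  also have "\<dots> \<le> (\<integral>\<^sup>+ t. enorm (g t) * tail f u \<partial>lborel)"
  proof (intro nn_integral_mono)
    fix t
    show "enorm (g t) * tail f (u + t) \<le> enorm (g t) * tail f u"
      using g0[of t] by (cases "t \<le> 0") (auto intro!: mult_left_mono tail_antimono)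
  qed
  also have "\<dots> = tail g 0 * tail f u"
    by (subst nn_integral_multc) (auto simp: tail_zero_eq g0)
  finally show ?thesis .
qed

lemma norm_corr_le_bounded_right:
  assumes [measurable]: "g \<in> borel_measurable borel" "f \<in> borel_measurable borel"
    and g0: "\<And>t. t \<le> 0 \<Longrightarrow> g t = 0" and M: "\<And>z. u < z \<Longrightarrow> enorm (f z) \<le> M"
  shows "enorm (corr g f u) \<le> M * tail g 0"
proof -
  have "enorm (corr g f u) \<le> (\<integral>\<^sup>+ t. enorm (g t) * enorm (f (u + t)) \<partial>lborel)"
    by (rule norm_corr_le) measurable
  also have "\<dots> \<le> (\<integral>\<^sup>+ t. M * enorm (g t) \<partial>lborel)"
  proof (intro nn_integral_mono)
    fix t
    show "enorm (g t) * enorm (f (u + t)) \<le> M * enorm (g t)"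
    proof (cases "t \<le> 0")
      case False
      then have "enorm (g t) * enorm (f (u + t)) \<le> enorm (g t) * M"
        using M[of "u + t"] by (intro mult_left_mono) auto
      then show ?thesis by (simp add: mult.commute)
    qed (simp add: g0)
  qed
  also have "\<dots> = M * tail g 0"
    by (subst nn_integral_cmult) (auto simp: tail_zero_eq g0)
  finally show ?thesis .
qed

lemma norm_corr_le_bounded_left:
  assumes [measurable]: "g \<in> borel_measurable borel" "f \<in> borel_measurable borel"
    and g0: "\<And>t. t \<le> 0 \<Longrightarrow> g t = 0" and M: "\<And>t. enorm (g t) \<le> M"
  shows "enorm (corr g f u) \<le> M * tail f u"
proof -
  have "enorm (corr g f u) \<le> (\<integral>\<^sup>+ t. enorm (g t) * enorm (f (u + t)) \<partial>lborel)"
    by (rule norm_corr_le) measurable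
  also have "\<dots> \<le> (\<integral>\<^sup>+ t. M * (enorm (f (u + t)) * indicator {0<..} t) \<partial>lborel)"
  proof (intro nn_integral_mono)
    fix t
    show "enorm (g t) * enorm (f (u + t)) \<le> M * (enorm (f (u + t)) * indicator {0<..} t)"
      using g0[of t] M[of t] by (cases "t \<le> 0") (auto intro!: mult_right_mono)
  qed
  also have "\<dots> = M * tail (\<lambda>t. f (u + t)) 0"
    unfolding tail_def by (rule nn_integral_cmult) measurable
  finally show ?thesis by (simp add: tail_shift)
qed

lemma integrable_corr_bounded_right:
  fixes f g :: "real \<Rightarrow> complex"
  assumes "integrable lborel g" and [measurable]: "f \<in> borel_measurable borel"
    and M: "\<And>z. norm (f z) \<le> M"
  shows "integrable lborel (\<lambda>t. g t * f (u + t))"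
proof (rule Bochner_Integration.integrable_bound[where f="\<lambda>t. M * norm (g t)"])
  have [measurable]: "g \<in> borel_measurable borel" using assms(1) by auto
  show "(\<lambda>t. g t * f (u + t)) \<in> borel_measurable lborel" by measurable
  show "AE t in lborel. norm (g t * f (u + t)) \<le> norm (M * norm (g t))"
  proof (rule AE_I2)
    fix t
    have "norm (g t) * norm (f (u + t)) \<le> norm (g t) * \<bar>M\<bar>" using M[of "u + t"] by (intro mult_left_mono) auto
    then show "norm (g t * f (u + t)) \<le> norm (M * norm (g t))" by (simp add: norm_mult abs_mult mult.commute)
  qed
qed (use assms(1) in auto)

lemma corr_cmult_left: "corr (\<lambda>t. c * g t) f u = c * corr g f u"
  by (simp add: corr_def mult.assoc)

lemma corr_divide_left: "corr (\<lambda>t. g t / c) f u = corr g f u / c"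
  using corr_cmult_left[of "1 / c" g f u] by simp

lemma corr_divide_right: "corr g (\<lambda>z. f z / c) u = corr g f u / c"
  by (simp add: corr_def)

lemma corr_diff_left:
  assumes "integrable lborel (\<lambda>t. g t * f (u + t))" "integrable lborel (\<lambda>t. h t * f (u + t))"
  shows "corr (\<lambda>t. g t - h t) f u = corr g f u - corr h f u"
  unfolding corr_def by (simp add: left_diff_distrib Bochner_Integration.integral_diff[OF assms])

lemma corr_diff_right:
  assumes "integrable lborel (\<lambda>t. g t * f (u + t))" "integrable lborel (\<lambda>t. g t * h (u + t))"
  shows "corr g (\<lambda>z. f z - h z) u = corr g f u - corr g h u"
  unfolding corr_def by (simp add: right_diff_distrib Bochner_Integration.integral_diff[OF assms])

lemma corr_shift: "corr g (\<lambda>z. f (z + h)) u = corr g f (u + h)"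
  by (simp add: corr_def ac_simps)

section \<open>Absorption and Cauchy estimates\<close>

text \<open>
  Inversion of \<open>1 + K\<close> on the level of norms: an equation \<open>g + K g = r\<close> with \<open>\<parallel>K\<parallel> \<le> q < 1\<close> leads to the
  first assumption with \<open>n = \<parallel>g\<parallel>\<close> and \<open>a = \<parallel>r\<parallel>\<close>. Finiteness of \<open>n\<close> is what allows the subtraction.
\<close>

lemma tail_le_absorb:
  fixes n a :: ennreal and q :: real
  assumes "n \<le> a + ennreal q * n" "n < \<infinity>" "0 \<le> q" "q < 1"
  shows "n \<le> ennreal (1 / (1 - q)) * a"
proof (cases a)
  case (real r)
  obtain m where m: "n = ennreal m" "0 \<le> m" using assms(2) by (cases n) auto
  have "ennreal m \<le> ennreal (r + q * m)"
    using assms(1) real m assms(3) by (simp add: ennreal_mult)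
  then have "m \<le> r + q * m" using real m assms(3) by (subst (asm) ennreal_le_iff) auto
  then have "m \<le> 1 / (1 - q) * r" using assms(4) by (simp add: field_simps)
  then show ?thesis using m real assms by (simp add: ennreal_mult[symmetric] ennreal_leI)
next
  case top
  then show ?thesis using assms by (simp add: ennreal_mult_top)
qed

lemma tendsto_ennreal_cmult_0:
  fixes c :: ennreal
  assumes "(r \<longlongrightarrow> 0) Fl" "c < \<infinity>"
  shows "((\<lambda>x. c * r x) \<longlongrightarrow> 0) Fl"
  using ennreal_tendsto_cmult[OF _ assms(1), of c] assms(2) by simp

text \<open>
  All Cauchy estimates below bound the distance for two increments \<open>h\<close>, \<open>j\<close> by \<open>r h + r j\<close> with one rate
  \<open>r\<close>.
\<close>

lemma convergent_of_Cauchy_bound: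
  fixes Q :: "real \<Rightarrow> complex" and r :: "real \<Rightarrow> ennreal"
  assumes r: "(r \<longlongrightarrow> 0) (at 0 within S)"
    and le: "\<And>h j. h \<in> S - {0} \<Longrightarrow> j \<in> S - {0} \<Longrightarrow> enorm (Q h - Q j) \<le> r h + r j"
  shows "\<exists>L. (Q \<longlongrightarrow> L) (at 0 within S)"
proof -
  have "cauchy_filter (filtermap Q (at 0 within S))"
    unfolding cauchy_filter_metric_filtermap
  proof (intro allI impI)
    fix e :: real assume "0 < e"
    have "\<forall>\<^sub>F h in at 0 within S. r h < ennreal (e / 3)"
      using \<open>0 < e\<close> by (intro order_tendstoD(2)[OF r]) simp
    then have ev: "\<forall>\<^sub>F h in at 0 within S. r h < ennreal (e / 3) \<and> h \<in> S - {0}"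
      by (auto simp: eventually_at_filter elim: eventually_mono)
    show "\<exists>P. eventually P (at 0 within S) \<and> (\<forall>x y. P x \<and> P y \<longrightarrow> dist (Q x) (Q y) < e)"
    proof (intro exI conjI allI impI)
      fix h j assume hj: "(r h < ennreal (e / 3) \<and> h \<in> S - {0}) \<and> (r j < ennreal (e / 3) \<and> j \<in> S - {0})"
      have "enorm (Q h - Q j) \<le> ennreal (e / 3) + ennreal (e / 3)"
        using hj by (intro order.trans[OF le[of h j]] add_mono) auto
      also have "\<dots> = ennreal (2 * e / 3)" using \<open>0 < e\<close> by (simp flip: ennreal_plus)
      finally show "dist (Q h) (Q j) < e" using \<open>0 < e\<close> by (simp add: dist_norm)
    qed (rule ev)
  qed
  then have "convergent_filter (filtermap Q (at 0 within S))" by (rule cauchy_filter_convergent)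
  then show ?thesis by (simp add: convergent_filter_iff filterlim_def)
qed

section \<open>The Marchenko equation in \<open>L\<^sup>1\<close>\<close>

text \<open>
  Here \<open>f\<close> stands for \<open>F\<close> on \<open>(2x\<^sub>0, \<infinity>)\<close>, extended by \<open>0\<close> so that it is a Borel function on the line, and
  \<open>b x t\<close> stands for \<open>A(x, x + t)\<close>, extended by \<open>0\<close> to \<open>t \<le> 0\<close>. With these extensions the integrals
  run over the whole line.
\<close>

locale marchenko_L1 =
  fixes f :: "real \<Rightarrow> complex" and b :: "real \<Rightarrow> real \<Rightarrow> complex" and x0 q :: real
  assumes f_measurable [measurable]: "f \<in> borel_measurable borel"
    and f_zero: "\<And>z. z \<le> 2 * x0 \<Longrightarrow> f z = 0"
    and q: "0 \<le> q" "q < 1" and tail_le_q: "tail f (2 * x0) \<le> ennreal q"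
    and b_measurable [measurable]: "\<And>x. b x \<in> borel_measurable borel"
    and b_int: "\<And>x. x0 \<le> x \<Longrightarrow> integrable lborel (b x)"
    and b_zero: "\<And>x t. t \<le> 0 \<Longrightarrow> b x t = 0"
    and b_eq: "\<And>x t. x0 \<le> x \<Longrightarrow> 0 < t \<Longrightarrow> b x t = - f (2 * x + t) - corr (b x) f (2 * x + t)"
begin

lemma tail_f_le_q: "2 * x0 \<le> u \<Longrightarrow> tail f u \<le> ennreal q"
  using tail_antimono[of "2 * x0" u f] tail_le_q by (rule order.trans)

lemma tail_b_le:
  assumes x: "x0 \<le> x"
  shows "tail (b x) 0 \<le> ennreal (1 / (1 - q)) * tail f (2 * x)"
proof (rule tail_le_absorb[OF _ _ q])
  have "tail (b x) 0 \<le> tail (\<lambda>t. f (2 * x + t)) 0 + tail (\<lambda>t. corr (b x) f (2 * x + t)) 0"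
    using norm_triangle_ineq4[of "- f (2 * x + _)" "corr (b x) f (2 * x + _)"]
    by (intro tail_triangle) (auto simp: b_eq[OF x])
  also have "\<dots> = tail f (2 * x) + tail (corr (b x) f) (2 * x)"
    by (simp add: tail_shift)
  also have "tail (corr (b x) f) (2 * x) \<le> tail (b x) 0 * tail f (2 * x)"
    by (rule tail_corr_le) (auto simp: b_zero)
  also have "\<dots> \<le> tail (b x) 0 * ennreal q"
    using x by (intro mult_left_mono tail_f_le_q) auto
  finally show "tail (b x) 0 \<le> tail f (2 * x) + ennreal q * tail (b x) 0"
    by (simp add: mult.commute add_left_mono)
  show "tail (b x) 0 < \<infinity>" using tail_finite[OF b_int[OF x]] .
qed

text \<open>
  A bound, uniform in \<open>x\<close>, of the \<open>L\<^sup>1\<close> norm of \<open>b x\<close>.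
\<close>

definition B :: real where "B = q / (1 - q)"

lemma B_nonneg: "0 \<le> B" using q by (simp add: B_def)

lemma tail_b_le_B:
  assumes "x0 \<le> x"
  shows "tail (b x) 0 \<le> ennreal B"
proof -
  have "tail (b x) 0 \<le> ennreal (1 / (1 - q)) * tail f (2 * x)" by (rule tail_b_le) fact
  also have "\<dots> \<le> ennreal (1 / (1 - q)) * ennreal q"
    using assms by (intro mult_left_mono tail_f_le_q) auto
  also have "\<dots> = ennreal B" using q by (simp add: B_def flip: ennreal_mult)
  finally show ?thesis .
qed

end

section \<open>Difference quotients of the solution\<close>

text \<open>
  From here on \<open>f\<close> is bounded and has the integrable density \<open>k\<close>. The number \<open>q\<close> is a parameter and not
  defined from \<open>x0\<close>: the results are later applied with \<open>x0\<close> replaced by larger points, and all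
  constants have to remain those of the original \<open>q\<close>.
\<close>

locale marchenko_core = marchenko_L1 f b x0 q + primitive f k "2 * x0"
  for f k :: "real \<Rightarrow> complex" and b :: "real \<Rightarrow> real \<Rightarrow> complex" and x0 q :: real +
  fixes M :: real
  assumes f_bound: "\<And>z. norm (f z) \<le> M"
begin

lemma M_nonneg: "0 \<le> M" using f_bound[of 0] norm_ge_zero order.trans by blast

lemma f_bound': "enorm (f z) \<le> ennreal M" by (rule ennreal_leI[OF f_bound])

lemma integrable_b_f: "x0 \<le> x \<Longrightarrow> integrable lborel (\<lambda>t. b x t * f (u + t))"
  by (rule integrable_corr_bounded_right[OF b_int _ f_bound]) auto

lemma integrable_b_f_shift: "x0 \<le> x \<Longrightarrow> integrable lborel (\<lambda>t. b x t * f (u + t + h))"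
  using integrable_b_f[of x "u + h"] by (simp add: ac_simps)

text \<open>
  A uniform bound of \<open>b\<close>.
\<close>

definition Mb :: real where "Mb = M + M * B"

lemma Mb_nonneg: "0 \<le> Mb" using M_nonneg B_nonneg by (simp add: Mb_def)

lemma b_bound: 
  assumes x: "x0 \<le> x"
  shows "enorm (b x t) \<le> ennreal Mb"
proof (cases "0 < t")
  case True
  have "norm (b x t) \<le> norm (f (2 * x + t)) + norm (corr (b x) f (2 * x + t))"
    using norm_triangle_ineq4[of "- f (2 * x + t)" "corr (b x) f (2 * x + t)"] by (simp add: b_eq[OF x True])
  then have "enorm (b x t) \<le> enorm (f (2 * x + t)) + enorm (corr (b x) f (2 * x + t))"
    by (simp flip: ennreal_plus add: ennreal_leI)
  also have "\<dots> \<le> ennreal M + ennreal M * tail (b x) 0"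
    by (intro add_mono f_bound' norm_corr_le_bounded_right) (auto simp: b_zero)
  also have "\<dots> \<le> ennreal M + ennreal M * ennreal B"
    using tail_b_le_B[OF x] by (intro add_left_mono mult_left_mono) auto
  also have "\<dots> = ennreal Mb" using M_nonneg B_nonneg by (simp add: Mb_def flip: ennreal_mult)
  finally show ?thesis .
qed (simp add: b_zero)

definition b_quot :: "real \<Rightarrow> real \<Rightarrow> real \<Rightarrow> complex" where
  "b_quot x h t = (b (x + h) t - b x t) / of_real h"

lemma b_quot_zero: "t \<le> 0 \<Longrightarrow> b_quot x h t = 0" by (simp add: b_quot_def b_zero)

lemma b_quot_int: "x0 \<le> x \<Longrightarrow> x0 \<le> x + h \<Longrightarrow> integrable lborel (b_quot x h)"
  unfolding b_quot_def[abs_def] by (intro integrable_divide Bochner_Integration.integrable_diff b_int)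

lemma b_quot_measurable [measurable]: "b_quot x h \<in> borel_measurable borel"
  unfolding b_quot_def[abs_def] by measurable

lemma integrable_b_quot_f: "x0 \<le> x \<Longrightarrow> x0 \<le> x + h \<Longrightarrow> integrable lborel (\<lambda>t. b_quot x h t * f (u + t))"
  by (rule integrable_corr_bounded_right[OF b_quot_int _ f_bound]) auto

lemma integrable_b_quot_f_shift: "x0 \<le> x \<Longrightarrow> x0 \<le> x + h \<Longrightarrow> integrable lborel (\<lambda>t. b_quot x h t * f (u + t + j))"
  using integrable_b_quot_f[of x h "u + j"] by (simp add: ac_simps)

lemma integrable_b_quot: "x0 \<le> x \<Longrightarrow> integrable lborel (\<lambda>t. b x t * quot f h (u + t))"
  using integrable_b_f_shift[of x u h] integrable_b_f[of x u]
  by (simp add: quot_def right_diff_distrib diff_divide_distrib)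

text \<open>
  The discrete product rule for \<open>corr (b x) f u\<close> when \<open>x\<close> moves by \<open>h\<close> and \<open>u\<close> by \<open>s\<close>. It is used with
  \<open>s = 2 * h\<close> for the equation of \<open>b\<close> and with \<open>s = h\<close> for \<open>A\<close> at fixed \<open>y\<close>.
\<close>

lemma corr_step:
  assumes x: "x0 \<le> x" "x0 \<le> x + h" and h: "h \<noteq> 0"
  shows "(corr (b (x + h)) f (u + s) - corr (b x) f u) / of_real h
       = corr (b_quot x h) f (u + s) + corr (b x) (\<lambda>z. f (z + s) - f z) u / of_real h"
proof -
  have "corr (b_quot x h) f (u + s) = (corr (b (x + h)) f (u + s) - corr (b x) f (u + s)) / of_real h"
    unfolding b_quot_def[abs_def] corr_divide_left
    by (subst corr_diff_left) (use x integrable_b_f in auto)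
  moreover have "corr (b x) (\<lambda>z. f (z + s) - f z) u = corr (b x) f (u + s) - corr (b x) f u"
    by (subst corr_diff_right) (use x integrable_b_f integrable_b_f_shift corr_shift in auto)
  ultimately show ?thesis by (simp add: diff_divide_distrib add_divide_distrib)
qed

text \<open>
  This is \<open>(1 + K\<^bsub>x+h\<^esub>) D\<^sub>h = R\<^sub>h\<close>; the factors \<open>2\<close> come from \<open>F(2x + t)\<close>.
\<close>

lemma b_quot_eq:
  assumes x: "x0 \<le> x" "x0 \<le> x + h" and h: "h \<noteq> 0" and t: "0 < t"
  shows "b_quot x h t = - 2 * quot f (2 * h) (2 * x + t) - corr (b_quot x h) f (2 * x + t + 2 * h)
     - 2 * corr (b x) (quot f (2 * h)) (2 * x + t)"
proof -
  have "b_quot x h t = - ((f (2 * x + t + 2 * h) - f (2 * x + t)) / of_real h)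
      - (corr (b (x + h)) f (2 * x + t + 2 * h) - corr (b x) f (2 * x + t)) / of_real h"
  proof -
    have "b (x + h) t - b x t = - (f (2 * x + t + 2 * h) - f (2 * x + t))
        - (corr (b (x + h)) f (2 * x + t + 2 * h) - corr (b x) f (2 * x + t))"
    proof -
      have e: "2 * (x + h) + t = 2 * x + t + 2 * h" by simp
      show ?thesis unfolding b_eq[OF x(1) t] b_eq[OF x(2) t] e by simp
    qed
    then show ?thesis by (simp add: b_quot_def diff_divide_distrib)
  qed
  also have "(f (2 * x + t + 2 * h) - f (2 * x + t)) / of_real h = 2 * quot f (2 * h) (2 * x + t)"
    using h by (simp add: quot_def field_simps)
  also have "(corr (b (x + h)) f (2 * x + t + 2 * h) - corr (b x) f (2 * x + t)) / of_real h
      = corr (b_quot x h) f (2 * x + t + 2 * h) + corr (b x) (\<lambda>z. f (z + 2 * h) - f z) (2 * x + t) / of_real h"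
    by (rule corr_step[OF x h])
  also have "corr (b x) (\<lambda>z. f (z + 2 * h) - f z) (2 * x + t) / of_real h = 2 * corr (b x) (quot f (2 * h)) (2 * x + t)"
    using h by (simp add: quot_def[abs_def] corr_divide_right)
  finally show ?thesis by (simp add: algebra_simps)
qed

lemma tail_b_quot_le:
  assumes x: "x0 \<le> x" "x0 \<le> x + h" and h: "h \<noteq> 0"
  shows "tail (b_quot x h) 0 \<le> ennreal (1 / (1 - q)) * (2 * (1 + tail (b x) 0) * tail k (min (2 * x) (2 * x + 2 * h)))"
proof (rule tail_le_absorb[OF _ _ q])
  let ?K = "tail k (min (2 * x) (2 * x + 2 * h))"
  let ?u = "\<lambda>t. 2 * quot f (2 * h) (2 * x + t) + 2 * corr (b x) (quot f (2 * h)) (2 * x + t)"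
  have Q: "tail (quot f (2 * h)) (2 * x) \<le> ?K" using x h by (intro tail_quot_le) auto
  have "tail (b_quot x h) 0 \<le> tail ?u 0 + tail (\<lambda>t. corr (b_quot x h) f ((2 * x + 2 * h) + t)) 0"
  proof (rule tail_triangle)
    fix t :: real assume "0 < t"
    show "norm (b_quot x h t) \<le> norm (?u t) + norm (corr (b_quot x h) f ((2 * x + 2 * h) + t))"
      using norm_triangle_ineq4[of "- ?u t" "corr (b_quot x h) f ((2 * x + 2 * h) + t)"]
      unfolding b_quot_eq[OF x h \<open>0 < t\<close>] norm_minus_cancel by (simp add: algebra_simps)
  qed auto
  also have "\<dots> \<le> 2 * (1 + tail (b x) 0) * ?K + ennreal q * tail (b_quot x h) 0"
  proof (rule add_mono)
    have "tail (\<lambda>t. corr (b_quot x h) f ((2 * x + 2 * h) + t)) 0 = tail (corr (b_quot x h) f) (2 * x + 2 * h)"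
      by (simp add: tail_shift)
    also have "\<dots> \<le> tail (b_quot x h) 0 * tail f (2 * x + 2 * h)"
      by (rule tail_corr_le) (auto simp: b_quot_zero)
    also have "\<dots> \<le> tail (b_quot x h) 0 * ennreal q"
      using x by (intro mult_left_mono tail_f_le_q) auto
    finally show "tail (\<lambda>t. corr (b_quot x h) f ((2 * x + 2 * h) + t)) 0 \<le> ennreal q * tail (b_quot x h) 0"
      by (simp add: mult.commute)
    have "tail ?u 0 \<le> tail (\<lambda>t. 2 * quot f (2 * h) (2 * x + t)) 0 + tail (\<lambda>t. 2 * corr (b x) (quot f (2 * h)) (2 * x + t)) 0"
      by (rule tail_triangle[OF _ _ norm_triangle_ineq]) measurable
    also have "\<dots> = 2 * tail (quot f (2 * h)) (2 * x) + 2 * tail (corr (b x) (quot f (2 * h))) (2 * x)"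
      by (simp add: tail_cmult tail_shift)
    also have "\<dots> \<le> 2 * tail (quot f (2 * h)) (2 * x) + 2 * (tail (b x) 0 * tail (quot f (2 * h)) (2 * x))"
      by (intro add_left_mono mult_left_mono tail_corr_le) (auto simp: b_zero)
    also have "\<dots> \<le> 2 * ?K + 2 * (tail (b x) 0 * ?K)"
      by (intro add_mono mult_left_mono Q) auto
    also have "\<dots> = 2 * (1 + tail (b x) 0) * ?K" by (simp add: algebra_simps)
    finally show "tail ?u 0 \<le> 2 * (1 + tail (b x) 0) * ?K" .
  qed
  finally show "tail (b_quot x h) 0 \<le> 2 * (1 + tail (b x) 0) * ?K + ennreal q * tail (b_quot x h) 0" .
  show "tail (b_quot x h) 0 < \<infinity>" using tail_finite[OF b_quot_int] x .
qed

text \<open>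
  A bound, uniform in \<open>x\<close> and \<open>h\<close>, of the norm of \<open>b_quot x h\<close>.
\<close>

definition C :: ennreal where
  "C = ennreal (1 / (1 - q)) * (2 * (1 + ennreal B) * tail k (2 * x0))"

lemma C_finite: "C < \<infinity>"
  using tail_finite[OF k_int, of "2 * x0"] by (simp add: C_def ennreal_mult_less_top)

lemma tail_b_quot_le_C:
  assumes x: "x0 \<le> x" "x0 \<le> x + h" and h: "h \<noteq> 0"
  shows "tail (b_quot x h) 0 \<le> C"
  unfolding C_def using x
  by (intro order.trans[OF tail_b_quot_le[OF x h]] mult_mono add_mono tail_b_le_B tail_antimono) auto

text \<open>
  The increments \<open>h\<close> that keep \<open>x + h\<close> in \<open>[x\<^sub>0, \<infinity>)\<close>: a neighbourhood of \<open>0\<close> if \<open>x > x\<^sub>0\<close>, and the half-line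
  \<open>h \<ge> 0\<close> if \<open>x = x\<^sub>0\<close>. The limits below are two-sided or one-sided accordingly.
\<close>

definition shifts :: "real \<Rightarrow> real set" where "shifts x = {h. x0 \<le> x + h}"

lemma filterlim_double: "filterlim (\<lambda>h. 2 * h) (at 0 within {h. 2 * x0 \<le> 2 * x + h}) (at 0 within shifts x)"
proof -
  have "((\<lambda>h. 2 * h) \<longlongrightarrow> 2 * 0) (at 0 within shifts x)" by (intro tendsto_intros)
  then show ?thesis by (auto simp: filterlim_at eventually_at_filter shifts_def)
qed

lemma tail_diff_tendsto:
  assumes x: "x0 \<le> x"
  shows "((\<lambda>h. shift_err h (2 * x)) \<longlongrightarrow> 0) (at 0 within {h. 2 * x0 \<le> 2 * x + h})"
proof (rule tendsto_sandwich[OF _ _ tendsto_const])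
  have "shift_err h (2 * x) \<le> ennreal \<bar>h\<bar> * tail k (2 * x0)" if "2 * x0 \<le> 2 * x + h" for h
    using that x by (intro order.trans[OF tail_diff_le] mult_left_mono tail_antimono) auto
  then show "\<forall>\<^sub>F h in at 0 within {h. 2 * x0 \<le> 2 * x + h}.
      shift_err h (2 * x) \<le> ennreal \<bar>h\<bar> * tail k (2 * x0)"
    by (simp add: eventually_at_filter)
  have "((\<lambda>h. ennreal \<bar>h\<bar> * tail k (2 * x0)) \<longlongrightarrow> ennreal \<bar>0\<bar> * tail k (2 * x0)) (at 0 within {h. 2 * x0 \<le> 2 * x + h})"
    using tail_finite[OF k_int, of "2 * x0"] by (intro tendsto_intros ennreal_tendsto_cmult) auto
  then show "((\<lambda>h. ennreal \<bar>h\<bar> * tail k (2 * x0)) \<longlongrightarrow> 0) (at 0 within {h. 2 * x0 \<le> 2 * x + h})"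
    by simp
qed simp

definition rate_b :: "real \<Rightarrow> real \<Rightarrow> ennreal" where
  "rate_b x h = ennreal (1 / (1 - q)) *
     (2 * (1 + ennreal B) * quot_err (2 * h) (2 * x)
        + C * shift_err (2 * h) (2 * x))"

lemma rate_b_tendsto:
  assumes x: "x0 \<le> x"
  shows "(rate_b x \<longlongrightarrow> 0) (at 0 within shifts x)"
proof -
  have "((\<lambda>h. quot_err (2 * h) (2 * x)) \<longlongrightarrow> 0) (at 0 within shifts x)"
    using filterlim_compose[OF tail_quot_diff_tendsto filterlim_double[of x]] x by simp
  moreover have "((\<lambda>h. shift_err (2 * h) (2 * x)) \<longlongrightarrow> 0) (at 0 within shifts x)"
    using filterlim_compose[OF tail_diff_tendsto[OF x] filterlim_double[of x]] by simp
  ultimately have "((\<lambda>h. 2 * (1 + ennreal B) * quot_err (2 * h) (2 * x)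
        + C * shift_err (2 * h) (2 * x)) \<longlongrightarrow> 0 + 0) (at 0 within shifts x)"
    using C_finite by (intro tendsto_add tendsto_ennreal_cmult_0) (auto simp: ennreal_mult_less_top)
  then show ?thesis
    unfolding rate_b_def[abs_def] by (intro tendsto_ennreal_cmult_0) auto
qed

lemma tail_corr_b_le:
  assumes "x0 \<le> x" and [measurable]: "g \<in> borel_measurable borel"
  shows "tail (corr (b x) g) u \<le> ennreal B * tail g u"
proof -
  have "tail (corr (b x) g) u \<le> tail (b x) 0 * tail g u" by (rule tail_corr_le) (auto simp: b_zero)
  also have "\<dots> \<le> ennreal B * tail g u" using assms(1) by (intro mult_right_mono tail_b_le_B) auto
  finally show ?thesis .
qed

lemma tail_corr_b_quot_le:
  assumes "x0 \<le> x" "x0 \<le> x + h" "h \<noteq> 0" and [measurable]: "g \<in> borel_measurable borel"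
  shows "tail (corr (b_quot x h) g) u \<le> C * tail g u"
proof -
  have "tail (corr (b_quot x h) g) u \<le> tail (b_quot x h) 0 * tail g u" by (rule tail_corr_le) (auto simp: b_quot_zero)
  also have "\<dots> \<le> C * tail g u" using assms by (intro mult_right_mono tail_b_quot_le_C) auto
  finally show ?thesis .
qed

text \<open>
  The difference \<open>E\<close> of two quotients solves \<open>(1 + K\<^sub>x) E = r\<close>, where \<open>r\<close> contains the differences of the
  quotients of \<open>f\<close> and the errors made by replacing \<open>K\<^bsub>x+h\<^esub>\<close> and \<open>K\<^bsub>x+j\<^esub>\<close> by \<open>K\<^sub>x\<close>. These errors are small
  since the quotients are bounded in norm by \<open>C\<close> and translation is continuous in \<open>L\<^sup>1\<close>.
\<close>

lemma tail_b_quot_Cauchy: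
  assumes x: "x0 \<le> x" and h: "h \<in> shifts x - {0}" and j: "j \<in> shifts x - {0}"
  shows "tail (\<lambda>t. b_quot x h t - b_quot x j t) 0 \<le> rate_b x h + rate_b x j"
proof -
  have hj: "x0 \<le> x + h" "h \<noteq> 0" "x0 \<le> x + j" "j \<noteq> 0" using h j by (auto simp: shifts_def)
  define E where "E = (\<lambda>t. b_quot x h t - b_quot x j t)"
  have [measurable]: "E \<in> borel_measurable borel" unfolding E_def by measurable
  have E_int: "integrable lborel E" unfolding E_def by (intro Bochner_Integration.integrable_diff b_quot_int x hj)
  define Q where "Q = (\<lambda>z. quot f (2 * h) z - quot f (2 * j) z)"
  have [measurable]: "Q \<in> borel_measurable borel" unfolding Q_def by measurable
  define P where "P = (\<lambda>h. corr (b_quot x h) (\<lambda>z. f (z + 2 * h) - f z))"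
  have P_meas [measurable]: "P h \<in> borel_measurable borel" "P j \<in> borel_measurable borel"
    unfolding P_def by measurable
  have P_le: "tail (P i) (2 * x) \<le> C * shift_err (2 * i) (2 * x)" if "x0 \<le> x + i" "i \<noteq> 0" for i
    unfolding P_def using x that by (intro tail_corr_b_quot_le) auto
  have E_eq: "E t = - ((2 * Q (2 * x + t) + 2 * corr (b x) Q (2 * x + t)) + corr E f (2 * x + t) + (P h (2 * x + t) - P j (2 * x + t)))"
    if "0 < t" for t
  proof -
    have c1: "corr E f (2 * x + t) = corr (b_quot x h) f (2 * x + t) - corr (b_quot x j) f (2 * x + t)"
      unfolding E_def by (rule corr_diff_left) (use x hj integrable_b_quot_f in auto)
    have c2: "corr (b x) Q (2 * x + t) = corr (b x) (quot f (2 * h)) (2 * x + t) - corr (b x) (quot f (2 * j)) (2 * x + t)"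
      unfolding Q_def by (rule corr_diff_right) (use x integrable_b_quot in auto)
    have c3: "P i (2 * x + t) = corr (b_quot x i) f (2 * x + t + 2 * i) - corr (b_quot x i) f (2 * x + t)" if "x0 \<le> x + i" for i
      unfolding P_def
      by (subst corr_diff_right) (use x that integrable_b_quot_f integrable_b_quot_f_shift corr_shift in auto)
    have c4: "E t = b_quot x h t - b_quot x j t" by (simp add: E_def)
    have c5: "Q (2 * x + t) = quot f (2 * h) (2 * x + t) - quot f (2 * j) (2 * x + t)" by (simp add: Q_def)
    show ?thesis
      unfolding c1 c2 c3[OF hj(1)] c3[OF hj(3)] c4 c5 b_quot_eq[OF x hj(1,2) that] b_quot_eq[OF x hj(3,4) that]
      by (simp add: algebra_simps)
  qed
  let ?R = "\<lambda>h. 2 * (1 + ennreal B) * quot_err (2 * h) (2 * x)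
        + C * shift_err (2 * h) (2 * x)"
  have Q_le: "tail Q (2 * x) \<le> quot_err (2 * h) (2 * x) + quot_err (2 * j) (2 * x)"
    unfolding Q_def by (rule tail_quot_diff_le)
  have "tail E 0 \<le> ennreal (1 / (1 - q)) * (?R h + ?R j)"
  proof (rule tail_le_absorb[OF _ _ q])
    have "tail E 0 \<le> tail (\<lambda>t. 2 * Q (2 * x + t) + 2 * corr (b x) Q (2 * x + t)) 0 + tail (\<lambda>t. corr E f (2 * x + t)) 0
        + tail (\<lambda>t. P h (2 * x + t) - P j (2 * x + t)) 0"
    proof (rule tail_triangle3)
      fix t :: real assume "0 < t"
      show "norm (E t) \<le> norm (2 * Q (2 * x + t) + 2 * corr (b x) Q (2 * x + t)) + norm (corr E f (2 * x + t))
          + norm (P h (2 * x + t) - P j (2 * x + t))"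
        unfolding E_eq[OF \<open>0 < t\<close>] norm_minus_cancel by (intro norm_triangle_le add_mono norm_triangle_ineq) auto
    qed measurable
    also have "\<dots> \<le> (2 * tail Q (2 * x) + 2 * (ennreal B * tail Q (2 * x))) + ennreal q * tail E 0
        + (C * shift_err (2 * h) (2 * x) + C * shift_err (2 * j) (2 * x))"
    proof (intro add_mono)
      have "tail (\<lambda>t. 2 * Q (2 * x + t) + 2 * corr (b x) Q (2 * x + t)) 0
          \<le> tail (\<lambda>t. 2 * Q (2 * x + t)) 0 + tail (\<lambda>t. 2 * corr (b x) Q (2 * x + t)) 0"
        by (rule tail_triangle[OF _ _ norm_triangle_ineq]) measurable
      also have "\<dots> = 2 * tail Q (2 * x) + 2 * tail (corr (b x) Q) (2 * x)"
        by (simp add: tail_cmult tail_shift)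
      also have "\<dots> \<le> 2 * tail Q (2 * x) + 2 * (ennreal B * tail Q (2 * x))"
        using x by (intro add_left_mono mult_left_mono tail_corr_b_le) auto
      finally show "tail (\<lambda>t. 2 * Q (2 * x + t) + 2 * corr (b x) Q (2 * x + t)) 0
          \<le> 2 * tail Q (2 * x) + 2 * (ennreal B * tail Q (2 * x))" .
      have "tail (\<lambda>t. corr E f (2 * x + t)) 0 = tail (corr E f) (2 * x)" by (simp add: tail_shift)
      also have "\<dots> \<le> tail E 0 * tail f (2 * x)" by (rule tail_corr_le) (auto simp: E_def b_quot_zero)
      also have "\<dots> \<le> tail E 0 * ennreal q" using x by (intro mult_left_mono tail_f_le_q) auto
      finally show "tail (\<lambda>t. corr E f (2 * x + t)) 0 \<le> ennreal q * tail E 0" by (simp add: mult.commute)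
      have "tail (\<lambda>t. P h (2 * x + t) - P j (2 * x + t)) 0 \<le> tail (\<lambda>t. P h (2 * x + t)) 0 + tail (\<lambda>t. P j (2 * x + t)) 0"
        by (rule tail_triangle[OF _ _ norm_triangle_ineq4]) measurable
      also have "\<dots> = tail (P h) (2 * x) + tail (P j) (2 * x)" by (simp add: tail_shift)
      also have "\<dots> \<le> C * shift_err (2 * h) (2 * x) + C * shift_err (2 * j) (2 * x)"
        by (intro add_mono P_le hj)
      finally show "tail (\<lambda>t. P h (2 * x + t) - P j (2 * x + t)) 0
          \<le> C * shift_err (2 * h) (2 * x) + C * shift_err (2 * j) (2 * x)" .
    qed
    also have "2 * tail Q (2 * x) + 2 * (ennreal B * tail Q (2 * x)) = 2 * (1 + ennreal B) * tail Q (2 * x)"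
      by (simp add: algebra_simps)
    also have "2 * (1 + ennreal B) * tail Q (2 * x) + ennreal q * tail E 0
        + (C * shift_err (2 * h) (2 * x) + C * shift_err (2 * j) (2 * x))
      \<le> 2 * (1 + ennreal B) * (quot_err (2 * h) (2 * x) + quot_err (2 * j) (2 * x))
        + ennreal q * tail E 0
        + (C * shift_err (2 * h) (2 * x) + C * shift_err (2 * j) (2 * x))"
      by (intro add_right_mono mult_left_mono Q_le) auto
    also have "\<dots> = ?R h + ?R j + ennreal q * tail E 0" by (simp add: distrib_left ac_simps)
    finally show "tail E 0 \<le> ?R h + ?R j + ennreal q * tail E 0" .
    show "tail E 0 < \<infinity>" by (rule tail_finite[OF E_int])
  qed
  also have "\<dots> = rate_b x h + rate_b x j" by (simp add: rate_b_def distrib_left)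
  finally show ?thesis unfolding E_def .
qed

section \<open>The derivative in the first variable\<close>

text \<open>
  This is \<open>A(x, y)\<close> for \<open>y > x\<close>. The formula makes sense for all \<open>y\<close>, so that \<open>a (x + h) y\<close> may be used
  without regard to the order of \<open>x + h\<close> and \<open>y\<close>.
\<close>

definition a :: "real \<Rightarrow> real \<Rightarrow> complex" where
  "a x y = - f (x + y) - corr (b x) f (x + y)"

abbreviation a_quot :: "real \<Rightarrow> real \<Rightarrow> real \<Rightarrow> complex" where
  "a_quot x h y \<equiv> quot (\<lambda>s. a s y) h x"

text \<open>
  The difference quotient of \<open>s \<mapsto> corr (b s) f (s + y)\<close> at \<open>x\<close>, as \<open>corr_quot_eq\<close> shows.
\<close>

definition corr_quot :: "real \<Rightarrow> real \<Rightarrow> real \<Rightarrow> complex" where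
  "corr_quot x h y = corr (b_quot x h) f (x + y + h) + corr (b x) (quot f h) (x + y)"

lemma corr_quot_measurable [measurable]: "corr_quot x h \<in> borel_measurable borel"
  unfolding corr_quot_def[abs_def] by measurable

lemma corr_quot_eq:
  assumes "x0 \<le> x" "x0 \<le> x + h" "h \<noteq> 0"
  shows "(corr (b (x + h)) f (x + h + y) - corr (b x) f (x + y)) / of_real h = corr_quot x h y"
  using corr_step[OF assms, of "x + y" h] assms(3)
  by (simp add: corr_quot_def quot_def[abs_def] corr_divide_right ac_simps)

lemma quot_a:
  assumes "x0 \<le> x" "x0 \<le> x + h" "h \<noteq> 0"
  shows "a_quot x h y = - quot f h (x + y) - corr_quot x h y"
  unfolding corr_quot_eq[OF assms, of y, symmetric]
  by (simp add: quot_def a_def diff_divide_distrib ac_simps)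

lemma norm_corr_quot_le:
  assumes "x0 \<le> x" "x0 \<le> x + h" "h \<noteq> 0" "x0 \<le> y"
  shows "enorm (corr_quot x h y) \<le> ennreal M * C + ennreal Mb * tail k (2 * x0)"
proof -
  have "enorm (corr_quot x h y) \<le> enorm (corr (b_quot x h) f (x + y + h)) + enorm (corr (b x) (quot f h) (x + y))"
    unfolding corr_quot_def by (simp flip: ennreal_plus add: ennreal_leI norm_triangle_ineq)
  also have "\<dots> \<le> ennreal M * tail (b_quot x h) 0 + ennreal Mb * tail (quot f h) (x + y)"
    using assms(1) by (intro add_mono norm_corr_le_bounded_right norm_corr_le_bounded_left f_bound' b_bound) (auto simp: b_zero b_quot_zero)
  also have "\<dots> \<le> ennreal M * C + ennreal Mb * tail k (2 * x0)"
    using assms by (intro add_mono mult_left_mono tail_b_quot_le_C order.trans[OF tail_quot_le] tail_antimono) auto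
  finally show ?thesis .
qed

text \<open>
  Rates of convergence of \<open>corr_quot x h\<close> as \<open>h \<rightarrow> 0\<close>: in the supremum norm here, and in \<open>L\<^sup>1\<close> in
  \<open>rate_1\<close>. The first one makes the derivative exist at each single \<open>y\<close>, the second one bounds its norm.
\<close>

definition rate_u :: "real \<Rightarrow> real \<Rightarrow> ennreal" where
  "rate_u x h = ennreal M * rate_b x h + C * modulus h + ennreal Mb * quot_err h (2 * x)"

definition rate_1 :: "real \<Rightarrow> real \<Rightarrow> ennreal" where
  "rate_1 x h = ennreal q * rate_b x h + C * shift_err h (2 * x)
     + ennreal B * quot_err h (2 * x)"

lemma shifts_subset: "x0 \<le> x \<Longrightarrow> shifts x \<subseteq> {h. 2 * x0 \<le> 2 * x + h}"
  by (auto simp: shifts_def)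

lemma tail_quot_diff_tendsto_shifts:
  "x0 \<le> x \<Longrightarrow> ((\<lambda>h. quot_err h (2 * x)) \<longlongrightarrow> 0) (at 0 within shifts x)"
  by (rule tendsto_within_subset[OF tail_quot_diff_tendsto shifts_subset]) auto

lemma rate_u_tendsto: "x0 \<le> x \<Longrightarrow> (rate_u x \<longlongrightarrow> 0) (at 0 within shifts x)"
proof -
  assume x: "x0 \<le> x"
  have "((\<lambda>h. ennreal M * rate_b x h + C * modulus h + ennreal Mb * quot_err h (2 * x)) \<longlongrightarrow> 0 + 0 + 0)
      (at 0 within shifts x)"
    by (intro tendsto_add tendsto_ennreal_cmult_0 rate_b_tendsto x tail_quot_diff_tendsto_shifts modulus_tendsto C_finite) auto
  then show ?thesis by (simp add: rate_u_def[abs_def])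
qed

lemma rate_1_tendsto: "x0 \<le> x \<Longrightarrow> (rate_1 x \<longlongrightarrow> 0) (at 0 within shifts x)"
proof -
  assume x: "x0 \<le> x"
  have "((\<lambda>h. ennreal q * rate_b x h + C * shift_err h (2 * x)
     + ennreal B * quot_err h (2 * x)) \<longlongrightarrow> 0 + 0 + 0) (at 0 within shifts x)"
    by (intro tendsto_add tendsto_ennreal_cmult_0 rate_b_tendsto x tail_quot_diff_tendsto_shifts C_finite
        tendsto_within_subset[OF tail_diff_tendsto shifts_subset]) auto
  then show ?thesis by (simp add: rate_1_def[abs_def])
qed

lemma corr_quot_diff_eq:
  assumes x: "x0 \<le> x" and h: "x0 \<le> x + h" and j: "x0 \<le> x + j"
  shows "corr_quot x h y - corr_quot x j y = corr (\<lambda>t. b_quot x h t - b_quot x j t) f (x + y)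
     + (corr (b_quot x h) (\<lambda>z. f (z + h) - f z) (x + y) - corr (b_quot x j) (\<lambda>z. f (z + j) - f z) (x + y))
     + corr (b x) (\<lambda>z. quot f h z - quot f j z) (x + y)"
proof -
  have 1: "corr (\<lambda>t. b_quot x h t - b_quot x j t) f (x + y) = corr (b_quot x h) f (x + y) - corr (b_quot x j) f (x + y)"
    by (rule corr_diff_left) (use x h j integrable_b_quot_f in auto)
  have 2: "corr (b x) (\<lambda>z. quot f h z - quot f j z) (x + y) = corr (b x) (quot f h) (x + y) - corr (b x) (quot f j) (x + y)"
    by (rule corr_diff_right) (use x integrable_b_quot in auto)
  have 3: "corr (b_quot x i) (\<lambda>z. f (z + i) - f z) (x + y) = corr (b_quot x i) f (x + y + i) - corr (b_quot x i) f (x + y)" if "x0 \<le> x + i" for i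
    by (subst corr_diff_right) (use x that integrable_b_quot_f integrable_b_quot_f_shift corr_shift in auto)
  show ?thesis unfolding corr_quot_def 1 2 3[OF h] 3[OF j] by simp
qed

lemma corr_quot_Cauchy:
  assumes x: "x0 \<le> x" "x < y" and h: "h \<in> shifts x - {0}" and j: "j \<in> shifts x - {0}"
  shows "enorm (corr_quot x h y - corr_quot x j y) \<le> rate_u x h + rate_u x j"
proof -
  have hj: "x0 \<le> x + h" "h \<noteq> 0" "x0 \<le> x + j" "j \<noteq> 0" using h j by (auto simp: shifts_def)
  let ?E = "corr (\<lambda>t. b_quot x h t - b_quot x j t) f (x + y)"
  let ?P = "\<lambda>h. corr (b_quot x h) (\<lambda>z. f (z + h) - f z) (x + y)"
  let ?Q = "corr (b x) (\<lambda>z. quot f h z - quot f j z) (x + y)"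
  have P: "enorm (?P i) \<le> C * modulus i" if "x0 \<le> x + i" "i \<noteq> 0" for i
  proof -
    have "enorm (?P i) \<le> modulus i * tail (b_quot x i) 0"
      using x that by (intro norm_corr_le_bounded_right norm_diff_le_modulus) (auto simp: b_quot_zero)
    also have "\<dots> \<le> modulus i * C" using x that by (intro mult_left_mono tail_b_quot_le_C) auto
    finally show ?thesis by (simp add: mult.commute)
  qed
  have E: "ennreal (norm ?E) \<le> ennreal M * (rate_b x h + rate_b x j)"
  proof -
    have "ennreal (norm ?E) \<le> ennreal M * tail (\<lambda>t. b_quot x h t - b_quot x j t) 0"
      by (intro norm_corr_le_bounded_right f_bound') (auto simp: b_quot_zero)
    also have "\<dots> \<le> ennreal M * (rate_b x h + rate_b x j)"
      by (intro mult_left_mono tail_b_quot_Cauchy x h j) auto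
    finally show ?thesis .
  qed
  have Q: "ennreal (norm ?Q) \<le> ennreal Mb * (quot_err h (2 * x) + quot_err j (2 * x))"
  proof -
    have "ennreal (norm ?Q) \<le> ennreal Mb * tail (\<lambda>z. quot f h z - quot f j z) (x + y)"
      using x(1) by (intro norm_corr_le_bounded_left b_bound) (auto simp: b_zero)
    also have "\<dots> \<le> ennreal Mb * tail (\<lambda>z. quot f h z - quot f j z) (2 * x)"
      using x by (intro mult_left_mono tail_antimono) auto
    also have "\<dots> \<le> ennreal Mb * (quot_err h (2 * x) + quot_err j (2 * x))"
      by (intro mult_left_mono tail_quot_diff_le) auto
    finally show ?thesis .
  qed
  have "norm (corr_quot x h y - corr_quot x j y) \<le> norm ?E + (norm (?P h) + norm (?P j)) + norm ?Q"
    unfolding corr_quot_diff_eq[OF x(1) hj(1,3)] by (intro norm_triangle_le add_mono norm_triangle_ineq norm_triangle_ineq4) auto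
  then have "enorm (corr_quot x h y - corr_quot x j y) \<le> ennreal (norm ?E) + (enorm (?P h) + enorm (?P j)) + ennreal (norm ?Q)"
    by (simp flip: ennreal_plus add: ennreal_leI)
  also have "\<dots> \<le> ennreal M * (rate_b x h + rate_b x j) + (C * modulus h + C * modulus j)
      + ennreal Mb * (quot_err h (2 * x) + quot_err j (2 * x))"
    by (intro add_mono E P Q hj)
  also have "\<dots> = rate_u x h + rate_u x j" by (simp add: rate_u_def distrib_left ac_simps)
  finally show ?thesis .
qed

lemma tail_corr_quot_Cauchy:
  assumes x: "x0 \<le> x" and h: "h \<in> shifts x - {0}" and j: "j \<in> shifts x - {0}"
  shows "tail (\<lambda>y. corr_quot x h y - corr_quot x j y) x \<le> rate_1 x h + rate_1 x j"
proof -
  have hj: "x0 \<le> x + h" "h \<noteq> 0" "x0 \<le> x + j" "j \<noteq> 0" using h j by (auto simp: shifts_def)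
  let ?E = "corr (\<lambda>t. b_quot x h t - b_quot x j t) f"
  let ?P = "\<lambda>h. corr (b_quot x h) (\<lambda>z. f (z + h) - f z)"
  let ?Q = "corr (b x) (\<lambda>z. quot f h z - quot f j z)"
  have "tail (\<lambda>y. corr_quot x h y - corr_quot x j y) x
      \<le> tail (\<lambda>y. ?E (x + y)) x + tail (\<lambda>y. ?P h (x + y) - ?P j (x + y)) x + tail (\<lambda>y. ?Q (x + y)) x"
  proof (rule tail_triangle3)
    fix y
    show "norm (corr_quot x h y - corr_quot x j y) \<le> norm (?E (x + y)) + norm (?P h (x + y) - ?P j (x + y)) + norm (?Q (x + y))"
      unfolding corr_quot_diff_eq[OF x(1) hj(1,3)] by (intro norm_triangle_le add_mono norm_triangle_ineq) auto
  qed measurable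
  also have "\<dots> \<le> ennreal q * (rate_b x h + rate_b x j)
      + (C * shift_err h (2 * x) + C * shift_err j (2 * x))
      + ennreal B * (quot_err h (2 * x) + quot_err j (2 * x))"
  proof (intro add_mono)
    have xx: "x + x = 2 * x" by simp
    have "tail (\<lambda>y. ?E (x + y)) x = tail ?E (2 * x)" by (subst tail_shift) (auto simp: xx)
    also have "\<dots> \<le> tail (\<lambda>t. b_quot x h t - b_quot x j t) 0 * tail f (2 * x)" by (rule tail_corr_le) (auto simp: b_quot_zero)
    also have "\<dots> \<le> (rate_b x h + rate_b x j) * ennreal q"
      by (rule mult_mono[OF tail_b_quot_Cauchy[OF x h j] tail_f_le_q]) (use x in auto)
    finally show "tail (\<lambda>y. ?E (x + y)) x \<le> ennreal q * (rate_b x h + rate_b x j)" by (simp add: mult.commute)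
    have "tail (\<lambda>y. ?P h (x + y) - ?P j (x + y)) x \<le> tail (\<lambda>y. ?P h (x + y)) x + tail (\<lambda>y. ?P j (x + y)) x"
      by (rule tail_triangle[OF _ _ norm_triangle_ineq4]) measurable
    also have "\<dots> = tail (?P h) (2 * x) + tail (?P j) (2 * x)"
      by (subst (1 2) tail_shift) (auto simp: xx)
    also have "\<dots> \<le> C * shift_err h (2 * x) + C * shift_err j (2 * x)"
      by (intro add_mono tail_corr_b_quot_le x hj) auto
    finally show "tail (\<lambda>y. ?P h (x + y) - ?P j (x + y)) x
        \<le> C * shift_err h (2 * x) + C * shift_err j (2 * x)" .
    have "tail (\<lambda>y. ?Q (x + y)) x = tail ?Q (2 * x)" by (subst tail_shift) (auto simp: xx)
    also have "\<dots> \<le> ennreal B * tail (\<lambda>z. quot f h z - quot f j z) (2 * x)"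
      by (rule tail_corr_b_le[OF x]) measurable
    also have "\<dots> \<le> ennreal B * (quot_err h (2 * x) + quot_err j (2 * x))"
      by (intro mult_left_mono tail_quot_diff_le) auto
    finally show "tail (\<lambda>y. ?Q (x + y)) x
        \<le> ennreal B * (quot_err h (2 * x) + quot_err j (2 * x))" .
  qed
  also have "\<dots> = rate_1 x h + rate_1 x j" by (simp add: rate_1_def distrib_left ac_simps)
  finally show ?thesis .
qed

lemma le_add_inverse_Suc: "x0 \<le> x \<Longrightarrow> x0 \<le> x + 1 / real (Suc n)"
  by (rule add_increasing2) auto

text \<open>
  The limit is taken along a sequence in order to be measurable in \<open>y\<close>; \<open>corr_quot_tendsto\<close> identifies it
  with the limit as \<open>h \<rightarrow> 0\<close>.
\<close>

definition corr_deriv :: "real \<Rightarrow> real \<Rightarrow> complex" where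
  "corr_deriv x y = lim (\<lambda>n. corr_quot x (1 / real (Suc n)) y)"

lemma corr_deriv_measurable [measurable]: "corr_deriv x \<in> borel_measurable borel"
  unfolding corr_deriv_def[abs_def] by measurable

lemma filterlim_inverse_shifts: "x0 \<le> x \<Longrightarrow> filterlim (\<lambda>n. 1 / real (Suc n)) (at 0 within shifts x) sequentially"
  using LIMSEQ_inverse_real_of_nat le_add_inverse_Suc[of x]
  by (auto simp: filterlim_at shifts_def inverse_eq_divide simp del: of_nat_Suc)

lemma corr_quot_tendsto:
  assumes x: "x0 \<le> x" "x < y"
  shows "((\<lambda>h. corr_quot x h y) \<longlongrightarrow> corr_deriv x y) (at 0 within shifts x)"
proof -
  obtain L where L: "((\<lambda>h. corr_quot x h y) \<longlongrightarrow> L) (at 0 within shifts x)"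
    using convergent_of_Cauchy_bound[OF rate_u_tendsto[OF x(1)] corr_quot_Cauchy[OF x]] by blast
  from filterlim_compose[OF this filterlim_inverse_shifts[OF x(1)]]
  have "L = corr_deriv x y" unfolding corr_deriv_def by (simp add: limI)
  with L show ?thesis by simp
qed

text \<open>
  The second increment tends to \<open>0\<close> in the \<open>L\<^sup>1\<close> Cauchy estimate, by Fatou's lemma.
\<close>

lemma tail_corr_quot_diff_deriv:
  assumes x: "x0 \<le> x" and h: "h \<in> shifts x - {0}"
  shows "tail (\<lambda>y. corr_quot x h y - corr_deriv x y) x \<le> rate_1 x h"
proof -
  let ?j = "\<lambda>n. 1 / real (Suc n)"
  have j: "?j n \<in> shifts x - {0}" for n
    using le_add_inverse_Suc[OF x, of n] by (auto simp: shifts_def simp del: of_nat_Suc)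
  have "tail (\<lambda>y. corr_quot x h y - corr_deriv x y) x
      = (\<integral>\<^sup>+ y. liminf (\<lambda>n. enorm (corr_quot x h y - corr_quot x (?j n) y) * indicator {x<..} y) \<partial>lborel)"
    unfolding tail_def
  proof (intro nn_integral_cong)
    fix y
    show "enorm (corr_quot x h y - corr_deriv x y) * indicator {x<..} y
        = liminf (\<lambda>n. enorm (corr_quot x h y - corr_quot x (?j n) y) * indicator {x<..} y)"
    proof (cases "x < y")
      case True
      have "(\<lambda>n. corr_quot x (?j n) y) \<longlonglongrightarrow> corr_deriv x y"
        by (rule filterlim_compose[OF corr_quot_tendsto[OF x True] filterlim_inverse_shifts[OF x]])
      then have "(\<lambda>n. enorm (corr_quot x h y - corr_quot x (?j n) y)) \<longlonglongrightarrow> enorm (corr_quot x h y - corr_deriv x y)"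
        by (intro tendsto_intros)
      then have "liminf (\<lambda>n. enorm (corr_quot x h y - corr_quot x (?j n) y)) = enorm (corr_quot x h y - corr_deriv x y)"
        by (rule lim_imp_Liminf[OF sequentially_bot])
      then show ?thesis using True by (simp del: of_nat_Suc)
    qed (simp add: Liminf_const)
  qed
  also have "\<dots> \<le> liminf (\<lambda>n. \<integral>\<^sup>+ y. enorm (corr_quot x h y - corr_quot x (?j n) y) * indicator {x<..} y \<partial>lborel)"
    by (rule nn_integral_liminf) measurable
  also have "\<dots> \<le> liminf (\<lambda>n. rate_1 x h + rate_1 x (?j n))"
    using tail_corr_quot_Cauchy[OF x h j] unfolding tail_def by (intro Liminf_mono always_eventually allI)
  also have "\<dots> = rate_1 x h + 0"
    by (intro lim_imp_Liminf tendsto_intros filterlim_compose[OF rate_1_tendsto[OF x] filterlim_inverse_shifts[OF x]]) auto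
  finally show ?thesis by simp
qed

definition ax :: "real \<Rightarrow> real \<Rightarrow> complex" where
  "ax x y = - k (x + y) - corr_deriv x y"

lemma a_has_vector_derivative:
  assumes x: "x0 \<le> x" "x < y" and f': "(f has_vector_derivative f') (at (x + y))"
  shows "((\<lambda>s. a s y) has_vector_derivative (- f' - corr_deriv x y)) (at x within {x0..})"
proof -
  have "((\<lambda>h. quot f h (x + y)) \<longlongrightarrow> f') (at 0)" using f' by (simp add: has_vector_derivative_iff_quot)
  then have "((\<lambda>h. quot f h (x + y)) \<longlongrightarrow> f') (at 0 within shifts x)" by (rule tendsto_within_subset) auto
  then have "((\<lambda>h. - quot f h (x + y) - corr_quot x h y) \<longlongrightarrow> - f' - corr_deriv x y) (at 0 within shifts x)"
    by (intro tendsto_intros corr_quot_tendsto x)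
  moreover have "\<forall>\<^sub>F h in at 0 within shifts x. - quot f h (x + y) - corr_quot x h y = a_quot x h y"
    using x(1) by (auto simp: eventually_at_filter shifts_def quot_a)
  ultimately have "((\<lambda>h. a_quot x h y) \<longlongrightarrow> - f' - corr_deriv x y) (at 0 within shifts x)"
    by (rule Lim_transform_eventually)
  then show ?thesis by (simp add: has_vector_derivative_iff_quot shifts_def)
qed

lemma AE_a_has_vector_derivative:
  assumes x: "x0 \<le> x"
  shows "AE y in lborel. x < y \<longrightarrow> ((\<lambda>s. a s y) has_vector_derivative ax x y) (at x within {x0..})"
  using AE_lborel_shift[OF deriv, of x]
proof eventually_elim
  case (elim y)
  show ?case using elim x a_has_vector_derivative[OF x] by (auto simp: ax_def)
qed

text \<open>
  Convergence in norm, and not only for almost every \<open>y\<close>, is what allows estimates of \<open>A\<^sub>x\<close> to be obtained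
  from estimates of difference quotients, and conversely.
\<close>

lemma tail_quot_a_ax_tendsto:
  assumes x: "x0 \<le> x"
  shows "((\<lambda>h. tail (\<lambda>y. a_quot x h y - ax x y) x) \<longlongrightarrow> 0) (at 0 within shifts x)"
proof (rule tendsto_sandwich[OF _ _ tendsto_const])
  have "tail (\<lambda>y. a_quot x h y - ax x y) x \<le> quot_err h (2 * x) + rate_1 x h"
    if h: "h \<in> shifts x - {0}" for h
  proof -
    have h': "x0 \<le> x + h" "h \<noteq> 0" using h by (auto simp: shifts_def)
    have "tail (\<lambda>y. a_quot x h y - ax x y) x
        \<le> tail (\<lambda>y. (\<lambda>z. quot f h z - k z) (x + y)) x + tail (\<lambda>y. corr_quot x h y - corr_deriv x y) x"
    proof (rule tail_triangle)
      fix y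
      have "a_quot x h y - ax x y = - ((quot f h (x + y) - k (x + y)) + (corr_quot x h y - corr_deriv x y))"
        unfolding quot_a[OF x h'] ax_def by simp
      then show "norm (a_quot x h y - ax x y) \<le> norm (quot f h (x + y) - k (x + y)) + norm (corr_quot x h y - corr_deriv x y)"
        by (simp only: norm_minus_cancel norm_triangle_ineq)
    qed measurable
    also have "tail (\<lambda>y. (\<lambda>z. quot f h z - k z) (x + y)) x = quot_err h (x + x)"
      by (rule tail_shift) measurable
    also have "\<dots> + tail (\<lambda>y. corr_quot x h y - corr_deriv x y) x \<le> quot_err h (2 * x) + rate_1 x h"
      using tail_corr_quot_diff_deriv[OF x h] by (simp add: add_left_mono)
    finally show ?thesis .
  qed
  then show "\<forall>\<^sub>F h in at 0 within shifts x. tail (\<lambda>y. a_quot x h y - ax x y) x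
      \<le> quot_err h (2 * x) + rate_1 x h"
    by (auto simp: eventually_at_filter)
  have "((\<lambda>h. quot_err h (2 * x) + rate_1 x h) \<longlongrightarrow> 0 + 0) (at 0 within shifts x)"
    by (intro tendsto_add tail_quot_diff_tendsto_shifts rate_1_tendsto x)
  then show "((\<lambda>h. quot_err h (2 * x) + rate_1 x h) \<longlongrightarrow> 0) (at 0 within shifts x)" by simp
qed simp

text \<open>
  The three summands bound the contributions of the three terms of the difference quotient of \<open>A\<close>: the
  quotient of \<open>f\<close>, the integral of \<open>b_quot\<close>, and the integral of \<open>b\<close>.
\<close>

definition Cx :: real where "Cx = 1 + q / (1 - q) * (2 * (1 + B)) + B"

lemma tail_quot_a_le:
  assumes x: "x0 \<le> x" and h: "0 < h"
  shows "tail (\<lambda>y. a_quot x h y) x \<le> ennreal Cx * tail k (2 * x)"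
proof -
  have xh: "x0 \<le> x + h" "h \<noteq> 0" using x h by auto
  have Q: "tail (quot f h) (2 * x) \<le> tail k (2 * x)"
    using tail_quot_le[of "2 * x" h] x h by (simp add: min_def)
  have "tail (\<lambda>y. a_quot x h y) x
      \<le> tail (\<lambda>y. quot f h (x + y)) x + tail (\<lambda>y. corr (b_quot x h) f ((x + h) + y)) x + tail (\<lambda>y. corr (b x) (quot f h) (x + y)) x"
  proof (rule tail_triangle3)
    fix y
    have "a_quot x h y = - (quot f h (x + y) + corr (b_quot x h) f ((x + h) + y) + corr (b x) (quot f h) (x + y))"
      unfolding quot_a[OF x xh] corr_quot_def by (simp add: ac_simps)
    then show "norm (a_quot x h y) \<le> norm (quot f h (x + y)) + norm (corr (b_quot x h) f ((x + h) + y))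
        + norm (corr (b x) (quot f h) (x + y))"
      by (simp only: norm_minus_cancel) (intro norm_triangle_le add_mono norm_triangle_ineq order_refl)
  qed measurable
  also have "\<dots> = tail (quot f h) (x + x) + tail (corr (b_quot x h) f) (x + h + x) + tail (corr (b x) (quot f h)) (x + x)"
    by (simp add: tail_shift)
  also have "\<dots> \<le> tail k (2 * x) + ennreal (q / (1 - q) * (2 * (1 + B))) * tail k (2 * x) + ennreal B * tail k (2 * x)"
  proof (intro add_mono)
    show "tail (quot f h) (x + x) \<le> tail k (2 * x)" using Q by simp
    have "tail (corr (b x) (quot f h)) (x + x) \<le> ennreal B * tail (quot f h) (x + x)"
      by (rule tail_corr_b_le[OF x]) measurable
    also have "\<dots> \<le> ennreal B * tail k (2 * x)" using Q by (intro mult_left_mono) auto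
    finally show "tail (corr (b x) (quot f h)) (x + x) \<le> ennreal B * tail k (2 * x)" .
    have "tail (corr (b_quot x h) f) (x + h + x) \<le> tail (b_quot x h) 0 * tail f (x + h + x)"
      by (rule tail_corr_le) (auto simp: b_quot_zero)
    also have "\<dots> \<le> ennreal (1 / (1 - q)) * (2 * (1 + ennreal B) * tail k (2 * x)) * ennreal q"
    proof (intro mult_mono)
      have "tail (b_quot x h) 0 \<le> ennreal (1 / (1 - q)) * (2 * (1 + tail (b x) 0) * tail k (min (2 * x) (2 * x + 2 * h)))"
        by (rule tail_b_quot_le[OF x xh])
      also have "\<dots> \<le> ennreal (1 / (1 - q)) * (2 * (1 + ennreal B) * tail k (2 * x))"
        using h by (intro mult_mono add_mono tail_b_le_B x) (auto simp: min_def)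
      finally show "tail (b_quot x h) 0 \<le> ennreal (1 / (1 - q)) * (2 * (1 + ennreal B) * tail k (2 * x))" .
      show "tail f (x + h + x) \<le> ennreal q" using x h by (intro tail_f_le_q) auto
    qed auto
    also have "\<dots> = ennreal (q / (1 - q) * (2 * (1 + B))) * tail k (2 * x)"
    proof -
      have "ennreal (q / (1 - q) * (2 * (1 + B))) = ennreal q * ennreal (1 / (1 - q)) * (2 * (1 + ennreal B))"
        using q B_nonneg by (simp add: ennreal_mult[symmetric] flip: ennreal_1 ennreal_plus ennreal_numeral)
      then show ?thesis by (simp only: mult.assoc mult.commute mult.left_commute)
    qed
    finally show "tail (corr (b_quot x h) f) (x + h + x) \<le> ennreal (q / (1 - q) * (2 * (1 + B))) * tail k (2 * x)" .
  qed
  also have "\<dots> = ennreal Cx * tail k (2 * x)"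
  proof -
    have "0 \<le> q / (1 - q) * (2 * (1 + B))" using q B_nonneg by (intro mult_nonneg_nonneg divide_nonneg_nonneg) auto
    then have "ennreal Cx = 1 + ennreal (q / (1 - q) * (2 * (1 + B))) + ennreal B"
      unfolding Cx_def using B_nonneg by (simp add: ennreal_plus)
    then show ?thesis by (simp only: distrib_right mult_1_left)
  qed
  finally show ?thesis .
qed

lemma quot_a_measurable [measurable]: "(\<lambda>y. a_quot x h y) \<in> borel_measurable borel"
  unfolding quot_def a_def by measurable

lemma ax_measurable [measurable]: "ax x \<in> borel_measurable borel"
  unfolding ax_def[abs_def] by measurable

lemma tail_ax_le:
  assumes x: "x0 \<le> x"
  shows "tail (ax x) x \<le> ennreal Cx * tail k (2 * x)"
proof -
  let ?h = "\<lambda>n. 1 / real (Suc n)"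
  let ?e = "\<lambda>n. tail (\<lambda>y. a_quot x (?h n) y - ax x y) x"
  have "tail (ax x) x \<le> ennreal Cx * tail k (2 * x) + ?e n" for n
  proof -
    have "tail (ax x) x \<le> tail (\<lambda>y. a_quot x (?h n) y) x + ?e n"
    proof (rule tail_triangle)
      fix y
      show "norm (ax x y) \<le> norm (a_quot x (?h n) y) + norm (a_quot x (?h n) y - ax x y)"
        using norm_triangle_ineq4[of "a_quot x (?h n) y" "a_quot x (?h n) y - ax x y"] by simp
    qed measurable
    also have "tail (\<lambda>y. a_quot x (?h n) y) x \<le> ennreal Cx * tail k (2 * x)"
      by (rule tail_quot_a_le[OF x]) simp
    finally show ?thesis by (simp add: add_right_mono)
  qed
  moreover have "(\<lambda>n. ennreal Cx * tail k (2 * x) + ?e n) \<longlonglongrightarrow> ennreal Cx * tail k (2 * x) + 0"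
    by (intro tendsto_intros filterlim_compose[OF tail_quot_a_ax_tendsto[OF x] filterlim_inverse_shifts[OF x]])
  ultimately show ?thesis by (auto intro: LIMSEQ_le_const)
qed

text \<open>
  A Lipschitz constant of \<open>s \<mapsto> corr (b s) f (s + y)\<close>, uniform in \<open>y \<ge> x\<^sub>0\<close>.
\<close>

definition Lm :: real where "Lm = enn2real (ennreal M * C + ennreal Mb * tail k (2 * x0))"

lemma norm_corr_quot_le_Lm:
  assumes "x0 \<le> x" "x0 \<le> x + h" "h \<noteq> 0" "x0 \<le> y"
  shows "norm (corr_quot x h y) \<le> Lm"
proof -
  have "ennreal M * C + ennreal Mb * tail k (2 * x0) < \<infinity>"
    using C_finite tail_finite[OF k_int, of "2 * x0"] by (simp add: ennreal_mult_less_top)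
  then have "enorm (corr_quot x h y) \<le> ennreal Lm"
    using norm_corr_quot_le[OF assms] by (simp add: Lm_def)
  then show ?thesis by (subst (asm) ennreal_le_iff) (simp_all add: Lm_def)
qed

section \<open>Local absolute continuity and the derivative in the second variable\<close>

lemma loc_abs_cont_a_first:
  assumes ac: "loc_abs_cont_on {2 * x0<..} f" and x: "x0 \<le> x"
  shows "loc_abs_cont_on {x<..<y} (\<lambda>s. a s y)"
  unfolding loc_abs_cont_on_def
proof (intro conjI allI impI)
  fix u v assume uv: "{u..v} \<subseteq> {x<..<y}"
  show "absolutely_continuous_on {u..v} (\<lambda>s. a s y)"
  proof (rule absolutely_continuous_on_dominated)
    have "{y + u..y + v} \<subseteq> {2 * x0<..}"
    proof
      fix z assume z: "z \<in> {y + u..y + v}"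
      then have "u \<in> {u..v}" by auto
      then have "u \<in> {x<..<y}" using uv by blast
      then show "z \<in> {2 * x0<..}" using z x by auto
    qed
    then show "absolutely_continuous_on {y + u..y + v} f" using ac by (simp add: loc_abs_cont_on_def)
    show "0 \<le> Lm" by (simp add: Lm_def)
    fix s s' assume s: "u \<le> s" "s \<le> s'" "s' \<le> v"
    show "norm (a s' y - a s y) \<le> norm (f (y + s') - f (y + s)) + Lm * (s' - s)"
    proof (cases "s = s'")
      case False
      define h where "h = s' - s"
      have "s \<in> {u..v}" using s by auto
      then have "s \<in> {x<..<y}" using uv by blast
      then have h: "x0 \<le> s" "x0 \<le> s + h" "h \<noteq> 0" "x0 \<le> y" "0 < h" "s + h = s'"
        using s False x by (auto simp: h_def)
      have "a s' y - a s y = of_real h * a_quot s h y" using h by (simp add: quot_def)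
      also have "\<dots> = - ((f (y + s') - f (y + s)) + of_real h * corr_quot s h y)"
        unfolding quot_a[OF h(1-3)] h(6)[symmetric] using h(3) by (simp add: quot_def field_simps)
      finally have "norm (a s' y - a s y) \<le> norm (f (y + s') - f (y + s)) + norm (of_real h * corr_quot s h y)"
        by (simp only: norm_minus_cancel norm_triangle_ineq)
      also have "norm (of_real h * corr_quot s h y) \<le> h * Lm"
        using norm_corr_quot_le_Lm[OF h(1-4)] h(5) by (simp add: norm_mult mult_left_mono)
      finally show ?thesis by (simp add: h_def mult.commute)
    qed simp
  qed
next
  have "AE s in lborel. 2 * x0 < y + s \<longrightarrow> (f has_vector_derivative k (y + s)) (at (y + s))"
    by (rule AE_lborel_shift[OF deriv])
  then have "AE s in lborel. s \<in> {x<..<y} \<longrightarrow> (\<lambda>s. a s y) differentiable at s"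
  proof eventually_elim
    case (elim s)
    show ?case
    proof
      assume s: "s \<in> {x<..<y}"
      then have "((\<lambda>s. a s y) has_vector_derivative (- k (s + y) - corr_deriv s y)) (at s within {x0..})"
        using x elim by (intro a_has_vector_derivative) (auto simp: add.commute)
      moreover have "at s within {x0..} = at s" using s x by (intro at_within_interior) auto
      ultimately show "(\<lambda>s. a s y) differentiable at s"
        by (auto simp: has_vector_derivative_def differentiable_def)
    qed
  qed
  then show "AE s in lebesgue. s \<in> {x<..<y} \<longrightarrow> (\<lambda>s. a s y) differentiable at s"
    by (simp add: AE_completion_iff)
qed

lemma integrable_b_k: "x0 \<le> x \<Longrightarrow> integrable lborel (\<lambda>t. b x t * k (u + t))"
proof (rule Bochner_Integration.integrable_bound[where f="\<lambda>t. Mb * norm (k (u + t))"])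
  assume x: "x0 \<le> x"
  show "(\<lambda>t. b x t * k (u + t)) \<in> borel_measurable lborel" by measurable
  show "integrable lborel (\<lambda>t. Mb * norm (k (u + t)))"
    using lborel_integrable_real_affine[OF k_int, of 1 u] by simp
  have "norm (b x t) \<le> Mb" for t
    using b_bound[OF x, of t] Mb_nonneg by simp
  then show "AE t in lborel. norm (b x t * k (u + t)) \<le> norm (Mb * norm (k (u + t)))"
    using Mb_nonneg by (auto simp: norm_mult abs_mult intro!: mult_right_mono)
qed

text \<open>
  Since \<open>b x\<close> is bounded, \<open>L\<^sup>1\<close> convergence of the difference quotients of \<open>f\<close> gives convergence of the
  integral at each single \<open>y\<close>.
\<close>

lemma a_has_vector_derivative_second:
  assumes x: "x0 \<le> x" "x < y" and f': "(f has_vector_derivative f') (at (x + y))"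
  shows "(a x has_vector_derivative (- f' - corr (b x) k (x + y))) (at y)"
proof -
  let ?S = "{h. 2 * x0 \<le> x + y + h}"
  have "((\<lambda>h. corr (b x) (quot f h) (x + y)) \<longlongrightarrow> corr (b x) k (x + y)) (at 0 within ?S)"
  proof -
    have lim: "((\<lambda>h. ennreal Mb * quot_err h (x + y)) \<longlongrightarrow> 0) (at 0 within ?S)"
      using x by (intro tendsto_ennreal_cmult_0 tail_quot_diff_tendsto) auto
    have *: "enorm (corr (b x) (quot f h) (x + y) - corr (b x) k (x + y))
        \<le> ennreal Mb * quot_err h (x + y)" for h
    proof -
      have eq: "corr (b x) (quot f h) (x + y) - corr (b x) k (x + y) = corr (b x) (\<lambda>z. quot f h z - k z) (x + y)"
        by (rule corr_diff_right[symmetric]) (use x integrable_b_quot integrable_b_k in auto)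
      show ?thesis unfolding eq
        by (rule norm_corr_le_bounded_left) (auto simp: b_zero intro: b_bound x(1))
    qed
    have "((\<lambda>h. enorm (corr (b x) (quot f h) (x + y) - corr (b x) k (x + y))) \<longlongrightarrow> 0) (at 0 within ?S)"
      by (rule tendsto_sandwich[OF _ _ tendsto_const lim]) (use * in auto)
    then have "((\<lambda>h. norm (corr (b x) (quot f h) (x + y) - corr (b x) k (x + y))) \<longlongrightarrow> 0) (at 0 within ?S)"
      by (rule tendsto_ennrealD[where x=0, unfolded ennreal_0]) auto
    then show ?thesis by (simp only: tendsto_norm_zero_iff LIM_zero_iff)
  qed
  moreover have "at 0 within ?S = at (0::real)"
  proof (rule at_within_interior)
    have "?S = {2 * x0 - (x + y)..}" by auto
    then show "0 \<in> interior ?S" using x by simp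
  qed
  ultimately have "((\<lambda>h. - quot f h (x + y) - corr (b x) (quot f h) (x + y)) \<longlongrightarrow> - f' - corr (b x) k (x + y)) (at 0)"
    using f' by (intro tendsto_intros) (auto simp: has_vector_derivative_iff_quot)
  moreover have "quot (a x) h y = - quot f h (x + y) - corr (b x) (quot f h) (x + y)" for h
  proof -
    have "corr (b x) (\<lambda>z. f (z + h) - f z) (x + y) = corr (b x) f (x + y + h) - corr (b x) f (x + y)"
      by (subst corr_diff_right) (use x integrable_b_f integrable_b_f_shift corr_shift in auto)
    then have "corr (b x) (quot f h) (x + y) = (corr (b x) f (x + y + h) - corr (b x) f (x + y)) / of_real h"
      by (simp add: quot_def[abs_def] corr_divide_right)
    then show ?thesis
      by (simp add: quot_def a_def diff_divide_distrib ac_simps)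
  qed
  ultimately show ?thesis by (simp add: has_vector_derivative_iff_quot)
qed

lemma loc_abs_cont_a_second:
  assumes ac: "loc_abs_cont_on {2 * x0<..} f" and x: "x0 \<le> x"
  shows "loc_abs_cont_on {x<..} (a x)"
  unfolding loc_abs_cont_on_def
proof (intro conjI allI impI)
  fix u v assume uv: "{u..v} \<subseteq> {x<..}"
  show "absolutely_continuous_on {u..v} (a x)"
  proof (rule absolutely_continuous_on_dominated)
    have "{x + u..x + v} \<subseteq> {2 * x0<..}"
    proof
      fix z assume z: "z \<in> {x + u..x + v}"
      then have "u \<in> {u..v}" by auto
      then have "u \<in> {x<..}" using uv by blast
      then show "z \<in> {2 * x0<..}" using z x by auto
    qed
    then show "absolutely_continuous_on {x + u..x + v} f" using ac by (simp add: loc_abs_cont_on_def)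
    let ?L = "Mb * enn2real (tail k (2 * x0))"
    have L: "ennreal ?L = ennreal Mb * tail k (2 * x0)"
      using Mb_nonneg tail_finite[OF k_int, of "2 * x0"] by (simp add: ennreal_mult)
    show "0 \<le> ?L" using Mb_nonneg by simp
    fix s s' assume s: "u \<le> s" "s \<le> s'" "s' \<le> v"
    define h where "h = s' - s"
    have "s \<in> {u..v}" using s by auto
    then have "s \<in> {x<..}" using uv by blast
    then have h: "x < s" "0 \<le> h" "s + h = s'" using s by (auto simp: h_def)
    let ?c = "corr (b x) (\<lambda>z. f (z + h) - f z) (x + s)"
    have "ennreal (norm ?c) \<le> ennreal Mb * shift_err h (x + s)"
      using x by (intro norm_corr_le_bounded_left b_bound) (auto simp: b_zero)
    also have "\<dots> \<le> ennreal Mb * (ennreal h * tail k (2 * x0))"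
      using h x by (intro mult_left_mono order.trans[OF tail_diff_le_pos] tail_antimono) auto
    also have "\<dots> = ennreal (?L * h)" using Mb_nonneg h L
      by (simp add: ennreal_mult ac_simps)
    finally have c: "norm ?c \<le> ?L * h" using Mb_nonneg h(2) by simp
    have "?c = corr (b x) f (x + s + h) - corr (b x) f (x + s)"
      by (subst corr_diff_right) (use x integrable_b_f integrable_b_f_shift corr_shift in auto)
    moreover have "x + s' = x + s + h" using h(3) by simp
    ultimately have "a x s' - a x s = - ((f (x + s') - f (x + s)) + ?c)"
      by (simp only: a_def) simp
    then have "norm (a x s' - a x s) \<le> norm (f (x + s') - f (x + s)) + norm ?c"
      by (simp only: norm_minus_cancel norm_triangle_ineq)
    then show "norm (a x s' - a x s) \<le> norm (f (x + s') - f (x + s)) + ?L * (s' - s)"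
      using c by (simp add: h_def)
  qed
next
  have "AE s in lborel. 2 * x0 < x + s \<longrightarrow> (f has_vector_derivative k (x + s)) (at (x + s))"
    by (rule AE_lborel_shift[OF deriv])
  then have "AE s in lborel. s \<in> {x<..} \<longrightarrow> a x differentiable at s"
  proof eventually_elim
    case (elim s)
    show ?case
      using a_has_vector_derivative_second[OF x _ elim[rule_format]] x
      by (auto simp: has_vector_derivative_def differentiable_def)
  qed
  then show "AE s in lebesgue. s \<in> {x<..} \<longrightarrow> a x differentiable at s"
    by (simp add: AE_completion_iff)
qed

lemma AE_a_has_vector_derivative_second:
  assumes x: "x0 \<le> x"
  shows "AE y in lborel. x < y \<longrightarrow> (a x has_vector_derivative (- k (x + y) - corr (b x) k (x + y))) (at y)"
  using AE_lborel_shift[OF deriv, of x]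
proof eventually_elim
  case (elim y)
  show ?case using elim x a_has_vector_derivative_second[OF x] by auto
qed

lemma tail_ay_le:
  assumes x: "x0 \<le> x"
  shows "tail (\<lambda>y. - k (x + y) - corr (b x) k (x + y)) x \<le> tail k (2 * x) * (1 + tail (b x) 0)"
proof -
  have "tail (\<lambda>y. - k (x + y) - corr (b x) k (x + y)) x \<le> tail (\<lambda>y. k (x + y)) x + tail (\<lambda>y. corr (b x) k (x + y)) x"
  proof (rule tail_triangle)
    fix y
    show "norm (- k (x + y) - corr (b x) k (x + y)) \<le> norm (k (x + y)) + norm (corr (b x) k (x + y))"
      using norm_triangle_ineq4[of "- k (x + y)" "corr (b x) k (x + y)"] by simp
  qed measurable
  also have "\<dots> = tail k (2 * x) + tail (corr (b x) k) (2 * x)" by (simp add: tail_shift)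
  also have "\<dots> \<le> tail k (2 * x) + tail (b x) 0 * tail k (2 * x)"
    by (intro add_left_mono tail_corr_le) (auto simp: b_zero)
  finally show ?thesis by (simp add: algebra_simps)
qed

section \<open>The derivative of \<open>F\<close> bounded by that of \<open>A\<close>\<close>

text \<open>
  Fix \<open>y > x + h\<close> and subtract the Marchenko equations at \<open>x + h\<close> and at \<open>x\<close>, without the change of
  variables \<open>t \<mapsto> x + t\<close>. On \<open>t > x + h\<close> the integrands combine to the difference quotient of \<open>A\<close> times
  \<open>F(t + y)\<close>; the rest is the mean of \<open>A(x, t) F(t + y)\<close> over \<open>x < t \<le> x + h\<close>. In the half-line
  coordinates this splits \<open>b x\<close> at \<open>h\<close>.
\<close>

lemma tail_quot_f_le_quot_a:
  assumes x: "x0 \<le> x" and h: "0 < h" and S: "\<And>t. enorm (b x t) \<le> S"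
  shows "tail (quot f h) (2 * x + h) \<le> ennreal (1 + q) * tail (\<lambda>y. a_quot x h y) x + S * tail f (2 * x)"
proof -
  have xh: "x0 \<le> x + h" "h \<noteq> 0" using x h by auto
  define A' where "A' = (\<lambda>y. a_quot x h y)"
  have [measurable]: "A' \<in> borel_measurable borel" unfolding A'_def by measurable
  \<comment> \<open>With \<open>t\<close> measured from \<open>x\<close>: \<open>d\<close> is the part of \<open>b x\<close> on \<open>(0, h]\<close>, and \<open>c\<close> the remaining part translated to \<open>(0, \<infinity>)\<close>.\<close>
  define c where "c = (\<lambda>t. if 0 < t then b x (h + t) else 0)"
  define d where "d = (\<lambda>t. if t \<le> h then b x t else 0)"
  define e where "e = (\<lambda>t. (b (x + h) t - c t) / of_real h)"
  have [measurable]: "c \<in> borel_measurable borel" "d \<in> borel_measurable borel"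
    unfolding c_def d_def by measurable
  then have [measurable]: "e \<in> borel_measurable borel" unfolding e_def by measurable
  have bs_int: "integrable lborel (\<lambda>t. b x (h + t))"
    using lborel_integrable_real_affine[OF b_int[OF x], of 1 h] by simp
  have c_int: "integrable lborel c"
    by (rule Bochner_Integration.integrable_bound[OF bs_int]) (auto simp: c_def)
  have d_int: "integrable lborel d"
    by (rule Bochner_Integration.integrable_bound[OF b_int[OF x]]) (auto simp: d_def)
  have int: "integrable lborel (\<lambda>t. g t * f (u + t))" if "integrable lborel g" for g u
    by (rule integrable_corr_bounded_right[OF that _ f_bound]) measurable
  have split: "corr (b x) f u = corr c f (u + h) + corr d f u" for u
  proof -
    define c' where "c' = (\<lambda>t. if h < t then b x t else 0)"
    have [measurable]: "c' \<in> borel_measurable borel" unfolding c'_def by measurable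
    have c'_int: "integrable lborel c'"
      by (rule Bochner_Integration.integrable_bound[OF b_int[OF x]]) (auto simp: c'_def)
    have "corr (b x) f u = (LINT t|lborel. c' t * f (u + t) + d t * f (u + t))"
      unfolding corr_def by (intro Bochner_Integration.integral_cong) (auto simp: c'_def d_def)
    also have "\<dots> = corr c' f u + corr d f u"
      unfolding corr_def by (rule Bochner_Integration.integral_add[OF int[OF c'_int] int[OF d_int]])
    also have "corr c' f u = (LINT t|lborel. c' (h + 1 * t) * f (u + (h + 1 * t)))"
      unfolding corr_def by (subst lborel_integral_real_affine[where c=1 and t=h]) simp_all
    also have "\<dots> = corr c f (u + h)"
      unfolding corr_def by (intro Bochner_Integration.integral_cong) (auto simp: c'_def c_def ac_simps)
    finally show ?thesis .
  qed
  have e_corr: "corr e f u = (corr (b (x + h)) f u - corr c f u) / of_real h" for u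
    unfolding e_def corr_divide_left
    by (subst corr_diff_left) (use int[OF b_int[OF xh(1)]] int[OF c_int] in auto)
  have eq: "quot f h (x + y) = - A' y - corr e f (x + h + y) + corr (\<lambda>t. d t / of_real h) f (x + y)" for y
  proof -
    have "A' y = (- f (x + h + y) - corr (b (x + h)) f (x + h + y) + f (x + y) + (corr c f (x + h + y) + corr d f (x + y))) / of_real h"
      using split[of "x + y"] by (simp add: A'_def quot_def a_def ac_simps)
    then show ?thesis
      unfolding e_corr corr_divide_left by (simp add: quot_def diff_divide_distrib add_divide_distrib ac_simps)
  qed
  have e_A': "e t = A' (x + h + t)" if "0 < t" for t
  proof -
    have 1: "b (x + h) t = a (x + h) (x + h + t)"
      using b_eq[OF xh(1) that] by (simp add: a_def algebra_simps)
    have 2: "b x (h + t) = a x (x + h + t)"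
      using b_eq[OF x, of "h + t"] that h by (simp add: a_def algebra_simps)
    show ?thesis using that unfolding e_def A'_def c_def quot_def by (simp add: 1 2)
  qed
  have tail_e: "tail e 0 \<le> tail A' x"
  proof -
    have "tail e 0 = tail (\<lambda>t. A' (x + h + t)) 0"
      by (intro tail_cong_AE AE_I2) (simp add: e_A')
    also have "\<dots> = tail A' (x + h)" by (subst tail_shift) auto
    also have "\<dots> \<le> tail A' x" using h by (intro tail_antimono) auto
    finally show ?thesis .
  qed
  have tail_d: "tail (\<lambda>t. d t / of_real h) 0 \<le> S"
  proof -
    have "tail (\<lambda>t. d t / of_real h) 0 \<le> (\<integral>\<^sup>+ t. ennreal (1 / h) * S * indicator {0..h} t \<partial>lborel)"
      unfolding tail_def
    proof (intro nn_integral_mono)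
      fix t
      have "enorm (d t / of_real h) = ennreal (1 / h) * enorm (d t)"
        using h by (simp add: norm_divide flip: ennreal_mult)
      also have "\<dots> \<le> ennreal (1 / h) * S" using S[of t] by (intro mult_left_mono) (auto simp: d_def)
      finally have "enorm (d t / of_real h) \<le> ennreal (1 / h) * S" .
      then show "enorm (d t / of_real h) * indicator {0<..} t \<le> ennreal (1 / h) * S * indicator {0..h} t"
        by (cases "0 < t \<and> t \<le> h") (auto simp: d_def)
    qed
    also have "\<dots> = ennreal (1 / h) * S * ennreal h" using h by (subst nn_integral_cmult) auto
    also have "\<dots> = (ennreal (1 / h) * ennreal h) * S" by (simp only: ac_simps)
    also have "ennreal (1 / h) * ennreal h = 1" using h by (simp flip: ennreal_mult)
    also have "1 * S = S" by simp
    finally show ?thesis .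
  qed
  have "tail (quot f h) (2 * x + h) = tail (\<lambda>y. quot f h (x + y)) (x + h)"
    by (subst tail_shift) (auto simp: ac_simps)
  also have "\<dots> \<le> tail A' (x + h) + tail (\<lambda>y. corr e f ((x + h) + y)) (x + h) + tail (\<lambda>y. corr (\<lambda>t. d t / of_real h) f (x + y)) (x + h)"
  proof (rule tail_triangle3)
    fix y
    have "norm (- A' y - corr e f (x + h + y) + corr (\<lambda>t. d t / of_real h) f (x + y))
        \<le> norm (- A' y - corr e f (x + h + y)) + norm (corr (\<lambda>t. d t / of_real h) f (x + y))"
      by (rule norm_triangle_ineq)
    also have "norm (- A' y - corr e f (x + h + y)) \<le> norm (A' y) + norm (corr e f (x + h + y))"
      using norm_triangle_ineq4[of "- A' y" "corr e f (x + h + y)"] by simp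
    finally show "norm (quot f h (x + y)) \<le> norm (A' y) + norm (corr e f (x + h + y)) + norm (corr (\<lambda>t. d t / of_real h) f (x + y))"
      unfolding eq by simp
  qed measurable
  also have "\<dots> \<le> tail A' x + ennreal q * tail A' x + S * tail f (2 * x)"
  proof (intro add_mono)
    show "tail A' (x + h) \<le> tail A' x" using h by (intro tail_antimono) auto
    have "tail (\<lambda>y. corr e f ((x + h) + y)) (x + h) = tail (corr e f) (x + h + (x + h))"
      by (subst tail_shift) auto
    also have "\<dots> \<le> tail e 0 * tail f (x + h + (x + h))"
      by (rule tail_corr_le) (auto simp: e_def c_def b_zero)
    also have "\<dots> \<le> tail A' x * ennreal q"
      by (rule mult_mono[OF tail_e tail_f_le_q]) (use xh in auto)
    finally show "tail (\<lambda>y. corr e f ((x + h) + y)) (x + h) \<le> ennreal q * tail A' x" by (simp add: mult.commute)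
    have "tail (\<lambda>y. corr (\<lambda>t. d t / of_real h) f (x + y)) (x + h) = tail (corr (\<lambda>t. d t / of_real h) f) (x + (x + h))"
      by (subst tail_shift) auto
    also have "\<dots> \<le> tail (\<lambda>t. d t / of_real h) 0 * tail f (x + (x + h))"
      by (rule tail_corr_le) (auto simp: d_def b_zero)
    also have "\<dots> \<le> S * tail f (2 * x)"
      by (rule mult_mono[OF tail_d tail_antimono]) (use h in auto)
    finally show "tail (\<lambda>y. corr (\<lambda>t. d t / of_real h) f (x + y)) (x + h) \<le> S * tail f (2 * x)" .
  qed
  also have "tail A' x + ennreal q * tail A' x = ennreal (1 + q) * tail A' x"
    using q by (simp add: ennreal_plus distrib_right)
  finally show ?thesis unfolding A'_def .
qed

lemma tail_k_le_tail_ax: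
  assumes x: "x0 \<le> x" and S: "\<And>t. enorm (b x t) \<le> S"
  shows "tail k (2 * x) \<le> ennreal (1 + q) * tail (ax x) x + S * tail f (2 * x)"
proof -
  let ?h = "\<lambda>n. 1 / real (Suc n)"
  let ?e = "\<lambda>n. tail (\<lambda>y. a_quot x (?h n) y - ax x y) x"
  let ?r = "\<lambda>n. quot_err (?h n) (2 * x)"
  have le: "tail k (2 * x + ?h n) \<le> (ennreal (1 + q) * (tail (ax x) x + ?e n) + S * tail f (2 * x)) + ?r n" for n
  proof -
    have h: "0 < ?h n" by simp
    have "tail k (2 * x + ?h n) \<le> tail (quot f (?h n)) (2 * x + ?h n) + quot_err (?h n) (2 * x + ?h n)"
    proof (rule tail_triangle)
      fix z
      show "norm (k z) \<le> norm (quot f (?h n) z) + norm (quot f (?h n) z - k z)"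
        using norm_triangle_ineq4[of "quot f (?h n) z" "quot f (?h n) z - k z"] by simp
    qed measurable
    also have "\<dots> \<le> (ennreal (1 + q) * (tail (ax x) x + ?e n) + S * tail f (2 * x)) + ?r n"
    proof (rule add_mono)
      have "tail (\<lambda>y. a_quot x (?h n) y) x \<le> tail (ax x) x + ?e n"
      proof (rule tail_triangle)
        fix y
        show "norm (a_quot x (?h n) y) \<le> norm (ax x y) + norm (a_quot x (?h n) y - ax x y)"
          using norm_triangle_ineq[of "ax x y" "a_quot x (?h n) y - ax x y"] by simp
      qed measurable
      then have "ennreal (1 + q) * tail (\<lambda>y. a_quot x (?h n) y) x \<le> ennreal (1 + q) * (tail (ax x) x + ?e n)"
        by (rule mult_left_mono) simp
      then show "tail (quot f (?h n)) (2 * x + ?h n) \<le> ennreal (1 + q) * (tail (ax x) x + ?e n) + S * tail f (2 * x)"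
        using tail_quot_f_le_quot_a[OF x h S] by (meson add_right_mono order.trans)
      show "quot_err (?h n) (2 * x + ?h n) \<le> ?r n" by (rule tail_antimono) simp
    qed
    finally show ?thesis .
  qed
  have h0: "?h \<longlonglongrightarrow> 0" using LIMSEQ_inverse_real_of_nat by (simp add: inverse_eq_divide)
  have "(\<lambda>n. 2 * x + ?h n) \<longlonglongrightarrow> 2 * x + 0" by (intro tendsto_intros h0)
  then have lim1: "(\<lambda>n. tail k (2 * x + ?h n)) \<longlonglongrightarrow> tail k (2 * x)"
    by (intro tail_continuous) simp
  have e0: "?e \<longlonglongrightarrow> 0"
    by (rule filterlim_compose[OF tail_quot_a_ax_tendsto[OF x] filterlim_inverse_shifts[OF x]])
  have r0: "?r \<longlonglongrightarrow> 0"
    by (rule filterlim_compose[OF tail_quot_diff_tendsto_shifts[OF x] filterlim_inverse_shifts[OF x]])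
  have lim2: "(\<lambda>n. (ennreal (1 + q) * (tail (ax x) x + ?e n) + S * tail f (2 * x)) + ?r n)
      \<longlonglongrightarrow> (ennreal (1 + q) * (tail (ax x) x + 0) + S * tail f (2 * x)) + 0"
    by (intro tendsto_add ennreal_tendsto_cmult e0 r0 tendsto_const) auto
  show ?thesis using LIMSEQ_le[OF lim1 lim2] le by auto
qed

end

section \<open>From \<open>F\<close> and \<open>A\<close> to the equation on a half-line\<close>

lemma sigma_F_upper: "x \<le> y \<Longrightarrow> enorm (F y) \<le> sigma_F F x"
  unfolding sigma_F_def by (rule SUP_upper) simp

lemma sigma_F_antimono: "x \<le> y \<Longrightarrow> sigma_F F y \<le> sigma_F F x"
  unfolding sigma_F_def by (rule SUP_subset_mono) auto

lemma sigma_1F_antimono: "x \<le> y \<Longrightarrow> sigma_1F F y \<le> sigma_1F F x"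
  unfolding sigma_1F_def by (intro nn_integral_mono) (auto simp: indicator_def)

lemma sigma_A_upper: "x \<le> y \<Longrightarrow> enorm (A x y) \<le> sigma_A A x"
  unfolding sigma_A_def by (rule SUP_upper) simp

locale marchenko_data =
  fixes F :: "real \<Rightarrow> complex" and A :: "real \<Rightarrow> real \<Rightarrow> complex" and x0 q :: real
  assumes q: "0 \<le> q" "q < 1" and sigma_1F_le: "sigma_1F F (2 * x0) \<le> ennreal q"
    and A_int: "\<And>x. x0 \<le> x \<Longrightarrow> set_integrable lebesgue {x..} (A x)"
    and marchenko: "marchenko F A x0"
    and F_ac: "loc_abs_cont_on {2 * x0<..} F"
begin

text \<open>
  The value at \<open>2 * x0\<close> is dropped. In the integral of the equation it occurs for one \<open>t\<close> at most, and the
  term \<open>F (x + y)\<close> is always written with \<open>F\<close> itself.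
\<close>

definition f :: "real \<Rightarrow> complex" where "f z = (if 2 * x0 < z then F z else 0)"

text \<open>
  The guard \<open>x0 \<le> x\<close> makes \<open>b x\<close> a Borel function for every \<open>x\<close>, which keeps measurability free of side
  conditions.
\<close>

definition b :: "real \<Rightarrow> real \<Rightarrow> complex" where "b x t = (if x0 \<le> x \<and> 0 < t then A x (x + t) else 0)"

lemma f_measurable [measurable]: "f \<in> borel_measurable borel"
proof -
  have "(\<lambda>z. indicator {2 * x0<..} z *\<^sub>R F z) \<in> borel_measurable borel"
    by (intro borel_measurable_continuous_on_indicator loc_abs_cont_on_imp_continuous_on F_ac) auto
  moreover have "(\<lambda>z. indicator {2 * x0<..} z *\<^sub>R F z) = f" by (auto simp: f_def)
  ultimately show ?thesis by simp
qed

lemma f_le_sigma_F: "u \<le> z \<Longrightarrow> enorm (f z) \<le> sigma_F F u"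
  using sigma_F_upper[of u z F] by (auto simp: f_def)

lemma tail_f_le: "tail f u \<le> sigma_1F F u"
  unfolding tail_def sigma_1F_def nn_integral_completion
  by (intro nn_integral_mono) (auto simp: indicator_def intro: f_le_sigma_F)

lemma tail_f_eq: "2 * x0 \<le> u \<Longrightarrow> (\<integral>\<^sup>+ v\<in>{u..}. enorm (F v) \<partial>lebesgue) = tail f u"
  by (rule tail_lebesgue(1)) (auto simp: f_def)

text \<open>
  The kernel \<open>A x\<close> is Lebesgue measurable; the integral is unchanged if it is replaced by a Borel version
  \<open>c\<close>. That \<open>b x\<close> itself is a Borel function is then read off from the equation.
\<close>

lemma A_formula_Borel:
  assumes x: "x0 \<le> x"
  obtains c where "c \<in> borel_measurable borel" "integrable lborel c"
    "AE t in lborel. c t = indicator {0..} t *\<^sub>R A x (x + t)"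
    "\<And>y. x \<le> y \<Longrightarrow> A x y = - F (x + y) - corr c f (x + y)"
proof -
  let ?g = "\<lambda>t. indicator {x..} t *\<^sub>R A x t"
  have g_int: "integrable lebesgue ?g" using A_int[OF x] by (simp add: set_integrable_def)
  then have g_meas [measurable]: "?g \<in> borel_measurable lebesgue" by auto
  from completion_ex_borel_measurable_complex[OF this]
  obtain g where [measurable]: "g \<in> borel_measurable borel" and g: "AE t in lborel. ?g t = g t" by auto
  have gl: "g \<in> borel_measurable lebesgue" by (rule measurable_completion) simp
  have g': "AE t in lebesgue. ?g t = g t" using g by (simp add: AE_completion_iff)
  have "integrable lebesgue g" by (rule integrable_cong_AE_imp[OF g_int gl g'])
  then have g_int': "integrable lborel g" by (simp add: integrable_completion)
  define c where "c = (\<lambda>t. g (x + t))"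
  show ?thesis
  proof
    show [measurable]: "c \<in> borel_measurable borel" unfolding c_def by measurable
    show "integrable lborel c" using lborel_integrable_real_affine[OF g_int', of 1 x] by (simp add: c_def)
    show "AE t in lborel. c t = indicator {0..} t *\<^sub>R A x (x + t)"
      using AE_lborel_shift[OF g, of x] by eventually_elim (simp add: c_def indicator_def)
    fix y assume y: "x \<le> y"
    \<comment> \<open>If \<open>x = y = x0\<close>, the argument of \<open>F\<close> reaches \<open>2 * x0\<close>, where \<open>f\<close> and \<open>F\<close> may differ, but for one \<open>t\<close> only.\<close>
    have ne: "AE t in lebesgue. t \<noteq> 2 * x0 - y" by (simp add: AE_completion_iff AE_lborel_singleton)
    have eq: "AE t in lebesgue. indicator {x..} t *\<^sub>R (A x t * F (t + y)) = g t * f (y + t)"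
      using g' ne
    proof eventually_elim
      case (elim t)
      show ?case
      proof (cases "x \<le> t")
        case True
        then have "2 * x0 < t + y" using elim x y by auto
        then show ?thesis using elim True by (simp add: f_def add.commute)
      next
        case False
        then show ?thesis using elim by simp
      qed
    qed
    have m1: "(\<lambda>t. g t * f (y + t)) \<in> borel_measurable lborel" by measurable
    have m2: "(\<lambda>t. indicator {x..} t *\<^sub>R (A x t * F (t + y))) \<in> borel_measurable lebesgue"
    proof -
      have fl: "(\<lambda>t. f (y + t) + indicator {2 * x0 - y} t *\<^sub>R F (2 * x0)) \<in> borel_measurable lebesgue"
        by (rule measurable_completion) measurable
      have "(\<lambda>t. ?g t * (f (y + t) + indicator {2 * x0 - y} t *\<^sub>R F (2 * x0))) \<in> borel_measurable lebesgue"
        by (rule borel_measurable_times[OF g_meas fl])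
      also have "(\<lambda>t. ?g t * (f (y + t) + indicator {2 * x0 - y} t *\<^sub>R F (2 * x0)))
          = (\<lambda>t. indicator {x..} t *\<^sub>R (A x t * F (t + y)))"
        using x y by (auto simp: fun_eq_iff f_def indicator_def add.commute)
      finally show ?thesis .
    qed
    have "(LINT t:{x..}|lebesgue. A x t * F (t + y)) = (LINT t|lebesgue. g t * f (y + t))"
      unfolding set_lebesgue_integral_def by (rule integral_cong_AE[OF m2 _ eq]) (rule measurable_completion[OF m1])
    also have "\<dots> = (LINT t|lborel. g t * f (y + t))" by (rule integral_completion[OF m1])
    also have "\<dots> = (LINT t|lborel. g (x + 1 * t) * f (y + (x + 1 * t)))"
      by (subst lborel_integral_real_affine[where c=1 and t=x]) simp_all
    also have "\<dots> = corr c f (x + y)" by (simp add: corr_def c_def ac_simps)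
    finally have "(LINT t:{x..}|lebesgue. A x t * F (t + y)) = corr c f (x + y)" .
    moreover have "A x y + (LINT t:{x..}|lebesgue. A x t * F (t + y)) = - F (x + y)"
      using marchenko x y by (simp add: marchenko_def)
    ultimately show "A x y = - F (x + y) - corr c f (x + y)" by (simp add: algebra_simps)
  qed
qed

lemma b_properties:
  assumes x: "x0 \<le> x"
  shows "integrable lborel (b x)" "x \<le> y \<Longrightarrow> A x y = - F (x + y) - corr (b x) f (x + y)"
    "sigma_1A A x = tail (b x) 0"
proof -
  obtain c where c [measurable]: "c \<in> borel_measurable borel" and c_int: "integrable lborel c"
    and cA: "AE t in lborel. c t = indicator {0..} t *\<^sub>R A x (x + t)"
    and A_c: "\<And>y. x \<le> y \<Longrightarrow> A x y = - F (x + y) - corr c f (x + y)"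
    using A_formula_Borel[OF x] by metis
  have "b x = (\<lambda>t. if 0 < t then - f (x + (x + t)) - corr c f (x + (x + t)) else 0)"
    using A_c x by (auto simp: fun_eq_iff b_def f_def)
  then have b_meas [measurable]: "b x \<in> borel_measurable borel" by simp
  have bc: "AE t in lborel. c t = b x t"
    using cA AE_lborel_singleton[of 0] by eventually_elim (use x in \<open>auto simp: b_def indicator_def\<close>)
  show "integrable lborel (b x)"
    by (rule integrable_cong_AE_imp[OF c_int _ bc]) measurable
  have "corr c f u = corr (b x) f u" for u
    unfolding corr_def using bc by (intro integral_cong_AE) (measurable, auto)
  then show "x \<le> y \<Longrightarrow> A x y = - F (x + y) - corr (b x) f (x + y)" using A_c by simp
  let ?g = "\<lambda>t. if x < t then b x (t - x) else 0"
  have "sigma_1A A x = tail ?g x"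
    unfolding sigma_1A_def by (rule tail_lebesgue(1)) (use x in \<open>auto simp: b_def\<close>)
  also have "\<dots> = tail (\<lambda>t. ?g (x + t)) 0" by (subst tail_shift) auto
  also have "\<dots> = tail (b x) 0" by (intro tail_cong_AE AE_I2) simp
  finally show "sigma_1A A x = tail (b x) 0" .
qed

sublocale marchenko_L1 f b x0 q
proof
  show "tail f (2 * x0) \<le> ennreal q" using tail_f_le sigma_1F_le by (rule order.trans)
  show "b x t = - f (2 * x + t) - corr (b x) f (2 * x + t)" if "x0 \<le> x" "0 < t" for x t
  proof -
    have "b x t = A x (x + t)" using that by (simp add: b_def)
    also have "\<dots> = - F (x + (x + t)) - corr (b x) f (x + (x + t))" using that by (intro b_properties) auto
    finally show ?thesis using that by (simp add: f_def)
  qed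
  show "b x \<in> borel_measurable borel" for x
  proof (cases "x0 \<le> x")
    case True
    then show ?thesis using b_properties(1) by auto
  next
    case False
    then have "b x = (\<lambda>t. 0)" by (auto simp: b_def)
    then show ?thesis by simp
  qed
qed (auto simp: f_def b_def q b_properties)

lemma sigma_1A_le:
  assumes x: "x0 \<le> x"
  shows "sigma_1A A x \<le> ennreal (1 / (1 - q)) * sigma_1F F (2 * x)"
  unfolding b_properties(3)[OF x]
  by (intro order.trans[OF tail_b_le[OF x]] mult_left_mono tail_f_le) auto

lemma sigma_A_le:
  assumes x: "x0 \<le> x"
  shows "sigma_A A x \<le> ennreal (1 / (1 - q)) * sigma_F F (2 * x)"
  unfolding sigma_A_def
proof (rule SUP_least)
  fix y assume y: "y \<in> {x..}"
  have "norm (A x y) \<le> norm (F (x + y)) + norm (corr (b x) f (x + y))"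
    using norm_triangle_ineq4[of "- F (x + y)" "corr (b x) f (x + y)"] b_properties(2)[OF x] y by simp
  then have "enorm (A x y) \<le> enorm (F (x + y)) + enorm (corr (b x) f (x + y))"
    by (simp flip: ennreal_plus add: ennreal_leI)
  also have "\<dots> \<le> sigma_F F (2 * x) + sigma_F F (2 * x) * tail (b x) 0"
    using y by (intro add_mono sigma_F_upper norm_corr_le_bounded_right f_le_sigma_F) (auto simp: b_zero)
  also have "\<dots> \<le> sigma_F F (2 * x) + sigma_F F (2 * x) * ennreal B"
    by (intro add_left_mono mult_left_mono tail_b_le_B x) auto
  also have "\<dots> = (1 + ennreal B) * sigma_F F (2 * x)" by (simp add: algebra_simps)
  also have "1 + ennreal B = ennreal (1 / (1 - q))"
    using q by (simp add: B_def field_simps flip: ennreal_1 ennreal_plus)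
  finally show "enorm (A x y) \<le> ennreal (1 / (1 - q)) * sigma_F F (2 * x)" .
qed

lemma b_le_sigma_A: "enorm (b x t) \<le> sigma_A A x"
  using sigma_A_upper[of x "x + t" A] by (auto simp: b_def)

text \<open>
  The equation solved for \<open>F(z)\<close>, at the point \<open>y = z - x\<close>.
\<close>

lemma sigma_F_le:
  assumes x: "x0 \<le> x"
  shows "sigma_F F (2 * x) \<le> ennreal (1 + q) * sigma_A A x"
  unfolding sigma_F_def
proof (rule SUP_least)
  fix z assume z: "z \<in> {2 * x..}"
  have "A x (z - x) = - F z - corr (b x) f z"
    using b_properties(2)[OF x, of "z - x"] z by simp
  then have "F z = - (A x (z - x) + corr (b x) f z)" by simp
  then have "norm (F z) \<le> norm (A x (z - x)) + norm (corr (b x) f z)"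
    by (simp only: norm_minus_cancel norm_triangle_ineq)
  then have "enorm (F z) \<le> enorm (A x (z - x)) + enorm (corr (b x) f z)"
    by (simp flip: ennreal_plus add: ennreal_leI)
  also have "\<dots> \<le> sigma_A A x + sigma_A A x * tail f z"
    using z by (intro add_mono sigma_A_upper norm_corr_le_bounded_left b_le_sigma_A) (auto simp: b_zero)
  also have "\<dots> \<le> sigma_A A x + sigma_A A x * ennreal q"
    using x z by (intro add_left_mono mult_left_mono tail_f_le_q) auto
  also have "\<dots> = ennreal (1 + q) * sigma_A A x"
    using q by (simp add: ennreal_plus algebra_simps)
  finally show "enorm (F z) \<le> ennreal (1 + q) * sigma_A A x" .
qed

lemma tail_f_le_sigma_1A:
  assumes x: "x0 \<le> x"
  shows "tail f (2 * x) \<le> ennreal (1 + q) * sigma_1A A x"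
proof -
  have "tail f (2 * x) = tail (\<lambda>t. f (2 * x + t)) 0" by (subst tail_shift) auto
  also have "\<dots> \<le> tail (b x) 0 + tail (\<lambda>t. corr (b x) f (2 * x + t)) 0"
  proof (rule tail_triangle)
    fix t :: real assume "0 < t"
    then have "f (2 * x + t) = - (b x t + corr (b x) f (2 * x + t))" using b_eq[OF x] by simp
    then show "norm (f (2 * x + t)) \<le> norm (b x t) + norm (corr (b x) f (2 * x + t))"
      by (simp only: norm_minus_cancel norm_triangle_ineq)
  qed measurable
  also have "\<dots> = tail (b x) 0 + tail (corr (b x) f) (2 * x)" by (simp add: tail_shift)
  also have "\<dots> \<le> tail (b x) 0 + tail (b x) 0 * tail f (2 * x)"
    by (intro add_left_mono tail_corr_le) (auto simp: b_zero)
  also have "\<dots> \<le> tail (b x) 0 + tail (b x) 0 * ennreal q"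
    using x by (intro add_left_mono mult_left_mono tail_f_le_q) auto
  also have "\<dots> = ennreal (1 + q) * sigma_1A A x"
    unfolding b_properties(3)[OF x] using q by (simp add: ennreal_plus algebra_simps)
  finally show ?thesis .
qed

lemma f_ac: "loc_abs_cont_on {2 * x0<..} f"
  by (rule loc_abs_cont_on_cong[OF _ _ F_ac]) (auto simp: f_def)

lemma f_deriv_iff:
  assumes "2 * x0 < z"
  shows "(f has_vector_derivative D) (at z) \<longleftrightarrow> (F has_vector_derivative D) (at z)"
proof
  assume "(f has_vector_derivative D) (at z)"
  then show "(F has_vector_derivative D) (at z)"
    by (rule has_vector_derivative_transform_within_open[where S="{2 * x0<..}"]) (use assms in \<open>auto simp: f_def\<close>)
next
  assume "(F has_vector_derivative D) (at z)"
  then show "(f has_vector_derivative D) (at z)"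
    by (rule has_vector_derivative_transform_within_open[where S="{2 * x0<..}"]) (use assms in \<open>auto simp: f_def\<close>)
qed

section \<open>The norms of the derivatives of \<open>A\<close>\<close>

lemma sigma_2F_f:
  assumes u: "2 * x0 \<le> u"
  shows "(\<integral>\<^sup>+ y\<in>{u..}. enorm (vector_derivative f (at y)) \<partial>lebesgue) = sigma_2F F u"
    "(\<integral>\<^sup>+ y\<in>{u<..}. enorm (vector_derivative f (at y)) \<partial>lebesgue) = sigma_2F F u"
proof -
  have eq: "vector_derivative f (at y) = vector_derivative F (at y)" if "u < y" for y
    unfolding vector_derivative_def using f_deriv_iff[of y] u that by simp
  have ae: "AE y in lborel. y \<noteq> u" by (rule AE_lborel_singleton)
  then show "(\<integral>\<^sup>+ y\<in>{u..}. enorm (vector_derivative f (at y)) \<partial>lebesgue) = sigma_2F F u"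
    unfolding sigma_2F_def nn_integral_completion
    by (intro nn_integral_cong_AE, elim eventually_mono) (auto simp: indicator_def eq)
  from ae show "(\<integral>\<^sup>+ y\<in>{u<..}. enorm (vector_derivative f (at y)) \<partial>lebesgue) = sigma_2F F u"
    unfolding sigma_2F_def nn_integral_completion
    by (intro nn_integral_cong_AE, elim eventually_mono) (auto simp: indicator_def eq)
qed

text \<open>
  Boundedness of \<open>f\<close> follows from integrability of its derivative.
\<close>

lemma ex_core:
  assumes fin: "sigma_2F F (2 * x0) < \<infinity>"
  obtains k M where "marchenko_core f k b x0 q M" "\<And>u. 2 * x0 \<le> u \<Longrightarrow> tail k u = sigma_2F F u"
proof -
  have fin': "(\<integral>\<^sup>+ y\<in>{2 * x0<..}. enorm (vector_derivative f (at y)) \<partial>lebesgue) < \<infinity>"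
    using sigma_2F_f(2)[of "2 * x0"] fin by simp
  obtain k where k: "primitive f k (2 * x0)"
    and tail_k: "\<And>u. 2 * x0 \<le> u \<Longrightarrow> tail k u = (\<integral>\<^sup>+ y\<in>{u..}. enorm (vector_derivative f (at y)) \<partial>lebesgue)"
    and "\<And>u. 2 * x0 \<le> u \<Longrightarrow> tail k u = (\<integral>\<^sup>+ y\<in>{u<..}. enorm (vector_derivative f (at y)) \<partial>lebesgue)"
    by (rule loc_abs_cont_primitive[OF f_ac f_measurable fin']) (rule that)
  interpret primitive f k "2 * x0" by (rule k)
  let ?K = "LINT s|lborel. norm (k s)"
  let ?M = "norm (f (2 * x0 + 1)) + ?K"
  have K: "norm (f v - f u) \<le> ?K" if "2 * x0 < u" "u \<le> v" for u v
  proof -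
    have "enorm (f v - f u) \<le> (\<integral>\<^sup>+ s\<in>{u..v}. enorm (k s) \<partial>lborel)"
      by (rule norm_diff_le[OF that])
    also have "\<dots> \<le> (\<integral>\<^sup>+ s. enorm (k s) \<partial>lborel)"
      by (intro nn_integral_mono) (simp add: indicator_def)
    also have "\<dots> = ennreal ?K" by (rule nn_integral_eq_integral) (use k_int in auto)
    finally show ?thesis by (subst (asm) ennreal_le_iff) auto
  qed
  have "0 \<le> ?K" by simp
  have M: "norm (f z) \<le> ?M" for z
  proof (cases "2 * x0 < z")
    case True
    have "norm (f z - f (2 * x0 + 1)) \<le> ?K"
      using K[of z "2 * x0 + 1"] K[of "2 * x0 + 1" z] True by (cases "z \<le> 2 * x0 + 1") (auto simp: norm_minus_commute)
    then show ?thesis using norm_triangle_sub[of "f z" "f (2 * x0 + 1)"] by simp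
  next
    case False
    then show ?thesis using \<open>0 \<le> ?K\<close> by (simp add: f_def)
  qed
  have "marchenko_core f k b x0 q ?M" by unfold_locales (rule M)
  then show ?thesis using that[of k ?M] tail_k sigma_2F_f(1) by simp
qed

lemma norm_Ay_le:
  assumes fin: "sigma_2F F (2 * x0) < \<infinity>" and x: "x0 \<le> x"
  shows "norm_Ay A x \<le> sigma_2F F (2 * x) * (1 + sigma_1A A x)"
proof -
  obtain k M where core: "marchenko_core f k b x0 q M" and k: "\<And>u. 2 * x0 \<le> u \<Longrightarrow> tail k u = sigma_2F F u"
    using ex_core[OF fin] by metis
  interpret core: marchenko_core f k b x0 q M by (rule core)
  have A_a: "core.a x y = A x y" if "x < y" for y
    using b_properties(2)[OF x, of y] x that by (simp add: core.a_def f_def)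
  have ac: "loc_abs_cont_on {x<..} (A x)"
    by (rule loc_abs_cont_on_cong[OF _ _ core.loc_abs_cont_a_second[OF f_ac x]]) (auto simp: A_a)
  have "AE y in lborel. x < y \<longrightarrow> norm (- k (x + y) - corr (b x) k (x + y)) = norm (vector_derivative (A x) (at y))"
    using core.AE_a_has_vector_derivative_second[OF x]
  proof eventually_elim
    case (elim y)
    show ?case
    proof
      assume y: "x < y"
      then have "(core.a x has_vector_derivative (- k (x + y) - corr (b x) k (x + y))) (at y)" using elim by simp
      then have "(A x has_vector_derivative (- k (x + y) - corr (b x) k (x + y))) (at y)"
        by (rule has_vector_derivative_transform_within_open[where S="{x<..}"]) (use y in \<open>auto simp: A_a\<close>)
      then show "norm (- k (x + y) - corr (b x) k (x + y)) = norm (vector_derivative (A x) (at y))"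
        by (simp add: vector_derivative_at)
    qed
  qed
  from tail_lebesgue(2)[OF this]
  have "norm_Ay A x = tail (\<lambda>y. - k (x + y) - corr (b x) k (x + y)) x"
    using ac by (simp add: norm_Ay_def)
  also have "\<dots> \<le> tail k (2 * x) * (1 + tail (b x) 0)" by (rule core.tail_ay_le[OF x])
  finally show ?thesis using x by (simp add: k b_properties(3)[OF x])
qed

lemma norm_Ax_eq:
  assumes core: "marchenko_core f k b x0 q M" and x: "x0 \<le> x"
  shows "norm_Ax x0 A x = tail (marchenko_core.ax f k b x) x"
proof -
  interpret core: marchenko_core f k b x0 q M by (rule core)
  have A_a: "core.a s y = A s y" if "x0 \<le> s" "s \<le> y" "x0 < y" for s y
    using b_properties(2)[of s y] that by (simp add: core.a_def f_def)
  have nb: "at x within {x0..y} \<noteq> bot" if "x < y" for y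
  proof -
    have "at x within {x..y} \<le> at x within {x0..y}" by (rule at_le) (use x in auto)
    moreover have "at x within {x..y} \<noteq> bot" using that by (simp add: at_within_Icc_at_right)
    ultimately show ?thesis by (metis bot.extremum_unique)
  qed
  have vd: "AE y in lborel. x < y \<longrightarrow> ((\<lambda>s. A s y) has_vector_derivative core.ax x y) (at x within {x0..y})"
    using core.AE_a_has_vector_derivative[OF x]
  proof eventually_elim
    case (elim y)
    show ?case
    proof
      assume y: "x < y"
      then have "((\<lambda>s. core.a s y) has_vector_derivative core.ax x y) (at x within {x0..y})"
        using elim by (auto intro: has_vector_derivative_within_subset)
      then show "((\<lambda>s. A s y) has_vector_derivative core.ax x y) (at x within {x0..y})"
        by (rule has_vector_derivative_transform[rotated 2]) (use x y in \<open>auto simp: A_a\<close>)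
    qed
  qed
  have "AE y in lborel. x < y \<longrightarrow> loc_abs_cont_on {x<..<y} (\<lambda>s. A s y) \<and>
            (\<lambda>s. A s y) differentiable (at x within {x0..y})"
    using vd
  proof eventually_elim
    case (elim y)
    have "loc_abs_cont_on {x<..<y} (\<lambda>s. A s y)"
      by (rule loc_abs_cont_on_cong[OF _ _ core.loc_abs_cont_a_first[OF f_ac x]]) (use x in \<open>auto simp: A_a\<close>)
    then show ?case using elim by (auto simp: has_vector_derivative_def differentiable_def)
  qed
  then have cond: "AE y in lebesgue. x < y \<longrightarrow> loc_abs_cont_on {x<..<y} (\<lambda>s. A s y) \<and>
            (\<lambda>s. A s y) differentiable (at x within {x0..y})"
    by (simp add: AE_completion_iff)
  have "AE y in lborel. x < y \<longrightarrow> norm (core.ax x y) = norm (vector_derivative (\<lambda>s. A s y) (at x within {x0..y}))"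
    using vd by eventually_elim (auto simp: vector_derivative_within[OF nb])
  from tail_lebesgue(2)[OF this] cond show ?thesis by (simp add: norm_Ax_def)
qed

lemma norm_Ax_le:
  assumes fin: "sigma_2F F (2 * x0) < \<infinity>" and x: "x0 \<le> x"
  shows "norm_Ax x0 A x \<le> ennreal (1 + q / (1 - q) * (2 * (1 + B)) + B) * sigma_2F F (2 * x)"
proof -
  obtain k M where core: "marchenko_core f k b x0 q M" and k: "\<And>u. 2 * x0 \<le> u \<Longrightarrow> tail k u = sigma_2F F u"
    using ex_core[OF fin] by metis
  interpret core: marchenko_core f k b x0 q M by (rule core)
  show ?thesis using core.tail_ax_le[OF x] x
    by (simp add: norm_Ax_eq[OF core x] core.Cx_def k)
qed

lemma sigma_2F_le:
  assumes fin: "sigma_2F F (2 * x0) < \<infinity>" and x: "x0 \<le> x"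
  shows "sigma_2F F (2 * x) \<le> ennreal (1 + q) * (norm_Ax x0 A x + sigma_A A x * sigma_1A A x)"
proof -
  obtain k M where core: "marchenko_core f k b x0 q M" and k: "\<And>u. 2 * x0 \<le> u \<Longrightarrow> tail k u = sigma_2F F u"
    using ex_core[OF fin] by metis
  interpret core: marchenko_core f k b x0 q M by (rule core)
  have "sigma_2F F (2 * x) = tail k (2 * x)" using x by (simp add: k)
  also have "\<dots> \<le> ennreal (1 + q) * tail (core.ax x) x + sigma_A A x * tail f (2 * x)"
    by (rule core.tail_k_le_tail_ax[OF x b_le_sigma_A])
  also have "\<dots> \<le> ennreal (1 + q) * norm_Ax x0 A x + sigma_A A x * (ennreal (1 + q) * sigma_1A A x)"
    by (intro add_mono mult_left_mono tail_f_le_sigma_1A x) (auto simp: norm_Ax_eq[OF core x])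
  also have "\<dots> = ennreal (1 + q) * (norm_Ax x0 A x + sigma_A A x * sigma_1A A x)"
    by (simp add: algebra_simps)
  finally show ?thesis .
qed

section \<open>Integrability of the derivative of \<open>F\<close>\<close>

lemma f_int: "integrable lborel f"
proof (rule integrableI_bounded)
  have "(\<integral>\<^sup>+ z. enorm (f z) \<partial>lborel) = tail f (2 * x0)"
    unfolding tail_def by (intro nn_integral_cong) (auto simp: indicator_def f_zero)
  also have "\<dots> < \<infinity>" using tail_le_q by (rule le_less_trans) simp
  finally show "(\<integral>\<^sup>+ z. enorm (f z) \<partial>lborel) < \<infinity>" .
qed measurable

lemma tail_quot_f_finite: "h \<noteq> 0 \<Longrightarrow> tail (quot f h) u < \<infinity>"
proof (rule tail_finite)
  have "integrable lborel (\<lambda>z. f (z + h))"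
    using lborel_integrable_real_affine[OF f_int, of 1 h] by (simp add: add.commute)
  then show "integrable lborel (quot f h)"
    unfolding quot_def[abs_def] by (intro integrable_divide Bochner_Integration.integrable_diff f_int)
qed

text \<open>
  The \<open>y\<close>-difference quotient of the Marchenko equation. Taking \<open>F\<close> and not \<open>A\<close> as the unknown, it is a
  Volterra inequality: the value at \<open>2x\<close> is bounded by the values further to the right.
\<close>

lemma tail_quot_f_step:
  assumes x: "x0 \<le> x" and h: "0 < h" and M: "\<And>z. norm (f z) \<le> M" and fin: "norm_Ay A x < \<infinity>"
  shows "tail (quot f h) (2 * x) \<le> norm_Ay A x + (\<integral>\<^sup>+ t. enorm (b x t) * tail (quot f h) (2 * x + t) \<partial>lborel)"
proof -
  define g where "g = (\<lambda>y. - f (x + y) - corr (b x) f (x + y))"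
  have [measurable]: "g \<in> borel_measurable borel" unfolding g_def by measurable
  have gA: "g y = A x y" if "x < y" for y
    using b_properties(2)[OF x, of y] x that by (simp add: g_def f_def)
  have A_ac: "loc_abs_cont_on {x<..} (A x)"
    and A_y: "norm_Ay A x = (\<integral>\<^sup>+ y\<in>{x<..}. enorm (vector_derivative (A x) (at y)) \<partial>lebesgue)"
    using fin by (auto simp: norm_Ay_def split: if_splits)
  have g_ac: "loc_abs_cont_on {x<..} g"
    by (rule loc_abs_cont_on_cong[OF _ _ A_ac]) (auto simp: gA)
  have vd: "vector_derivative g (at y) = vector_derivative (A x) (at y)" if "x < y" for y
  proof -
    have "(g has_vector_derivative D) (at y) \<longleftrightarrow> (A x has_vector_derivative D) (at y)" for D
      using has_vector_derivative_transform_within_open[of g D y "{x<..}" "A x"]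
        has_vector_derivative_transform_within_open[of "A x" D y "{x<..}" g] that by (auto simp: gA)
    then show ?thesis unfolding vector_derivative_def by simp
  qed
  have g_y: "(\<integral>\<^sup>+ y\<in>{x<..}. enorm (vector_derivative g (at y)) \<partial>lebesgue) = norm_Ay A x"
    unfolding A_y by (intro nn_integral_cong) (auto simp: indicator_def vd)
  have quot_g: "tail (quot g h) x \<le> norm_Ay A x"
  proof (rule loc_abs_cont_primitive[OF g_ac])
    show "(\<integral>\<^sup>+ y\<in>{x<..}. enorm (vector_derivative g (at y)) \<partial>lebesgue) < \<infinity>"
      using fin by (simp add: g_y)
    fix k assume "primitive g k x"
      and k: "\<And>u. x \<le> u \<Longrightarrow> tail k u = (\<integral>\<^sup>+ y\<in>{u<..}. enorm (vector_derivative g (at y)) \<partial>lebesgue)"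
    then interpret g: primitive g k x by simp
    show "tail (quot g h) x \<le> norm_Ay A x"
      using g.tail_quot_le[of x h] h k[of x] by (simp add: g_y min_def)
  qed measurable
  have eq: "quot f h (x + y) = - (quot g h y + corr (b x) (quot f h) (x + y))" for y
  proof -
    have int: "integrable lborel (\<lambda>t. b x t * f (u + t))" for u
      by (rule integrable_corr_bounded_right[OF b_int[OF x] _ M]) measurable
    have "corr (b x) (\<lambda>z. f (z + h) - f z) (x + y) = corr (b x) f (x + y + h) - corr (b x) f (x + y)"
      unfolding corr_shift[of "b x" f h "x + y", symmetric]
      by (rule corr_diff_right) (use int[of "x + y"] int[of "x + y + h"] in \<open>auto simp: ac_simps\<close>)
    then have "corr (b x) (quot f h) (x + y) = (corr (b x) f (x + y + h) - corr (b x) f (x + y)) / of_real h"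
      by (simp add: quot_def[abs_def] corr_divide_right)
    then show ?thesis
      by (simp add: quot_def g_def diff_divide_distrib ac_simps)
  qed
  have "tail (quot f h) (2 * x) = tail (\<lambda>y. quot f h (x + y)) x" by (subst tail_shift) auto
  also have "\<dots> \<le> tail (quot g h) x + tail (\<lambda>y. corr (b x) (quot f h) (x + y)) x"
  proof (rule tail_triangle)
    fix y
    show "norm (quot f h (x + y)) \<le> norm (quot g h y) + norm (corr (b x) (quot f h) (x + y))"
      unfolding eq norm_minus_cancel by (rule norm_triangle_ineq)
  qed measurable
  also have "tail (\<lambda>y. corr (b x) (quot f h) (x + y)) x = tail (corr (b x) (quot f h)) (2 * x)"
    by (subst tail_shift) auto
  also have "tail (quot g h) x + \<dots> \<le> norm_Ay A x + (\<integral>\<^sup>+ t. enorm (b x t) * tail (quot f h) (2 * x + t) \<partial>lborel)"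
    by (intro add_mono quot_g tail_corr_le_integral) measurable
  finally show ?thesis .
qed

text \<open>
  This expresses \<open>F' \<in> L\<^sup>1(2x, \<infinity>)\<close> through difference quotients, whose norms are finite for each \<open>h\<close>. So
  they can be absorbed, which the norm of \<open>F'\<close>, possibly infinite, cannot.
\<close>

definition quot_bounded :: "real \<Rightarrow> bool" where
  "quot_bounded x \<longleftrightarrow> (\<exists>K<\<infinity>. \<forall>h>0. tail (quot f h) (2 * x) \<le> K)"

lemma tail_quot_absorb_half:
  assumes h: "0 < h" and le: "tail (quot f h) u \<le> K + ennreal (1 / 2) * tail (quot f h) u"
  shows "tail (quot f h) u \<le> 2 * K"
  using tail_le_absorb[OF le tail_quot_f_finite] h by simp

lemma quot_bounded_large:
  assumes x: "x0 \<le> x" and M: "\<And>z. norm (f z) \<le> M" and fin: "norm_Ay A x < \<infinity>"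
    and small: "tail (b x) 0 \<le> ennreal (1 / 2)"
  shows "quot_bounded x"
  unfolding quot_bounded_def
proof (intro exI conjI allI impI)
  show "2 * norm_Ay A x < \<infinity>" using fin by (simp add: ennreal_mult_less_top)
  fix h :: real assume h: "0 < h"
  let ?T = "tail (quot f h)"
  have "(\<integral>\<^sup>+ t. enorm (b x t) * ?T (2 * x + t) \<partial>lborel) \<le> (\<integral>\<^sup>+ t. enorm (b x t) * ?T (2 * x) \<partial>lborel)"
  proof (intro nn_integral_mono)
    fix t
    show "enorm (b x t) * ?T (2 * x + t) \<le> enorm (b x t) * ?T (2 * x)"
      using b_zero[of t x] by (cases "t \<le> 0") (auto intro!: mult_left_mono tail_antimono)
  qed
  also have "\<dots> = tail (b x) 0 * ?T (2 * x)"
    by (subst nn_integral_multc) (auto simp: tail_zero_eq b_zero)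
  also have "\<dots> \<le> ennreal (1 / 2) * ?T (2 * x)" by (intro mult_right_mono small) auto
  finally have "?T (2 * x) \<le> norm_Ay A x + ennreal (1 / 2) * ?T (2 * x)"
    using tail_quot_f_step[OF x h M fin] by (meson add_left_mono order.trans)
  then show "?T (2 * x) \<le> 2 * norm_Ay A x" by (rule tail_quot_absorb_half[OF h])
qed

text \<open>
  The integral over \<open>t\<close> is split at \<open>d\<close>. For \<open>t \<le> d\<close> the bound \<open>S\<close> of \<open>b x\<close> gives at most half of the
  left-hand side; for \<open>t > d\<close> the hypothesis on \<open>x + d / 2\<close> applies.
\<close>

lemma quot_bounded_step:
  assumes x: "x0 \<le> x" and M: "\<And>z. norm (f z) \<le> M" and fin: "norm_Ay A x < \<infinity>"
    and d: "0 < d" "\<And>t. enorm (b x t) \<le> ennreal S" "0 \<le> S" "S * d \<le> 1 / 2"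
    and next_bounded: "quot_bounded (x + d / 2)"
  shows "quot_bounded x"
proof -
  obtain K where K: "K < \<infinity>" "\<And>h. 0 < h \<Longrightarrow> tail (quot f h) (2 * x + d) \<le> K"
    using next_bounded by (auto simp: quot_bounded_def algebra_simps)
  show ?thesis
    unfolding quot_bounded_def
  proof (intro exI conjI allI impI)
    show "2 * (norm_Ay A x + ennreal B * K) < \<infinity>" using fin K by (simp add: ennreal_mult_less_top)
    fix h :: real assume h: "0 < h"
    let ?T = "tail (quot f h)"
    have "(\<integral>\<^sup>+ t. enorm (b x t) * ?T (2 * x + t) \<partial>lborel)
        \<le> (\<integral>\<^sup>+ t. enorm (b x t) * K + ennreal S * ?T (2 * x) * indicator {0..d} t \<partial>lborel)"
    proof (intro nn_integral_mono)
      fix t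
      consider "t \<le> 0" | "0 < t" "t \<le> d" | "d < t" by linarith
      then show "enorm (b x t) * ?T (2 * x + t)
          \<le> enorm (b x t) * K + ennreal S * ?T (2 * x) * indicator {0..d} t"
      proof cases
        case 1
        then show ?thesis by (simp add: b_zero)
      next
        case 2
        then have "enorm (b x t) * ?T (2 * x + t) \<le> ennreal S * ?T (2 * x)"
          by (intro mult_mono d tail_antimono) auto
        then show ?thesis using 2 by (simp add: add_increasing)
      next
        case 3
        then have "?T (2 * x + t) \<le> K"
          using K(2)[OF h] tail_antimono[of "2 * x + d" "2 * x + t" "quot f h"] by (meson add_left_mono less_imp_le order.trans)
        then show ?thesis by (simp add: add_increasing2 mult_left_mono)
      qed
    qed
    also have "\<dots> = tail (b x) 0 * K + ennreal S * ?T (2 * x) * ennreal d"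
      using d(1) by (subst nn_integral_add) (auto simp: nn_integral_multc nn_integral_cmult tail_zero_eq b_zero)
    also have "\<dots> \<le> ennreal B * K + ennreal (1 / 2) * ?T (2 * x)"
    proof (rule add_mono)
      show "tail (b x) 0 * K \<le> ennreal B * K" by (intro mult_right_mono tail_b_le_B x) auto
      have "ennreal S * ?T (2 * x) * ennreal d = ennreal (S * d) * ?T (2 * x)"
        using d by (simp add: ennreal_mult ac_simps)
      also have "\<dots> \<le> ennreal (1 / 2) * ?T (2 * x)" by (intro mult_right_mono ennreal_leI d) auto
      finally show "ennreal S * ?T (2 * x) * ennreal d \<le> ennreal (1 / 2) * ?T (2 * x)" .
    qed
    finally have "?T (2 * x) \<le> norm_Ay A x + (ennreal B * K + ennreal (1 / 2) * ?T (2 * x))"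
      using tail_quot_f_step[OF x h M fin] by (meson add_left_mono order.trans)
    then have "?T (2 * x) \<le> (norm_Ay A x + ennreal B * K) + ennreal (1 / 2) * ?T (2 * x)"
      by (simp add: add.assoc)
    then show "?T (2 * x) \<le> 2 * (norm_Ay A x + ennreal B * K)" by (rule tail_quot_absorb_half[OF h])
  qed
qed

lemma ex_tail_f_small:
  assumes "0 < e"
  shows "\<exists>n. tail f (real n) < ennreal e"
proof -
  have "(\<lambda>n. tail f (real n)) \<longlonglongrightarrow> (\<integral>\<^sup>+ z. 0 \<partial>(lborel :: real measure))"
    unfolding tail_def
  proof (rule nn_integral_dominated_convergence[where w="\<lambda>z. enorm (f z)"])
    show "(\<integral>\<^sup>+ z. enorm (f z) \<partial>lborel) < \<infinity>"
      using f_int by (simp add: integrable_iff_bounded)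
    show "AE z in lborel. (\<lambda>n. enorm (f z) * indicator {real n<..} z) \<longlonglongrightarrow> 0"
    proof (rule AE_I2, rule tendsto_eventually)
      fix z
      obtain m where "z \<le> real m" using real_arch_simple by blast
      then have "\<forall>n\<ge>m. enorm (f z) * indicator {real n<..} z = 0" by (auto simp: indicator_def)
      then show "\<forall>\<^sub>F n in sequentially. enorm (f z) * indicator {real n<..} z = 0"
        unfolding eventually_sequentially by blast
    qed
  qed (auto simp: indicator_def)
  then have "\<forall>\<^sub>F n in sequentially. tail f (real n) < ennreal e"
    using assms by (intro order_tendstoD(2)) auto
  then show ?thesis by (rule eventually_happens'[OF sequentially_bot])
qed

text \<open>
  The step length \<open>d\<close> depends only on a bound of \<open>b\<close> that is uniform in \<open>x \<ge> x\<^sub>0\<close>, so finitely many steps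
  lead from large \<open>x\<close> to \<open>x\<^sub>0\<close>. Fatou's lemma then passes from difference quotients to \<open>F'\<close>.
\<close>

lemma sigma_2F_finite:
  assumes fin: "\<And>x. x0 \<le> x \<Longrightarrow> norm_Ay A x < \<infinity>" and A_fin: "sigma_A A x0 < \<infinity>"
  shows "sigma_2F F (2 * x0) < \<infinity>"
proof -
  have F_fin: "sigma_F F (2 * x0) < \<infinity>"
    by (rule le_less_trans[OF sigma_F_le[OF order_refl]]) (use A_fin in \<open>simp add: ennreal_mult_less_top\<close>)
  define M where "M = enn2real (sigma_F F (2 * x0))"
  have M: "norm (f z) \<le> M" for z
  proof (cases "2 * x0 < z")
    case True
    then have "enorm (f z) \<le> ennreal M"
      using f_le_sigma_F[of "2 * x0" z] F_fin by (simp add: M_def)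
    then show ?thesis by (simp add: M_def)
  qed (simp add: f_def M_def)
  define S where "S = 1 / (1 - q) * M"
  have S0: "0 \<le> S" using q by (simp add: S_def M_def)
  have S: "enorm (b x t) \<le> ennreal S" if x: "x0 \<le> x" for x t
  proof -
    have "enorm (b x t) \<le> ennreal (1 / (1 - q)) * sigma_F F (2 * x)"
      using b_le_sigma_A sigma_A_le[OF x] by (rule order.trans)
    also have "\<dots> \<le> ennreal (1 / (1 - q)) * sigma_F F (2 * x0)"
      using x by (intro mult_left_mono sigma_F_antimono) auto
    also have "sigma_F F (2 * x0) = ennreal M" using F_fin by (simp add: M_def)
    also have "ennreal (1 / (1 - q)) * ennreal M = ennreal S"
      unfolding S_def by (rule ennreal_mult[symmetric]) (use q in \<open>auto simp: M_def\<close>)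
    finally show ?thesis .
  qed
  \<comment> \<open>Two units of the argument of \<open>F\<close> correspond to one of \<open>x\<close>, so a step in \<open>x\<close> has length \<open>d / 2\<close>.\<close>
  define d where "d = 1 / (2 * (S + 1))"
  have d: "0 < d" "S * d \<le> 1 / 2" using S0 by (auto simp: d_def field_simps)
  obtain n where n: "tail f (real n) < ennreal ((1 - q) / 2)"
    using ex_tail_f_small[of "(1 - q) / 2"] q by auto
  have large: "quot_bounded x" if x: "x0 \<le> x" "real n \<le> 2 * x" for x
  proof (rule quot_bounded_large[OF x(1) M fin[OF x(1)]])
    have "tail (b x) 0 \<le> ennreal (1 / (1 - q)) * tail f (2 * x)" by (rule tail_b_le[OF x(1)])
    also have "\<dots> \<le> ennreal (1 / (1 - q)) * ennreal ((1 - q) / 2)"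
      using n tail_antimono[OF x(2), of f] by (intro mult_left_mono) auto
    also have "\<dots> = ennreal (1 / 2)" using q by (simp flip: ennreal_mult)
    finally show "tail (b x) 0 \<le> ennreal (1 / 2)" .
  qed
  have "quot_bounded x" if "x0 \<le> x" "real n \<le> 2 * x + real j * d" for x j
    using that
  proof (induction j arbitrary: x)
    case 0
    then show ?case by (intro large) auto
  next
    case (Suc j)
    have "quot_bounded (x + d / 2)" using Suc.prems d by (intro Suc.IH) (auto simp: algebra_simps)
    then show ?case using Suc.prems d S0 S by (intro quot_bounded_step[OF _ M fin, of x d S]) auto
  qed
  moreover obtain j where "real n - 2 * x0 \<le> real j * d"
    using reals_Archimedean3[OF d(1)] less_imp_le by metis
  ultimately have "quot_bounded x0" by (auto simp: algebra_simps)
  then obtain K where K: "K < \<infinity>" "\<And>h. 0 < h \<Longrightarrow> tail (quot f h) (2 * x0) \<le> K"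
    by (auto simp: quot_bounded_def)
  let ?h = "\<lambda>n. 1 / real (Suc n)"
  have h0: "?h \<longlonglongrightarrow> 0" using LIMSEQ_inverse_real_of_nat by (simp add: inverse_eq_divide)
  have "AE z in lborel. z \<in> {2 * x0<..} \<longrightarrow> f differentiable at z"
    using f_ac by (simp add: loc_abs_cont_on_def AE_completion_iff)
  then have "AE z in lborel. enorm (vector_derivative f (at z)) * indicator {2 * x0<..} z
      = liminf (\<lambda>n. enorm (quot f (?h n) z) * indicator {2 * x0<..} z)"
  proof eventually_elim
    case (elim z)
    show ?case
    proof (cases "2 * x0 < z")
      case True
      then have "((\<lambda>h. quot f h z) \<longlongrightarrow> vector_derivative f (at z)) (at 0)"
        using elim by (simp add: vector_derivative_works has_vector_derivative_iff_quot)
      then have "(\<lambda>n. quot f (?h n) z) \<longlonglongrightarrow> vector_derivative f (at z)"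
        by (rule filterlim_compose) (use h0 in \<open>auto simp: filterlim_at simp del: of_nat_Suc\<close>)
      then have "(\<lambda>n. enorm (quot f (?h n) z)) \<longlonglongrightarrow> enorm (vector_derivative f (at z))"
        by (intro tendsto_intros)
      then have "liminf (\<lambda>n. enorm (quot f (?h n) z)) = enorm (vector_derivative f (at z))"
        by (rule lim_imp_Liminf[OF sequentially_bot])
      then show ?thesis using True by (simp del: of_nat_Suc)
    qed (simp add: Liminf_const)
  qed
  then have "sigma_2F F (2 * x0)
      = (\<integral>\<^sup>+ z. liminf (\<lambda>n. enorm (quot f (?h n) z) * indicator {2 * x0<..} z) \<partial>lborel)"
    unfolding sigma_2F_f(2)[OF order_refl, symmetric] nn_integral_completion by (rule nn_integral_cong_AE)
  also have "\<dots> \<le> liminf (\<lambda>n. \<integral>\<^sup>+ z. enorm (quot f (?h n) z) * indicator {2 * x0<..} z \<partial>lborel)"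
    by (rule nn_integral_liminf) measurable
  also have "\<dots> \<le> liminf (\<lambda>n. K)"
    using K(2) unfolding tail_def by (intro Liminf_mono always_eventually) auto
  also have "\<dots> = K" by (simp add: Liminf_const)
  finally show ?thesis using K(1) by (rule le_less_trans)
qed

end

section \<open>The estimates\<close>

text \<open>
  For \<open>x > x\<^sub>0\<close> the derivative is two-sided, and the norm is the same for all admissible \<open>x\<^sub>0\<close>.
\<close>

lemma norm_Ax_interior:
  assumes "x0 < x"
  shows "norm_Ax x0 A x =
     (if (AE y in lebesgue. x < y \<longrightarrow> loc_abs_cont_on {x<..<y} (\<lambda>s. A s y) \<and> (\<lambda>s. A s y) differentiable (at x))
      then \<integral>\<^sup>+ y \<in> {x<..}. enorm (vector_derivative (\<lambda>s. A s y) (at x)) \<partial>lebesgue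
      else \<infinity>)"
proof -
  have at: "at x within {x0..y} = at x" if "x < y" for y
    using assms that by (rule at_within_Icc_at)
  have 1: "(\<lambda>y. x < y \<longrightarrow> loc_abs_cont_on {x<..<y} (\<lambda>s. A s y) \<and> (\<lambda>s. A s y) differentiable (at x within {x0..y}))
      = (\<lambda>y. x < y \<longrightarrow> loc_abs_cont_on {x<..<y} (\<lambda>s. A s y) \<and> (\<lambda>s. A s y) differentiable (at x))"
    using at by auto
  have 2: "(\<integral>\<^sup>+ y \<in> {x<..}. enorm (vector_derivative (\<lambda>s. A s y) (at x within {x0..y})) \<partial>lebesgue)
      = (\<integral>\<^sup>+ y \<in> {x<..}. enorm (vector_derivative (\<lambda>s. A s y) (at x)) \<partial>lebesgue)"
    by (intro nn_integral_cong) (auto simp: indicator_def at)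
  show ?thesis unfolding norm_Ax_def 1 2 ..
qed

lemma sigma_2F_finite_of_weighted:
  assumes ac: "loc_abs_cont_on {0<..} F"
    and fin: "(\<integral>\<^sup>+ x \<in> {0<..}. ennreal (x * norm (vector_derivative F (at x))) \<partial>lebesgue) < \<infinity>"
    and u: "0 < u"
  shows "sigma_2F F u < \<infinity>"
proof -
  obtain k where [measurable]: "k \<in> borel_measurable borel"
    and k: "AE z in lborel. 0 < z \<longrightarrow> (F has_vector_derivative k z) (at z)"
    using loc_abs_cont_borel_derivative[OF ac] by metis
  have eq: "AE z in lborel. 0 < z \<longrightarrow> vector_derivative F (at z) = k z"
    using k by eventually_elim (auto simp: vector_derivative_at)
  have "sigma_2F F u = tail k u"
    unfolding sigma_2F_def
    by (rule tail_lebesgue(1)) (use eq in eventually_elim, use u in auto)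
  have "ennreal u * tail k u = (\<integral>\<^sup>+ z. ennreal u * (enorm (k z) * indicator {u<..} z) \<partial>lborel)"
    unfolding tail_def by (rule nn_integral_cmult[symmetric]) measurable
  also have "\<dots> \<le> (\<integral>\<^sup>+ x \<in> {0<..}. ennreal (x * norm (vector_derivative F (at x))) \<partial>lborel)"
  proof (rule nn_integral_mono_AE)
    show "AE z in lborel. ennreal u * (enorm (k z) * indicator {u<..} z)
        \<le> ennreal (z * norm (vector_derivative F (at z))) * indicator {0<..} z"
      using eq
    proof eventually_elim
      case (elim z)
      show ?case
      proof (cases "u < z")
        case True
        then have "u * norm (k z) \<le> z * norm (k z)" by (intro mult_right_mono) auto
        then show ?thesis using True u elim by (simp add: ennreal_leI flip: ennreal_mult)
      qed simp
    qed
  qed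
  also have "\<dots> < \<infinity>" using fin by (simp add: nn_integral_completion)
  finally have "tail k u < \<infinity>" using u by (auto simp: ennreal_mult_less_top)
  with \<open>sigma_2F F u = tail k u\<close> show ?thesis by simp
qed

text \<open>
  The function \<open>F\<close> may be unbounded at \<open>0\<close>, and then \<open>F'\<close> is not integrable on \<open>(2x\<^sub>0, \<infinity>)\<close> if
  \<open>x\<^sub>0 = 0\<close>. The derivative estimates are therefore proved from a starting point \<open>x1\<close> in place of \<open>x\<^sub>0\<close>: any
  point strictly between \<open>x\<^sub>0\<close> and \<open>x\<close> if \<open>x > x\<^sub>0\<close>, so that the derivative at \<open>x\<close> is two-sided, and \<open>x\<^sub>0\<close>
  itself if \<open>x = x\<^sub>0\<close>, where the claim is trivial unless \<open>\<sigma>\<^sub>2\<^sub>F(2x\<^sub>0)\<close> is finite.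
\<close>

lemma estimates_of_A_by_F:
  fixes F :: "real \<Rightarrow> complex" and A :: "real \<Rightarrow> real \<Rightarrow> complex" and x0 :: real
  assumes x0: "0 \<le> x0"
    and small: "sigma_1F F (2 * x0) < 1"
    and A_int: "\<And>x. x0 \<le> x \<Longrightarrow> set_integrable lebesgue {x..} (A x)"
    and mar: "marchenko F A x0"
    and ac: "loc_abs_cont_on {0<..} F"
    and weight: "(\<integral>\<^sup>+ x \<in> {0<..}. ennreal (x * norm (vector_derivative F (at x))) \<partial>lebesgue) < \<infinity>"
  shows "\<exists>c::real. c > 0 \<and> (\<forall>x\<ge>x0.
         sigma_A A x \<le> ennreal c * sigma_F F (2 * x) \<and>
         sigma_1A A x \<le> ennreal c * sigma_1F F (2 * x) \<and>
         norm_Ay A x \<le> sigma_2F F (2 * x) * (1 + ennreal c * sigma_1F F (2 * x)) \<and>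
         norm_Ax x0 A x \<le> ennreal c *
           (sigma_2F F (2 * x) + sigma_1F F (2 * x) * sigma_F F (2 * x)))"
proof -
  define q where "q = enn2real (sigma_1F F (2 * x0))"
  have fin: "sigma_1F F (2 * x0) < top" using small by (rule order.strict_trans) simp
  have q: "0 \<le> q" "sigma_1F F (2 * x0) = ennreal q" using fin by (simp_all add: q_def)
  then have "q < 1" using small by simp
  have data: "marchenko_data F A x1 q" if "x0 \<le> x1" for x1
  proof
    show "sigma_1F F (2 * x1) \<le> ennreal q"
      using sigma_1F_antimono[of "2 * x0" "2 * x1" F] that q by simp
    show "marchenko F A x1" using mar that by (auto simp: marchenko_def)
    show "loc_abs_cont_on {2 * x1<..} F"
      by (rule loc_abs_cont_on_subset[OF ac]) (use x0 that in auto)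
  qed (use q \<open>q < 1\<close> A_int that in auto)
  define r where "r = 1 / (1 - q)"
  define s where "s = 1 + q / (1 - q) * (2 * (1 + q / (1 - q))) + q / (1 - q)"
  \<comment> \<open>\<open>r\<close> serves the bounds of \<open>A\<close> and \<open>A\<^sub>y\<close>, and \<open>s\<close> that of \<open>A\<^sub>x\<close>.\<close>
  define c where "c = r + s"
  have rs: "0 < r" "0 < s" using q(1) \<open>q < 1\<close> by (auto simp: r_def s_def intro!: add_pos_nonneg)
  then have c: "0 < c" "ennreal r \<le> ennreal c" "ennreal s \<le> ennreal c" by (auto simp: c_def intro: ennreal_leI)
  show ?thesis
  proof (intro exI[of _ c] conjI allI impI c(1))
    fix x assume x: "x0 \<le> x"
    interpret d0: marchenko_data F A x0 q by (rule data) simp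
    show "sigma_A A x \<le> ennreal c * sigma_F F (2 * x)"
      using d0.sigma_A_le[OF x] c(2) unfolding r_def[symmetric] by (meson mult_right_mono order.trans zero_le)
    show 1: "sigma_1A A x \<le> ennreal c * sigma_1F F (2 * x)"
      using d0.sigma_1A_le[OF x] c(2) unfolding r_def[symmetric] by (meson mult_right_mono order.trans zero_le)
    have "norm_Ay A x \<le> sigma_2F F (2 * x) * (1 + sigma_1A A x) \<and> norm_Ax x0 A x \<le> ennreal s * sigma_2F F (2 * x)"
      if top: "sigma_2F F (2 * x) < \<infinity>"
    proof -
      obtain x1 where x1: "x0 \<le> x1" "x1 \<le> x" "x1 = x0 \<or> x1 < x" "sigma_2F F (2 * x1) < \<infinity>"
      proof (cases "x = x0")
        case True
        then show ?thesis using that[of x0] top by simp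
      next
        case False
        have e: "2 * ((x0 + x) / 2) = x0 + x" by simp
        show ?thesis
        proof (rule that[of "(x0 + x) / 2"])
          show "sigma_2F F (2 * ((x0 + x) / 2)) < \<infinity>"
            unfolding e by (rule sigma_2F_finite_of_weighted[OF ac weight]) (use False x x0 in auto)
        qed (use False x in auto)
      qed
      interpret d1: marchenko_data F A x1 q by (rule data[OF x1(1)])
      have "norm_Ax x0 A x = norm_Ax x1 A x"
        using x1(1,3) norm_Ax_interior[of x0 x A] norm_Ax_interior[of x1 x A] by auto
      then show ?thesis
        using d1.norm_Ay_le[OF x1(4,2)] d1.norm_Ax_le[OF x1(4,2)] by (simp add: s_def d1.B_def)
    qed
    note bounds = this
    show "norm_Ay A x \<le> sigma_2F F (2 * x) * (1 + ennreal c * sigma_1F F (2 * x))"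
    proof (cases "sigma_2F F (2 * x) < \<infinity>")
      case True
      have "norm_Ay A x \<le> sigma_2F F (2 * x) * (1 + sigma_1A A x)" using bounds[OF True] ..
      also have "\<dots> \<le> sigma_2F F (2 * x) * (1 + ennreal c * sigma_1F F (2 * x))"
        by (intro mult_left_mono add_left_mono 1) auto
      finally show ?thesis .
    next
      case False
      then show ?thesis by (simp add: less_top[symmetric] ennreal_top_mult)
    qed
    show "norm_Ax x0 A x \<le> ennreal c * (sigma_2F F (2 * x) + sigma_1F F (2 * x) * sigma_F F (2 * x))"
    proof (cases "sigma_2F F (2 * x) < \<infinity>")
      case True
      have "norm_Ax x0 A x \<le> ennreal s * sigma_2F F (2 * x)" using bounds[OF True] ..
      also have "\<dots> \<le> ennreal c * (sigma_2F F (2 * x) + sigma_1F F (2 * x) * sigma_F F (2 * x))"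
        by (intro mult_mono c) auto
      finally show ?thesis .
    next
      case False
      then show ?thesis using c(1) by (simp add: less_top[symmetric] ennreal_mult_top)
    qed
  qed
qed

lemma estimates_of_F_by_A:
  fixes F :: "real \<Rightarrow> complex" and A :: "real \<Rightarrow> real \<Rightarrow> complex" and x0 :: real
  assumes small: "sigma_1F F (2 * x0) < 1"
    and A_int: "\<And>x. x0 \<le> x \<Longrightarrow> set_integrable lebesgue {x..} (A x)"
    and mar: "marchenko F A x0"
    and ac: "loc_abs_cont_on {2 * x0<..} F"
    and A_fin: "sigma_A A x0 < \<infinity>" and Ay_fin: "\<And>x. x0 \<le> x \<Longrightarrow> norm_Ay A x < \<infinity>"
  shows "\<exists>c::real. c > 0 \<and> (\<forall>x\<ge>x0.
         sigma_F F (2 * x) \<le> ennreal c * sigma_A A x \<and>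
         (\<integral>\<^sup>+ v \<in> {2 * x..}. enorm (F v) \<partial>lebesgue) \<le> ennreal c * sigma_1A A x \<and>
         sigma_2F F (2 * x) \<le> ennreal c *
           (sigma_A A x * sigma_1A A x + norm_Ax x0 A x * (1 + sigma_1A A x)))"
proof -
  define q where "q = enn2real (sigma_1F F (2 * x0))"
  have fin: "sigma_1F F (2 * x0) < top" using small by (rule order.strict_trans) simp
  have q: "0 \<le> q" "sigma_1F F (2 * x0) = ennreal q" using fin by (simp_all add: q_def)
  then have "q < 1" using small by simp
  interpret marchenko_data F A x0 q
    by unfold_locales (use q \<open>q < 1\<close> A_int mar ac in auto)
  have F_fin: "sigma_2F F (2 * x0) < \<infinity>" by (rule sigma_2F_finite[OF Ay_fin A_fin])
  show ?thesis
  proof (intro exI[of _ "1 + q"] conjI allI impI)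
    show "0 < 1 + q" using q by simp
    fix x assume x: "x0 \<le> x"
    show "sigma_F F (2 * x) \<le> ennreal (1 + q) * sigma_A A x" by (rule sigma_F_le[OF x])
    show "(\<integral>\<^sup>+ v \<in> {2 * x..}. enorm (F v) \<partial>lebesgue) \<le> ennreal (1 + q) * sigma_1A A x"
      using tail_f_le_sigma_1A[OF x] x by (simp add: tail_f_eq)
    have "sigma_2F F (2 * x) \<le> ennreal (1 + q) * (norm_Ax x0 A x + sigma_A A x * sigma_1A A x)"
      by (rule sigma_2F_le[OF F_fin x])
    also have "\<dots> \<le> ennreal (1 + q) * (sigma_A A x * sigma_1A A x + norm_Ax x0 A x * (1 + sigma_1A A x))"
      by (intro mult_left_mono) (auto simp: distrib_left add.commute add.left_commute add_increasing)
    finally show "sigma_2F F (2 * x)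
        \<le> ennreal (1 + q) * (sigma_A A x * sigma_1A A x + norm_Ax x0 A x * (1 + sigma_1A A x))" .
  qed
qed

theorem theorem2p1:
  fixes F :: "real \<Rightarrow> complex" and A :: "real \<Rightarrow> real \<Rightarrow> complex" and x0 :: real
  assumes "0 \<le> x0"
    and "sigma_1F F (2 * x0) < 1"
    and "\<And>x. x0 \<le> x \<Longrightarrow> set_integrable lebesgue {x..} (A x)"
    and "marchenko F A x0"
  shows
    "(sigma_1F F 0 < \<infinity> \<and>
      loc_abs_cont_on {0<..} F \<and>
      (\<integral>\<^sup>+ x \<in> {0<..}. ennreal (x * norm (vector_derivative F (at x))) \<partial>lebesgue) < \<infinity>
      \<longrightarrow>
      (\<exists>c::real. c > 0 \<and> (\<forall>x\<ge>x0.
         sigma_A A x \<le> ennreal c * sigma_F F (2 * x) \<and>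
         sigma_1A A x \<le> ennreal c * sigma_1F F (2 * x) \<and>
         norm_Ay A x \<le> sigma_2F F (2 * x) * (1 + ennreal c * sigma_1F F (2 * x)) \<and>
         norm_Ax x0 A x \<le> ennreal c *
           (sigma_2F F (2 * x) + sigma_1F F (2 * x) * sigma_F F (2 * x)))))
     \<and>
     (loc_abs_cont_on {2 * x0<..} F \<and>
      (\<forall>x\<ge>x0. sigma_A A x + sigma_1A A x + norm_Ax x0 A x + norm_Ay A x < \<infinity>)
      \<longrightarrow>
      (\<exists>c::real. c > 0 \<and> (\<forall>x\<ge>x0.
         sigma_F F (2 * x) \<le> ennreal c * sigma_A A x \<and>
         (\<integral>\<^sup>+ v \<in> {2 * x..}. ennreal (norm (F v)) \<partial>lebesgue) \<le> ennreal c * sigma_1A A x \<and>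
         sigma_2F F (2 * x) \<le> ennreal c *
           (sigma_A A x * sigma_1A A x + norm_Ax x0 A x * (1 + sigma_1A A x)))))"
proof (intro conjI impI, goal_cases)
  case 1
  then show ?case using assms by (intro estimates_of_A_by_F) auto
next
  case 2
  then have "sigma_A A x < \<infinity> \<and> norm_Ay A x < \<infinity>" if "x0 \<le> x" for x
    using that by auto
  with 2 show ?case using assms by (intro estimates_of_F_by_A) auto
qed

end
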